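(* Let $(\Omega,\mathcal F,\mu)$ be a probability space and $m\in\mathbb N$. The couple $\big(U^1_m(\Omega^\infty,\ell^1),\,U^1_m(\Omega^\infty,\ell^2)\big)$ is $K$-closed in $\big(L^1(\Omega^\infty,\ell^1),\,L^1(\Omega^\infty,\ell^2)\big)$.
   Context: $\Omega^\infty=\Omega^{\mathbb N}$ carries the product probability measure. $U^2_{\le m}(\Omega^\infty)\subset L^2(\Omega^\infty)$ is the closed span of the functions in $L^2(\Omega^\infty)$ depending on at most $m$ coordinates, $U^2_0=U^2_{\le0}$ (constants), $U^2_m=U^2_{\le m}\cap(U^2_{\le m-1})^\perp$ for $m\ge1$, and $U^1_m(\Omega^\infty)$ is the closure of $U^2_m$ in $L^1(\Omega^\infty)$. For a Banach space $B$, $U^1_m(\Omega^\infty,B)$ is the closure of $U^1_m(\Omega^\infty)\otimes B$ in the Bochner space $L^1(\Omega^\infty,B)$. For a compatible couple $(X_0,X_1)$ of Banach spaces, $K(f,t;X_0,X_1)=\inf_{f=f_0+f_1}\|f_0\|_{X_0}+t\|f_1\|_{X_1}$ for $f\in X_0+X_1$, $t>0$. For closed subspaces $Y_0\subset X_0$, $Y_1\subset X_1$ (with inherited norms), $(Y_0,Y_1)$ is $K$-closed in $(X_0,X_1)$ if there is a constant $C$ with $K(f,t;Y_0,Y_1)\le C\,K(f,t;X_0,X_1)$ for all $f\in Y_0+Y_1$ and $t>0$. *)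

theory Defs
  imports "HOL-Probability.Probability" "HOL-Library.Function_Algebras"
begin

text \<open>
  The scalar field is a type of sort \<open>{real_normed_field, euclidean_space}\<close>. The field norm is
  multiplicative and comes from an inner product, so the scalars are the reals or the complex
  numbers.

  Elements of Lebesgue and Bochner spaces are represented by functions, not by classes of functions
  modulo almost everywhere equality, and the norms are therefore seminorms. All the function spaces
  below contain, with a function, every other function of the same Lebesgue or Bochner space that
  is almost everywhere equal to it. A decomposition \<open>f = f0 + f1\<close> of classes can therefore
  always be realised as a pointwise identity between representatives.
\<close>


section \<open>Closed spans and the K-functional\<close>

text \<open>The closure of \<open>S\<close> in the space \<open>X\<close> with (semi)norm \<open>N\<close>.\<close>

definition norm_closure :: "'v::ab_group_add set \<Rightarrow> ('v \<Rightarrow> real) \<Rightarrow> 'v set \<Rightarrow> 'v set" where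
  "norm_closure X N S = {f \<in> X. \<forall>e>0. \<exists>g\<in>S. N (f - g) < e}"

definition K_functional ::
    "'v::ab_group_add set \<Rightarrow> ('v \<Rightarrow> real) \<Rightarrow> 'v set \<Rightarrow> ('v \<Rightarrow> real) \<Rightarrow> 'v \<Rightarrow> real \<Rightarrow> real" where
  "K_functional X0 N0 X1 N1 f t =
     Inf {N0 f0 + t * N1 f1 | f0 f1. f0 \<in> X0 \<and> f1 \<in> X1 \<and> f = f0 + f1}"

text \<open>The subspaces \<open>Y0\<close> of \<open>X0\<close> and \<open>Y1\<close> of \<open>X1\<close> carry the inherited norms \<open>N0\<close>, \<open>N1\<close>.\<close>

definition K_closed ::
    "'v::ab_group_add set \<Rightarrow> 'v set \<Rightarrow> 'v set \<Rightarrow> ('v \<Rightarrow> real) \<Rightarrow> 'v set \<Rightarrow> ('v \<Rightarrow> real) \<Rightarrow> bool" where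
  "K_closed Y0 Y1 X0 N0 X1 N1 \<longleftrightarrow>
     (\<exists>C. \<forall>f \<in> {f0 + f1 | f0 f1. f0 \<in> Y0 \<and> f1 \<in> Y1}. \<forall>t>0.
        K_functional Y0 N0 Y1 N1 f t \<le> C * K_functional X0 N0 X1 N1 f t)"


section \<open>Lebesgue and Bochner spaces\<close>

definition scale_fun :: "'k::field \<Rightarrow> ('w \<Rightarrow> 'k) \<Rightarrow> 'w \<Rightarrow> 'k" where
  "scale_fun c f = (\<lambda>x. c * f x)"

definition scale_vfun :: "'k::field \<Rightarrow> ('w \<Rightarrow> nat \<Rightarrow> 'k) \<Rightarrow> 'w \<Rightarrow> nat \<Rightarrow> 'k" where
  "scale_vfun c f = (\<lambda>x. scale_fun c (f x))"

lemma vector_space_scale_fun: "vector_space scale_fun"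
  by unfold_locales (auto simp: scale_fun_def fun_eq_iff algebra_simps)

lemma vector_space_scale_vfun: "vector_space scale_vfun"
  by unfold_locales (auto simp: scale_vfun_def scale_fun_def fun_eq_iff algebra_simps)

definition L1 :: "'w measure \<Rightarrow> ('w \<Rightarrow> 'k::{real_normed_field, euclidean_space}) set" where
  "L1 P = {f. integrable P f}"

definition L1_norm :: "'w measure \<Rightarrow> ('w \<Rightarrow> 'k::{real_normed_field, euclidean_space}) \<Rightarrow> real" where
  "L1_norm P f = (\<integral>x. norm (f x) \<partial>P)"

definition L2 :: "'w measure \<Rightarrow> ('w \<Rightarrow> 'k::{real_normed_field, euclidean_space}) set" where
  "L2 P = {f \<in> borel_measurable P. integrable P (\<lambda>x. (norm (f x))\<^sup>2)}"

definition L2_norm :: "'w measure \<Rightarrow> ('w \<Rightarrow> 'k::{real_normed_field, euclidean_space}) \<Rightarrow> real" where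
  "L2_norm P f = sqrt (\<integral>x. (norm (f x))\<^sup>2 \<partial>P)"

text \<open>
  Orthogonality with respect to the inner product of \<open>L2\<close> that is linear over the scalar field.
  On complex numbers \<open>inner a b = Re (a * cnj b)\<close>; quantifying over \<open>c\<close> therefore makes the whole
  Hermitian product vanish and not only its real part.
\<close>

definition L2_orthogonal ::
    "'w measure \<Rightarrow> ('w \<Rightarrow> 'k::{real_normed_field, euclidean_space}) \<Rightarrow> ('w \<Rightarrow> 'k) \<Rightarrow> bool" where
  "L2_orthogonal P f g \<longleftrightarrow> (\<forall>c. (\<integral>x. inner (c * f x) (g x) \<partial>P) = 0)"

lemma L2_orthogonal_real:
  fixes f g :: "'w \<Rightarrow> real"
  shows "L2_orthogonal P f g \<longleftrightarrow> (\<integral>x. f x * g x \<partial>P) = 0"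
  by (auto simp: L2_orthogonal_def mult.assoc dest: spec[of _ 1])

lemma L2_orthogonal_complex:
  fixes f g :: "'w \<Rightarrow> complex"
  assumes "integrable P (\<lambda>x. f x * cnj (g x))"
  shows "L2_orthogonal P f g \<longleftrightarrow> (\<integral>x. f x * cnj (g x) \<partial>P) = 0"
proof -
  define I where "I = (\<integral>x. f x * cnj (g x) \<partial>P)"
  have eq: "(\<integral>x. inner (c * f x) (g x) \<partial>P) = Re (c * I)" for c
  proof -
    have "(\<integral>x. inner (c * f x) (g x) \<partial>P) = (\<integral>x. Re (c * (f x * cnj (g x))) \<partial>P)"
      by (intro Bochner_Integration.integral_cong) (auto simp: inner_complex_def algebra_simps)
    also have "\<dots> = Re (\<integral>x. c * (f x * cnj (g x)) \<partial>P)"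
      using assms by (intro integral_Re integrable_mult_right) auto
    finally show ?thesis
      by (simp add: I_def)
  qed
  have "(\<forall>c. Re (c * I) = 0) \<longleftrightarrow> I = 0"
  proof
    assume "\<forall>c. Re (c * I) = 0"
    from this[rule_format, of 1] this[rule_format, of "\<i>"] show "I = 0"
      by (simp add: complex_eq_iff)
  qed simp
  then show ?thesis
    by (simp add: L2_orthogonal_def eq I_def)
qed

definition lp_space :: "real \<Rightarrow> (nat \<Rightarrow> 'k::real_normed_field) set" where
  "lp_space p = {b. summable (\<lambda>n. norm (b n) powr p)}"

definition lp_norm :: "real \<Rightarrow> (nat \<Rightarrow> 'k::real_normed_field) \<Rightarrow> real" where
  "lp_norm p b = (\<Sum>n. norm (b n) powr p) powr (1 / p)"

text \<open>
  The Bochner space of functions with values in the Banach space \<open>B\<close> with norm \<open>N\<close>: those functions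
  of integrable norm that are pointwise limits of \<open>B\<close>-valued simple functions. The library's
  Bochner integral takes the value space to be a type; here the couple needs both value
  spaces inside one type of sequences.
\<close>

definition strongly_measurable ::
    "'w measure \<Rightarrow> 'b::ab_group_add set \<Rightarrow> ('b \<Rightarrow> real) \<Rightarrow> ('w \<Rightarrow> 'b) \<Rightarrow> bool" where
  "strongly_measurable P B N f \<longleftrightarrow>
     (\<forall>x\<in>space P. f x \<in> B) \<and>
     (\<exists>s. (\<forall>i. simple_function P (s i) \<and> s i ` space P \<subseteq> B) \<and>
          (\<forall>x\<in>space P. (\<lambda>i. N (f x - s i x)) \<longlonglongrightarrow> 0))"

definition bochner_L1 ::
    "'w measure \<Rightarrow> 'b::ab_group_add set \<Rightarrow> ('b \<Rightarrow> real) \<Rightarrow> ('w \<Rightarrow> 'b) set" where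
  "bochner_L1 P B N = {f. strongly_measurable P B N f \<and> integrable P (\<lambda>x. N (f x))}"

definition bochner_L1_norm ::
    "'w measure \<Rightarrow> ('b \<Rightarrow> real) \<Rightarrow> ('w \<Rightarrow> 'b) \<Rightarrow> real" where
  "bochner_L1_norm P N f = (\<integral>x. N (f x) \<partial>P)"


section \<open>The homogeneous subspaces of the infinite product\<close>

definition infinite_power :: "'a measure \<Rightarrow> (nat \<Rightarrow> 'a) measure" where
  "infinite_power M = (\<Pi>\<^sub>M i\<in>UNIV. M)"

definition depends_on :: "(nat \<Rightarrow> 'a) measure \<Rightarrow> nat set \<Rightarrow> ((nat \<Rightarrow> 'a) \<Rightarrow> 'b) \<Rightarrow> bool" where
  "depends_on P A f \<longleftrightarrow>
     (\<forall>x\<in>space P. \<forall>y\<in>space P. (\<forall>i\<in>A. x i = y i) \<longrightarrow> f x = f y)"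

definition U2_le ::
    "'a measure \<Rightarrow> nat \<Rightarrow> ((nat \<Rightarrow> 'a) \<Rightarrow> 'k::{real_normed_field, euclidean_space}) set" where
  "U2_le M m =
     norm_closure (L2 (infinite_power M)) (L2_norm (infinite_power M))
       (module.span scale_fun
          {f \<in> L2 (infinite_power M).
             \<exists>A. finite A \<and> card A \<le> m \<and> depends_on (infinite_power M) A f})"

fun U2 ::
    "'a measure \<Rightarrow> nat \<Rightarrow> ((nat \<Rightarrow> 'a) \<Rightarrow> 'k::{real_normed_field, euclidean_space}) set" where
  "U2 M 0 = U2_le M 0"
| "U2 M (Suc m) =
     {f \<in> U2_le M (Suc m). \<forall>g \<in> U2_le M m. L2_orthogonal (infinite_power M) f g}"

definition U1 ::
    "'a measure \<Rightarrow> nat \<Rightarrow> ((nat \<Rightarrow> 'a) \<Rightarrow> 'k::{real_normed_field, euclidean_space}) set" where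
  "U1 M m = norm_closure (L1 (infinite_power M)) (L1_norm (infinite_power M)) (U2 M m)"

text \<open>
  For a Banach space \<open>B\<close> of scalar sequences with norm \<open>N\<close>; the elementary tensor of \<open>f\<close> and \<open>b\<close>
  is the function \<open>\<lambda>x. scale_fun (f x) b\<close>.
\<close>

definition U1_vec ::
    "'a measure \<Rightarrow> nat \<Rightarrow> (nat \<Rightarrow> 'k::{real_normed_field, euclidean_space}) set
       \<Rightarrow> ((nat \<Rightarrow> 'k) \<Rightarrow> real) \<Rightarrow> ((nat \<Rightarrow> 'a) \<Rightarrow> nat \<Rightarrow> 'k) set" where
  "U1_vec M m B N =
     norm_closure (bochner_L1 (infinite_power M) B N) (bochner_L1_norm (infinite_power M) N)
       (module.span scale_vfun {\<lambda>x. scale_fun (f x) b | f b. f \<in> U1 M m \<and> b \<in> B})"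

end

theory Submission
  imports Defs "HOL-Computational_Algebra.Polynomial"
begin

text \<open>
  The problem reduces to functions on a finite product of finite probability spaces: elements of
  the two homogeneous spaces are approximated by sequences \<open>f\<^sup>n\<close>, \<open>n < d\<close>, of homogeneous functions
  of finitely many coordinates that take finitely many values, \<open>f\<^sup>n = (\<Sum>A. f\<^sup>n\<^sub>A)\<close>, where \<open>A\<close> ranges
  over the sets of \<open>m\<close> coordinates, \<open>f\<^sup>n\<^sub>A\<close> depends on the coordinates in \<open>A\<close> only and has mean zero in
  each of them (\<open>common_homogeneous_approx\<close>). The K-functional of the large couple is bounded below
  by pairing: if \<open>\<bar>G\<^sup>n\<bar> \<le> 1\<close> and \<open>(\<Sum>n. \<bar>G\<^sup>n\<bar>\<^sup>2) \<le> t\<^sup>2\<close> everywhere, then the expectation \<open>E\<langle>G, f\<rangle>\<close> is at most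
  \<open>\<parallel>k0\<parallel> + t \<parallel>k1\<parallel>\<close> whenever \<open>f = k0 + k1\<close>. It is therefore enough to find, with constants that depend
  on \<open>m\<close> only, a homogeneous decomposition \<open>f = g0 + g1\<close> together with such a \<open>G\<close> for which
  \<open>\<parallel>g0\<parallel> + t \<parallel>g1\<parallel> \<le> C E\<langle>G, f\<rangle>\<close>. This is \<open>finite_decomposition\<close>.

  Both objects come from a convex optimisation problem. Attach a weight \<open>w\<^sub>b(x\<^sub>b) \<ge> 0\<close> to each set \<open>b\<close>
  of at most \<open>m\<close> coordinates and each value \<open>x\<^sub>b\<close> of these coordinates, one family of weights for
  each \<open>n\<close> and one further family that is shared by all \<open>n\<close>. For each \<open>n\<close> let \<open>W\<^sub>A\<close> be the sum over
  \<open>b \<subseteq> A\<close> of the weights for \<open>n\<close> and the shared weights, and let \<open>\<phi>\<^sub>A = f\<^sub>A / W\<^sub>A\<close>. Minimising the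
  expectation of the sum of the \<open>\<bar>f\<^sub>A\<bar>\<^sup>2 / W\<^sub>A\<close> plus the cost of
  the weights, where the shared weights cost \<open>t\<^sup>2\<close> and the others \<open>1\<close>, gives first-order conditions of
  the following kind (\<open>packing_weights\<close>): given \<open>x\<^sub>b\<close>, the expectation of \<open>\<Sum>A\<supseteq>b. \<bar>\<phi>\<^sub>A\<bar>\<^sup>2\<close> is bounded
  by a constant for each \<open>n\<close>, and by a constant times \<open>t\<^sup>2\<close> when summed over \<open>n\<close>; and the total cost of
  the weights is at most a constant times \<open>E\<langle>f, \<phi>\<rangle>\<close>.

  \<^item> The weights split \<open>f\<^sub>A = (\<Sum>b\<subseteq>A. w\<^sub>b \<phi>\<^sub>A)\<close>, the individual weights contributing to \<open>g0\<close> and the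
    shared ones to \<open>g1\<close>. For fixed \<open>b\<close> the functions \<open>\<phi>\<^sub>A\<close>, centred in the coordinates outside \<open>b\<close>,
    are orthogonal given \<open>x\<^sub>b\<close>, so the packing condition bounds the norm of \<open>\<Sum>A\<supseteq>b. w\<^sub>b \<phi>\<^sub>A\<close> by the
    cost of \<open>w\<^sub>b\<close> (\<open>class_bound\<close>). Hence \<open>\<parallel>g0\<parallel> + t \<parallel>g1\<parallel>\<close> is controlled by \<open>E\<langle>f, \<phi>\<rangle>\<close>.

  \<^item> Let \<open>Q\<^sup>n = (\<Sum>A. \<bar>\<phi>\<^sup>n\<^sub>A\<bar>\<^sup>2)\<close>. Given \<open>x\<^sub>A\<close>, sorting the sets \<open>B\<close> by \<open>A \<inter> B\<close> shows that the expectation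
    of \<open>Q\<^sup>n\<close> is bounded (\<open>mean_packed_sum\<close>). By Markov's inequality at least half of \<open>E\<langle>f\<^sub>A, \<phi>\<^sub>A\<rangle>\<close>,
    whose integrand is nonnegative, lives where \<open>Q\<^sup>n\<close> and \<open>\<Sum>n. Q\<^sup>n\<close> are at most a constant and a
    constant times \<open>t\<^sup>2\<close>. There Cauchy-Schwarz gives \<open>E\<langle>f, \<phi>\<rangle> \<le> 2 E(\<Sum>n. \<theta>\<^sup>n S\<^sup>n)\<close> with
    \<open>S\<^sup>n = (\<Sum>A. \<bar>f\<^sup>n\<^sub>A\<bar>\<^sup>2)\<^sup>1\<^sup>/\<^sup>2\<close> and with \<open>\<theta>\<close> satisfying the two bounds required of \<open>G\<close>.

  \<^item> Square functions are replaced by \<open>f\<close> itself in \<open>dual_lift\<close>. By Khinchine's inequality for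
    Rademacher chaos, \<open>S\<^sup>n\<close> is at most a constant times the average over signs of
    \<open>\<bar>\<Sum>A. (\<Prod>i\<in>A. \<epsilon>\<^sub>i) f\<^sup>n\<^sub>A\<bar>\<close>. A noise operator multiplies \<open>f\<^sub>A\<close> by \<open>\<Prod>i\<in>A. r\<^sub>i\<close> with \<open>0 \<le> r\<^sub>i \<le> 1\<close>; for
    \<open>r\<^sub>i = (1 + \<epsilon>\<^sub>i / 2\<^sup>j) / 2\<close> this product is a polynomial of degree \<open>m\<close> in \<open>2\<^sup>-\<^sup>j\<close> with top coefficient
    \<open>2\<^sup>-\<^sup>m (\<Prod>i\<in>A. \<epsilon>\<^sub>i)\<close>, and a fixed linear combination over \<open>j \<le> m\<close> extracts it. Noise operators are
    self-adjoint and average over points, so when moved to the other side of the pairing they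
    preserve the pointwise bounds. The result is \<open>G\<close>.
\<close>

section \<open>Optimal weights\<close>

lemma compact_box_fun:
  fixes B :: "'i \<Rightarrow> real"
  shows "compact {w. \<forall>i. 0 \<le> w i \<and> w i \<le> B i}"
proof -
  have "compactin (product_topology (\<lambda>_. euclidean) UNIV) (PiE UNIV (\<lambda>i. {0..B i}))"
    by (subst compactin_PiE) auto
  moreover have "PiE UNIV (\<lambda>i. {0..B i}) = {w. \<forall>i. 0 \<le> w i \<and> w i \<le> B i}"
    by (auto simp: PiE_UNIV_domain)
  ultimately show ?thesis
    by (metis compactin_euclidean_iff euclidean_product_topology)
qed

text \<open>
  The weights minimise the convex function \<open>J w = (\<Sum>x\<in>X. a x / V w x) + (\<Sum>i\<in>I. c i * w i)\<close>, where
  \<open>V w x\<close> is \<open>\<eta>\<close> plus the sum of the weights incident with \<open>x\<close>. Increasing a single weight cannot lower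
  \<open>J\<close>, which gives the first estimate; shrinking all of them cannot either, which gives the second. The
  shift \<open>\<eta>\<close> keeps the denominators positive. Finite perturbations replace derivatives, which costs
  the factors \<open>2\<close>.
\<close>

lemma optimal_weights:
  fixes a :: "'x \<Rightarrow> real" and c :: "'i \<Rightarrow> real" and R :: "'i \<Rightarrow> 'x \<Rightarrow> bool"
  assumes fin: "finite X" "finite I"
    and a: "\<And>x. x \<in> X \<Longrightarrow> 0 \<le> a x" and c: "\<And>i. i \<in> I \<Longrightarrow> 0 \<le> c i"
    and null: "\<And>i x. i \<in> I \<Longrightarrow> x \<in> X \<Longrightarrow> c i = 0 \<Longrightarrow> R i x \<Longrightarrow> a x = 0"
    and "0 < \<eta>"
  obtains w where "\<And>i. 0 \<le> w i"
    and "\<And>i. i \<in> I \<Longrightarrow>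
      (\<Sum>x | x \<in> X \<and> R i x. a x / (\<eta> + (\<Sum>j | j \<in> I \<and> R j x. w j))\<^sup>2) \<le> 2 * c i"
    and "(\<Sum>i\<in>I. c i * w i) \<le> 2 * (\<Sum>x\<in>X. a x / (\<eta> + (\<Sum>j | j \<in> I \<and> R j x. w j)))"
proof -
  define V where "V w x = \<eta> + (\<Sum>j | j \<in> I \<and> R j x. w j)" for w :: "'i \<Rightarrow> real" and x
  define J where "J w = (\<Sum>x\<in>X. a x / V w x) + (\<Sum>i\<in>I. c i * w i)" for w
  define J0 where "J0 = J (\<lambda>_. 0)"
  \<comment> \<open>A minimiser has \<open>c i * w i \<le> J0\<close>, so the box leaves room for increasing each weight by \<open>\<eta>\<close>.\<close>
  define B where "B i = (if i \<in> I \<and> 0 < c i then J0 / c i + \<eta> else 0)" for i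
  define K where "K = {w. \<forall>i. 0 \<le> w i \<and> w i \<le> B i}"
  have J0: "0 \<le> J0"
    unfolding J0_def J_def V_def using a \<open>0 < \<eta>\<close> by (auto intro!: sum_nonneg divide_nonneg_nonneg)
  have B: "0 \<le> B i" for i
    using J0 \<open>0 < \<eta>\<close> by (auto simp: B_def)
  have Vpos: "\<eta> \<le> V w x" if "\<forall>i. 0 \<le> w i" for w x
    using that by (auto simp: V_def intro!: sum_nonneg)
  have "compact K"
    unfolding K_def by (rule compact_box_fun)
  moreover have "K \<noteq> {}"
    using B by (auto simp: K_def intro!: exI[of _ "\<lambda>_. 0"])
  moreover have "continuous_on K J"
    unfolding J_def
  proof (intro continuous_intros continuous_on_divide)
    show "continuous_on K (\<lambda>w. V w x)" for x
      unfolding V_def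
      by (intro continuous_intros continuous_on_subset[OF continuous_on_product_coordinates]) auto
    show "\<forall>w\<in>K. V w x \<noteq> 0" for x
    proof
      fix w assume "w \<in> K"
      then show "V w x \<noteq> 0"
        using Vpos[of w x] \<open>0 < \<eta>\<close> by (auto simp: K_def)
    qed
  qed (auto intro: continuous_on_subset[OF continuous_on_product_coordinates])
  ultimately obtain w where w: "w \<in> K" and wmin: "\<And>v. v \<in> K \<Longrightarrow> J w \<le> J v"
    using continuous_attains_inf[of K J] by blast
  have wB: "0 \<le> w i" "w i \<le> B i" for i
    using w by (auto simp: K_def)
  have V: "\<eta> \<le> V w x" "0 < V w x" for x
    using Vpos[of w x] wB \<open>0 < \<eta>\<close> by auto
  have "J w \<le> J0"
    unfolding J0_def by (rule wmin) (use B in \<open>auto simp: K_def\<close>)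
  have cw: "c i * w i \<le> J0" if "i \<in> I" for i
  proof -
    have "c i * w i \<le> (\<Sum>i\<in>I. c i * w i)"
      using that fin c wB by (intro member_le_sum) auto
    also have "\<dots> \<le> J w"
      unfolding J_def using a V by (auto intro!: sum_nonneg divide_nonneg_pos)
    finally show ?thesis using \<open>J w \<le> J0\<close> by simp
  qed
  show thesis
  proof (rule that[of w])
    show "0 \<le> w i" for i by (rule wB)
    show "(\<Sum>x | x \<in> X \<and> R i x. a x / (\<eta> + (\<Sum>j | j \<in> I \<and> R j x. w j))\<^sup>2) \<le> 2 * c i"
      if i: "i \<in> I" for i
    proof (cases "c i = 0")
      case True
      have "(\<Sum>x | x \<in> X \<and> R i x. a x / (\<eta> + (\<Sum>j | j \<in> I \<and> R j x. w j))\<^sup>2) = 0"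
        by (intro sum.neutral) (use null[OF i _ True] in auto)
      then show ?thesis using True by simp
    next
      case False
      then have ci: "0 < c i" using c[OF i] by simp
      \<comment> \<open>The step \<open>\<eta>\<close> at most doubles the denominator, since \<open>\<eta> \<le> V w x\<close>.\<close>
      define v where "v = w(i := w i + \<eta>)"
      have "w i \<le> J0 / c i"
        using cw[OF i] ci by (simp add: field_simps)
      then have "v i \<le> B i"
        using i ci by (simp add: v_def B_def)
      then have "v j \<le> B j" "0 \<le> v j" for j
        using wB[of j] \<open>0 < \<eta>\<close> by (cases "j = i"; simp add: v_def)+
      then have "v \<in> K" by (simp add: K_def)
      then have le: "J w \<le> J v" by (rule wmin)
      have Vv: "V v x = V w x + (if R i x then \<eta> else 0)" for x
      proof (cases "R i x")
        case True
        then have "i \<in> {j. j \<in> I \<and> R j x}" using i by simp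
        then have "(\<Sum>j | j \<in> I \<and> R j x. v j) = v i + (\<Sum>j\<in>{j. j \<in> I \<and> R j x} - {i}. v j)"
          "(\<Sum>j | j \<in> I \<and> R j x. w j) = w i + (\<Sum>j\<in>{j. j \<in> I \<and> R j x} - {i}. w j)"
          using fin by (auto intro!: sum.remove)
        moreover have "(\<Sum>j\<in>{j. j \<in> I \<and> R j x} - {i}. v j) = (\<Sum>j\<in>{j. j \<in> I \<and> R j x} - {i}. w j)"
          by (intro sum.cong) (auto simp: v_def)
        ultimately show ?thesis using True by (simp add: V_def v_def)
      next
        case False
        then have "(\<Sum>j | j \<in> I \<and> R j x. v j) = (\<Sum>j | j \<in> I \<and> R j x. w j)"
          by (intro sum.cong) (auto simp: v_def)
        then show ?thesis using False by (simp add: V_def)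
      qed
      have cv: "(\<Sum>i\<in>I. c i * v i) = (\<Sum>i\<in>I. c i * w i) + c i * \<eta>"
      proof -
        have "(\<Sum>i\<in>I. c i * v i) = (\<Sum>j\<in>I. c j * w j + (if j = i then c i * \<eta> else 0))"
          by (intro sum.cong) (auto simp: v_def algebra_simps)
        then show ?thesis using fin i by (simp add: sum.distrib)
      qed
      have "(\<Sum>x\<in>X. a x / V w x - a x / V v x) \<le> c i * \<eta>"
        using le unfolding J_def cv by (simp add: sum_subtractf)
      moreover have "(\<Sum>x | x \<in> X \<and> R i x. a x * \<eta> / (2 * (V w x)\<^sup>2)) \<le>
        (\<Sum>x\<in>X. a x / V w x - a x / V v x)"
      proof -
        have "(\<Sum>x | x \<in> X \<and> R i x. a x * \<eta> / (2 * (V w x)\<^sup>2)) =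
          (\<Sum>x\<in>X. if R i x then a x * \<eta> / (2 * (V w x)\<^sup>2) else 0)"
          using fin by (simp add: sum.inter_filter)
        also have "\<dots> \<le> (\<Sum>x\<in>X. a x / V w x - a x / V v x)"
        proof (intro sum_mono)
          fix x assume x: "x \<in> X"
          show "(if R i x then a x * \<eta> / (2 * (V w x)\<^sup>2) else 0) \<le> a x / V w x - a x / V v x"
          proof (cases "R i x")
            case True
            have "a x / V w x - a x / V v x = a x * \<eta> / (V w x * (V w x + \<eta>))"
              using V[of x] \<open>0 < \<eta>\<close> True by (simp add: Vv field_simps)
            moreover have "V w x * (V w x + \<eta>) \<le> 2 * (V w x)\<^sup>2"
              using V[of x] by (simp add: power2_eq_square algebra_simps)
            ultimately show ?thesis
              using True V[of x] \<open>0 < \<eta>\<close> a[OF x] by (auto intro!: divide_left_mono mult_pos_pos)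
          qed (simp add: Vv)
        qed
        finally show ?thesis .
      qed
      ultimately have "(\<Sum>x | x \<in> X \<and> R i x. a x * \<eta> / (2 * (V w x)\<^sup>2)) \<le> c i * \<eta>"
        by linarith
      moreover have "(\<Sum>x | x \<in> X \<and> R i x. a x * \<eta> / (2 * (V w x)\<^sup>2)) =
        \<eta> / 2 * (\<Sum>x | x \<in> X \<and> R i x. a x / (V w x)\<^sup>2)"
        by (simp add: sum_distrib_left field_simps)
      ultimately have "\<eta> / 2 * (\<Sum>x | x \<in> X \<and> R i x. a x / (V w x)\<^sup>2) \<le> \<eta> / 2 * (2 * c i)"
        by (simp add: mult.commute[of "c i"])
      then show ?thesis
        using \<open>0 < \<eta>\<close> unfolding V_def by (subst (asm) mult_le_cancel_left_pos) auto
    qed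
    show "(\<Sum>i\<in>I. c i * w i) \<le> 2 * (\<Sum>x\<in>X. a x / (\<eta> + (\<Sum>j | j \<in> I \<and> R j x. w j)))"
    proof -
      define v where "v i = w i / 2" for i
      have "v \<in> K"
        using wB by (auto simp: K_def v_def) (smt (verit) field_sum_of_halves)
      then have le: "J w \<le> J v" by (rule wmin)
      have Vv: "V w x \<le> 2 * V v x" "0 < V v x" for x
        using \<open>0 < \<eta>\<close> wB by (auto simp: V_def v_def sum_divide_distrib[symmetric]
            intro!: add_pos_nonneg sum_nonneg)
      have "(\<Sum>i\<in>I. c i * v i) = (\<Sum>i\<in>I. c i * w i) / 2"
        by (simp add: v_def sum_divide_distrib)
      then have "(\<Sum>i\<in>I. c i * w i) / 2 \<le> (\<Sum>x\<in>X. a x / V v x) - (\<Sum>x\<in>X. a x / V w x)"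
        using le by (simp add: J_def)
      also have "(\<Sum>x\<in>X. a x / V v x) \<le> (\<Sum>x\<in>X. 2 * (a x / V w x))"
      proof (intro sum_mono)
        fix x assume "x \<in> X"
        have "1 / V v x \<le> 2 / V w x"
          using Vv[of x] V[of x] by (simp add: field_simps)
        from mult_left_mono[OF this a[OF \<open>x \<in> X\<close>]]
        show "a x / V v x \<le> 2 * (a x / V w x)" by (simp add: mult.commute)
      qed
      also have "\<dots> = 2 * (\<Sum>x\<in>X. a x / V w x)" by (simp add: sum_distrib_left)
      finally show ?thesis by (simp add: V_def)
    qed
  qed
qed

section \<open>Khinchine's inequality for Rademacher chaos\<close>

text \<open>
  A subset \<open>J\<close> stands for the pattern of signs that is \<open>-1\<close> exactly on \<open>J\<close>.
\<close>

definition sign_of :: "nat set \<Rightarrow> nat set \<Rightarrow> real" where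
  "sign_of J A = (\<Prod>i\<in>A. if i \<in> J then -1 else 1)"

definition chaos :: "nat set \<Rightarrow> (nat set \<Rightarrow> 'v::real_vector) \<Rightarrow> nat set \<Rightarrow> 'v" where
  "chaos S b J = (\<Sum>A\<in>Pow S. sign_of J A *\<^sub>R b A)"

text \<open>
  The recursion behind the inductions over the number of signs: a pattern of signs on \<open>insert i S\<close> is
  one on \<open>S\<close> together with the sign at \<open>i\<close>.
\<close>

lemma sum_Pow_insert:
  assumes "finite S" "i \<notin> S"
  shows "(\<Sum>J\<in>Pow (insert i S). h J) = (\<Sum>J\<in>Pow S. h J) + (\<Sum>J\<in>Pow S. h (insert i J))"
proof -
  have "inj_on (insert i) (Pow S)"
    using assms by (auto simp: inj_on_def)
  then show ?thesis
    unfolding Pow_insert using assms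
    by (subst sum.union_disjoint) (auto simp: sum.reindex)
qed

lemma chaos_insert:
  assumes "finite S" "i \<notin> S" "J \<subseteq> S"
  shows "chaos (insert i S) b J = chaos S b J + chaos S (\<lambda>A. b (insert i A)) J"
    and "chaos (insert i S) b (insert i J) = chaos S b J - chaos S (\<lambda>A. b (insert i A)) J"
proof -
  have 1: "sign_of J (insert i A) = sign_of J A" "sign_of (insert i J) A = sign_of J A"
    "sign_of (insert i J) (insert i A) = - sign_of J A" if "A \<in> Pow S" for A
  proof -
    have A: "finite A" "i \<notin> A" using that assms finite_subset by auto
    show 2: "sign_of (insert i J) A = sign_of J A"
      unfolding sign_of_def using A by (intro prod.cong) auto
    show "sign_of J (insert i A) = sign_of J A"
      using A assms by (auto simp: sign_of_def)
    show "sign_of (insert i J) (insert i A) = - sign_of J A"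
      using A assms 2 by (simp add: sign_of_def)
  qed
  show "chaos (insert i S) b J = chaos S b J + chaos S (\<lambda>A. b (insert i A)) J"
    and "chaos (insert i S) b (insert i J) = chaos S b J - chaos S (\<lambda>A. b (insert i A)) J"
    unfolding chaos_def using assms 1 by (simp_all add: sum_Pow_insert sum_negf)
qed

lemma chaos_second_moment:
  fixes b :: "nat set \<Rightarrow> 'v::real_inner"
  assumes "finite S"
  shows "(\<Sum>J\<in>Pow S. (norm (chaos S b J))\<^sup>2) = 2 ^ card S * (\<Sum>A\<in>Pow S. (norm (b A))\<^sup>2)"
  using assms
proof (induction S arbitrary: b rule: finite_induct)
  case empty
  then show ?case by (simp add: chaos_def sign_of_def)
next
  case (insert i S)
  let ?P = "chaos S b" and ?Q = "chaos S (\<lambda>A. b (insert i A))"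
  have "(\<Sum>J\<in>Pow (insert i S). (norm (chaos (insert i S) b J))\<^sup>2) =
    (\<Sum>J\<in>Pow S. (norm (?P J + ?Q J))\<^sup>2 + (norm (?P J - ?Q J))\<^sup>2)"
    using insert.hyps by (simp add: sum_Pow_insert chaos_insert sum.distrib)
  also have "\<dots> = (\<Sum>J\<in>Pow S. 2 * (norm (?P J))\<^sup>2 + 2 * (norm (?Q J))\<^sup>2)"
    by (intro sum.cong) (auto simp: power2_norm_eq_inner algebra_simps)
  also have "\<dots> = 2 * (\<Sum>J\<in>Pow S. (norm (?P J))\<^sup>2) + 2 * (\<Sum>J\<in>Pow S. (norm (?Q J))\<^sup>2)"
    by (simp add: sum.distrib sum_distrib_left)
  also have "\<dots> = 2 ^ card (insert i S) * (\<Sum>A\<in>Pow (insert i S). (norm (b A))\<^sup>2)"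
    using insert.hyps by (simp add: insert.IH sum_Pow_insert algebra_simps)
  finally show ?case .
qed

lemma parallelogram_fourth:
  fixes p q :: "'v::real_inner"
  shows "norm (p + q) ^ 4 + norm (p - q) ^ 4 \<le> 2 * norm p ^ 4 + 2 * norm q ^ 4 + 12 * ((norm p)\<^sup>2 * (norm q)\<^sup>2)"
proof -
  define a where "a = (norm p)\<^sup>2 + (norm q)\<^sup>2"
  have e: "norm x ^ 4 = ((norm x)\<^sup>2)\<^sup>2" for x :: 'v by simp
  have "(norm (p + q))\<^sup>2 = a + 2 * inner p q" "(norm (p - q))\<^sup>2 = a - 2 * inner p q"
    by (simp_all add: a_def power2_norm_eq_inner algebra_simps inner_commute)
  then have "norm (p + q) ^ 4 + norm (p - q) ^ 4 = 2 * a\<^sup>2 + 8 * (inner p q)\<^sup>2"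
    by (simp only: e) (simp add: power2_eq_square algebra_simps)
  moreover have "(inner p q)\<^sup>2 \<le> (norm p)\<^sup>2 * (norm q)\<^sup>2"
    using Cauchy_Schwarz_ineq[of p q] by (simp add: power2_norm_eq_inner)
  moreover have "a\<^sup>2 = norm p ^ 4 + norm q ^ 4 + 2 * ((norm p)\<^sup>2 * (norm q)\<^sup>2)"
    unfolding a_def by (simp only: e) (simp add: power2_eq_square algebra_simps)
  ultimately show ?thesis by simp
qed

text \<open>
  Bonami's inequality. Splitting off one sign writes the chaos as \<open>P \<plusminus> Q\<close>, where \<open>Q\<close> has degree one
  less; this gains a factor \<open>9\<close> for \<open>Q\<close>, which absorbs the mixed term of
  \<open>parallelogram_fourth\<close> after Cauchy-Schwarz.
\<close>

lemma chaos_fourth_moment: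
  fixes b :: "nat set \<Rightarrow> 'v::real_inner"
  assumes "finite S" and "\<And>A. A \<subseteq> S \<Longrightarrow> m < card A \<Longrightarrow> b A = 0"
  shows "(\<Sum>J\<in>Pow S. norm (chaos S b J) ^ 4) \<le> 2 ^ card S * 9 ^ m * (\<Sum>A\<in>Pow S. (norm (b A))\<^sup>2)\<^sup>2"
  using assms
proof (induction S arbitrary: b m rule: finite_induct)
  case empty
  have "norm (b {}) ^ 4 \<le> 9 ^ m * norm (b {}) ^ 4"
    using mult_right_mono[of 1 "9 ^ m :: real" "norm (b {}) ^ 4"] by simp
  then show ?case by (simp add: chaos_def sign_of_def)
next
  case (insert i S)
  let ?b' = "\<lambda>A. b (insert i A)"
  let ?P = "chaos S b" and ?Q = "chaos S ?b'"
  define \<alpha> where "\<alpha> = (\<Sum>A\<in>Pow S. (norm (b A))\<^sup>2)"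
  define \<beta> where "\<beta> = (\<Sum>A\<in>Pow S. (norm (?b' A))\<^sup>2)"
  have ab: "0 \<le> \<alpha>" "0 \<le> \<beta>" by (auto simp: \<alpha>_def \<beta>_def intro!: sum_nonneg)
  have card_ins: "card (insert i A) = Suc (card A)" if "A \<subseteq> S" for A
    using that insert.hyps finite_subset by (subst card_insert_disjoint) auto
  have IHP: "(\<Sum>J\<in>Pow S. norm (?P J) ^ 4) \<le> 2 ^ card S * 9 ^ m * \<alpha>\<^sup>2"
    unfolding \<alpha>_def by (rule insert.IH) (use insert.prems in auto)
  have IHQ: "9 * (\<Sum>J\<in>Pow S. norm (?Q J) ^ 4) \<le> 2 ^ card S * 9 ^ m * \<beta>\<^sup>2"
  proof (cases m)
    case 0
    then have "?b' A = 0" if "A \<subseteq> S" for A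
      using insert.prems[of "insert i A"] that card_ins[OF that] by auto
    then show ?thesis by (simp add: chaos_def)
  next
    case (Suc k)
    have "(\<Sum>J\<in>Pow S. norm (?Q J) ^ 4) \<le> 2 ^ card S * 9 ^ k * \<beta>\<^sup>2"
      unfolding \<beta>_def
    proof (rule insert.IH)
      show "?b' A = 0" if "A \<subseteq> S" "k < card A" for A
        using insert.prems[of "insert i A"] Suc card_ins[OF that(1)] that by auto
    qed
    then show ?thesis using Suc by simp
  qed
  have mixed: "3 * (\<Sum>J\<in>Pow S. (norm (?P J))\<^sup>2 * (norm (?Q J))\<^sup>2) \<le> 2 ^ card S * 9 ^ m * (\<alpha> * \<beta>)"
  proof (rule power2_le_imp_le)
    have "(3 * (\<Sum>J\<in>Pow S. (norm (?P J))\<^sup>2 * (norm (?Q J))\<^sup>2))\<^sup>2 \<le>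
        9 * ((\<Sum>J\<in>Pow S. ((norm (?P J))\<^sup>2)\<^sup>2) * (\<Sum>J\<in>Pow S. ((norm (?Q J))\<^sup>2)\<^sup>2))"
      using Cauchy_Schwarz_ineq_sum[of "\<lambda>J. (norm (?P J))\<^sup>2" "\<lambda>J. (norm (?Q J))\<^sup>2" "Pow S"]
      by (simp add: power_mult_distrib)
    also have "\<dots> = (\<Sum>J\<in>Pow S. norm (?P J) ^ 4) * (9 * (\<Sum>J\<in>Pow S. norm (?Q J) ^ 4))"
      by simp
    also have "\<dots> \<le> (2 ^ card S * 9 ^ m * \<alpha>\<^sup>2) * (2 ^ card S * 9 ^ m * \<beta>\<^sup>2)"
      by (intro mult_mono IHP IHQ mult_nonneg_nonneg sum_nonneg) auto
    also have "\<dots> = (2 ^ card S * 9 ^ m * (\<alpha> * \<beta>))\<^sup>2"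
      by (simp add: power2_eq_square)
    finally show "(3 * (\<Sum>J\<in>Pow S. (norm (?P J))\<^sup>2 * (norm (?Q J))\<^sup>2))\<^sup>2 \<le>
      (2 ^ card S * 9 ^ m * (\<alpha> * \<beta>))\<^sup>2" .
  qed (use ab in simp)
  have "(\<Sum>J\<in>Pow (insert i S). norm (chaos (insert i S) b J) ^ 4) =
    (\<Sum>J\<in>Pow S. norm (?P J + ?Q J) ^ 4 + norm (?P J - ?Q J) ^ 4)"
    using insert.hyps by (simp add: sum_Pow_insert chaos_insert sum.distrib)
  also have "\<dots> \<le> (\<Sum>J\<in>Pow S. 2 * norm (?P J) ^ 4 + 2 * norm (?Q J) ^ 4 +
      12 * ((norm (?P J))\<^sup>2 * (norm (?Q J))\<^sup>2))"
    by (intro sum_mono parallelogram_fourth)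
  also have "\<dots> = 2 * (\<Sum>J\<in>Pow S. norm (?P J) ^ 4) + 2 * (\<Sum>J\<in>Pow S. norm (?Q J) ^ 4) +
      12 * (\<Sum>J\<in>Pow S. (norm (?P J))\<^sup>2 * (norm (?Q J))\<^sup>2)"
    by (simp add: sum.distrib sum_distrib_left)
  also have "\<dots> \<le> 2 * (2 ^ card S * 9 ^ m * \<alpha>\<^sup>2) + 2 * (2 ^ card S * 9 ^ m * \<beta>\<^sup>2)
      + 4 * (2 ^ card S * 9 ^ m * (\<alpha> * \<beta>))"
    using IHP IHQ mixed sum_nonneg[of "Pow S" "\<lambda>J. norm (?Q J) ^ 4"] by simp
  also have "\<dots> = 2 ^ card (insert i S) * 9 ^ m * (\<alpha> + \<beta>)\<^sup>2"
    using insert.hyps by (simp add: power2_eq_square algebra_simps)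
  also have "\<alpha> + \<beta> = (\<Sum>A\<in>Pow (insert i S). (norm (b A))\<^sup>2)"
    using insert.hyps by (simp add: \<alpha>_def \<beta>_def sum_Pow_insert)
  finally show ?case .
qed

text \<open>
  The first moment is bounded below by the second and fourth ones, through the elementary inequality
  \<open>3 s\<^sup>2 z\<^sup>2 - z\<^sup>4 \<le> 2 s\<^sup>3 z\<close> for \<open>z \<ge> 0\<close>.
\<close>

lemma chaos_khinchine:
  fixes b :: "nat set \<Rightarrow> 'v::real_inner"
  assumes "finite S" and "\<And>A. A \<subseteq> S \<Longrightarrow> m < card A \<Longrightarrow> b A = 0"
  shows "sqrt (\<Sum>A\<in>Pow S. (norm (b A))\<^sup>2) \<le> 3 ^ m / 2 ^ card S * (\<Sum>J\<in>Pow S. norm (chaos S b J))"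
proof -
  define \<sigma> where "\<sigma> = sqrt (\<Sum>A\<in>Pow S. (norm (b A))\<^sup>2)"
  have \<sigma>2: "\<sigma>\<^sup>2 = (\<Sum>A\<in>Pow S. (norm (b A))\<^sup>2)"
    unfolding \<sigma>_def by (simp add: sum_nonneg)
  show ?thesis
  proof (cases "\<sigma> = 0")
    case True
    then show ?thesis unfolding \<sigma>_def[symmetric] by (simp add: sum_nonneg)
  next
    case False
    then have "0 < \<sigma>" unfolding \<sigma>_def by (simp add: sum_nonneg less_le)
    \<comment> \<open>With \<open>\<sigma>\<close> the root of the second moment, the sum of the \<open>z\<^sup>4\<close> is at most a third of that of the \<open>3 s\<^sup>2 z\<^sup>2\<close>.\<close>
    define s where "s = 3 ^ m * \<sigma>"
    have "0 < s" using \<open>0 < \<sigma>\<close> by (simp add: s_def)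
    have s2: "s\<^sup>2 = 9 ^ m * \<sigma>\<^sup>2"
      by (simp add: s_def power2_eq_square flip: power_mult_distrib)
    have ineq: "3 * s\<^sup>2 * z\<^sup>2 - z ^ 4 \<le> 2 * s ^ 3 * z" if "0 \<le> z" for z :: real
    proof -
      have "0 \<le> z * (z - s)\<^sup>2 * (z + 2 * s)"
        using that \<open>0 < s\<close> by simp
      also have "\<dots> = 2 * s ^ 3 * z - (3 * s\<^sup>2 * z\<^sup>2 - z ^ 4)"
        by (simp add: power2_eq_square power3_eq_cube power4_eq_xxxx algebra_simps)
      finally show ?thesis by simp
    qed
    let ?Z = "chaos S b"
    have "3 * s\<^sup>2 * (2 ^ card S * \<sigma>\<^sup>2) - 2 ^ card S * 9 ^ m * (\<sigma>\<^sup>2)\<^sup>2 \<le>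
        3 * s\<^sup>2 * (\<Sum>J\<in>Pow S. (norm (?Z J))\<^sup>2) - (\<Sum>J\<in>Pow S. norm (?Z J) ^ 4)"
      using chaos_second_moment[OF assms(1), of b] chaos_fourth_moment[OF assms, of m]
      by (simp add: \<sigma>2)
    also have "\<dots> = (\<Sum>J\<in>Pow S. 3 * s\<^sup>2 * (norm (?Z J))\<^sup>2 - norm (?Z J) ^ 4)"
      by (simp add: sum_subtractf sum_distrib_left)
    also have "\<dots> \<le> (\<Sum>J\<in>Pow S. 2 * s ^ 3 * norm (?Z J))"
      by (intro sum_mono ineq) auto
    also have "\<dots> = 2 * s ^ 3 * (\<Sum>J\<in>Pow S. norm (?Z J))"
      by (simp add: sum_distrib_left)
    finally have "3 * s\<^sup>2 * (2 ^ card S * \<sigma>\<^sup>2) - 2 ^ card S * 9 ^ m * (\<sigma>\<^sup>2)\<^sup>2 \<le>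
        2 * s ^ 3 * (\<Sum>J\<in>Pow S. norm (?Z J))" .
    moreover have "3 * s\<^sup>2 * (2 ^ card S * \<sigma>\<^sup>2) = 3 * (2 ^ card S * 9 ^ m * (\<sigma>\<^sup>2)\<^sup>2)"
      unfolding s2 by (simp add: power2_eq_square)
    ultimately have "2 * (2 ^ card S * 9 ^ m * (\<sigma>\<^sup>2)\<^sup>2) \<le> 2 * s ^ 3 * (\<Sum>J\<in>Pow S. norm (?Z J))"
      by linarith
    also have "2 * s ^ 3 = 2 * (9 ^ m * 3 ^ m * \<sigma> ^ 3)"
      using s2 by (simp add: power3_eq_cube power2_eq_square s_def)
    also have "2 * (2 ^ card S * 9 ^ m * (\<sigma>\<^sup>2)\<^sup>2) = 2 * (9 ^ m * \<sigma> ^ 3) * (2 ^ card S * \<sigma>)"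
      by (simp add: power2_eq_square power3_eq_cube)
    finally have "2 * (9 ^ m * \<sigma> ^ 3) * (2 ^ card S * \<sigma>) \<le>
        2 * (9 ^ m * \<sigma> ^ 3) * (3 ^ m * (\<Sum>J\<in>Pow S. norm (?Z J)))"
      by (simp add: mult_ac)
    then have "2 ^ card S * \<sigma> \<le> 3 ^ m * (\<Sum>J\<in>Pow S. norm (?Z J))"
      using \<open>0 < \<sigma>\<close> by (simp add: mult_le_cancel_left_pos)
    then show ?thesis
      unfolding \<sigma>_def[symmetric] by (simp add: field_simps)
  qed
qed

section \<open>Extracting the top coefficient of a polynomial\<close>

text \<open>
  Its roots are \<open>2\<^sup>-\<^sup>l\<close> for \<open>l < m\<close>. Its coefficients \<open>c\<^sub>j\<close> therefore satisfy \<open>(\<Sum>j. c\<^sub>j (2\<^sup>-\<^sup>j)\<^sup>k) = 0\<close> for \<open>k < m\<close>: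
  summing the values of a polynomial at the points \<open>2\<^sup>-\<^sup>j\<close> against them annihilates all terms of degree
  less than \<open>m\<close>.
\<close>

definition extraction_poly :: "nat \<Rightarrow> real poly" where
  "extraction_poly m = (\<Prod>l<m. [:- (1 / 2 ^ l), 1:])"

lemma degree_extraction_poly: "degree (extraction_poly m) = m"
  unfolding extraction_poly_def by (subst degree_prod_eq_sum_degree) auto

lemma extraction_poly_zero: "l < m \<Longrightarrow> poly (extraction_poly m) (1 / 2 ^ l) = 0"
  unfolding extraction_poly_def poly_prod by (rule prod_zero) auto

lemma extraction_poly_nonzero: "poly (extraction_poly m) (1 / 2 ^ m) \<noteq> 0"
  unfolding extraction_poly_def poly_prod by (auto simp: field_simps)

lemma extract_product:
  fixes \<delta> :: "'i \<Rightarrow> real"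
  assumes "finite A" "card A = m"
  shows "(\<Sum>j\<le>m. coeff (extraction_poly m) j * (\<Prod>i\<in>A. 1 + \<delta> i / 2 ^ j)) =
    poly (extraction_poly m) (1 / 2 ^ m) * (\<Prod>i\<in>A. \<delta> i)"
proof -
  let ?q = "extraction_poly m"
  have "(\<Prod>i\<in>A. 1 + \<delta> i / 2 ^ j) = (\<Sum>B\<in>Pow A. (\<Prod>i\<in>B. \<delta> i) * (1 / 2 ^ card B) ^ j)" for j :: nat
  proof -
    have "(\<Prod>i\<in>A. 1 + \<delta> i / 2 ^ j) = (\<Sum>B\<in>Pow A. (\<Prod>i\<in>B. \<delta> i / 2 ^ j))"
      using prod_add[OF assms(1), of "\<lambda>i. \<delta> i / 2 ^ j" "\<lambda>_. 1"] by (simp add: add.commute)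
    also have "\<dots> = (\<Sum>B\<in>Pow A. (\<Prod>i\<in>B. \<delta> i) * (1 / 2 ^ card B) ^ j)"
      by (intro sum.cong) (auto simp: prod_dividef power_divide mult.commute simp flip: power_mult)
    finally show ?thesis .
  qed
  then have "(\<Sum>j\<le>m. coeff ?q j * (\<Prod>i\<in>A. 1 + \<delta> i / 2 ^ j)) =
      (\<Sum>B\<in>Pow A. (\<Prod>i\<in>B. \<delta> i) * (\<Sum>j\<le>m. coeff ?q j * (1 / 2 ^ card B) ^ j))"
    by (simp add: sum_distrib_left) (subst sum.swap, simp add: mult_ac)
  also have "\<dots> = (\<Sum>B\<in>Pow A. (\<Prod>i\<in>B. \<delta> i) * poly ?q (1 / 2 ^ card B))"
    by (simp add: poly_altdef degree_extraction_poly)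
  also have "\<dots> = (\<Sum>B\<in>{A}. (\<Prod>i\<in>B. \<delta> i) * poly ?q (1 / 2 ^ card B))"
  proof (intro sum.mono_neutral_right ballI)
    fix B assume "B \<in> Pow A - {A}"
    then have "card B < m" using assms by (auto intro!: psubset_card_mono)
    then show "(\<Prod>i\<in>B. \<delta> i) * poly ?q (1 / 2 ^ card B) = 0"
      by (simp add: extraction_poly_zero del: power_one_over)
  qed (use assms in auto)
  finally show ?thesis using assms by simp
qed

section \<open>Finite powers of a finite probability space\<close>

text \<open>
  The \<open>\<ell>\<^sup>2\<close> norm over the index set \<open>I\<close>. A single coordinate is the case \<open>I = {n}\<close>, so that both norms of
  the couple are treated by the same lemmas.
\<close>

definition l2_part :: "nat set \<Rightarrow> (nat \<Rightarrow> 'v::real_normed_vector) \<Rightarrow> real" where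
  "l2_part I a = sqrt (\<Sum>n\<in>I. (norm (a n))\<^sup>2)"

lemma l2_part_L2_set: "l2_part I a = L2_set (\<lambda>n. norm (a n)) I"
  by (simp add: l2_part_def L2_set_def)

lemma l2_part_nonneg [simp]: "0 \<le> l2_part I a"
  by (simp add: l2_part_def sum_nonneg)

lemma l2_part_sq: "(l2_part I a)\<^sup>2 = (\<Sum>n\<in>I. (norm (a n))\<^sup>2)"
  by (simp add: l2_part_def sum_nonneg)

lemma l2_part_singleton [simp]: "l2_part {n} a = norm (a n)"
  by (simp add: l2_part_def)

lemma l2_part_zero [simp]: "l2_part I (\<lambda>n. 0) = 0"
  by (simp add: l2_part_def)

lemma l2_part_add: "l2_part I (\<lambda>n. a n + b n) \<le> l2_part I a + l2_part I b"
proof -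
  have "l2_part I (\<lambda>n. a n + b n) \<le> L2_set (\<lambda>n. norm (a n) + norm (b n)) I"
    unfolding l2_part_L2_set by (intro L2_set_mono norm_triangle_ineq) auto
  also have "\<dots> \<le> l2_part I a + l2_part I b"
    unfolding l2_part_L2_set by (rule L2_set_triangle_ineq)
  finally show ?thesis .
qed

lemma l2_part_scale: "l2_part I (\<lambda>n. c *\<^sub>R a n) = \<bar>c\<bar> * l2_part I a"
  by (simp add: l2_part_def power_mult_distrib sum_distrib_left[symmetric] real_sqrt_mult)

lemma l2_part_diff: "l2_part I (\<lambda>n. a n - b n) \<le> l2_part I a + l2_part I b"
  using l2_part_add[of I a "\<lambda>n. (-1) *\<^sub>R b n"] l2_part_scale[of I "-1" b] by simp

lemma l2_part_sum: "l2_part I (\<lambda>n. \<Sum>k\<in>K. a k n) \<le> (\<Sum>k\<in>K. l2_part I (a k))"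
proof (induction K rule: infinite_finite_induct)
  case (insert k K)
  then show ?case
    using l2_part_add[of I "a k" "\<lambda>n. \<Sum>k\<in>K. a k n"] by simp
qed auto

lemma sum_inner_le_l2_part:
  fixes a b :: "nat \<Rightarrow> 'v::real_inner"
  shows "(\<Sum>n\<in>I. norm (a n) * norm (b n)) \<le> l2_part I a * l2_part I b"
  unfolding l2_part_L2_set using L2_set_mult_ineq[of "\<lambda>n. norm (a n)" "\<lambda>n. norm (b n)" I] by simp

definition agree :: "nat set \<Rightarrow> (nat \<Rightarrow> 'c) \<Rightarrow> (nat \<Rightarrow> 'c) \<Rightarrow> bool" where
  "agree b x y \<longleftrightarrow> (\<forall>i\<in>b. x i = y i)"

lemma agree_sym: "agree b x y \<longleftrightarrow> agree b y x"
  by (auto simp: agree_def)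

text \<open>
  Everything below happens on words of length \<open>N\<close> with independent letters of distribution \<open>\<pi>\<close>. All
  integrals are finite sums, and letters of probability zero are permitted.
\<close>

locale finite_power =
  fixes \<Gamma> :: "'c set" and \<pi> :: "'c \<Rightarrow> real" and N :: nat
  assumes finite_alphabet: "finite \<Gamma>"
    and pi_nonneg: "\<And>c. c \<in> \<Gamma> \<Longrightarrow> 0 \<le> \<pi> c"
    and pi_sum: "(\<Sum>c\<in>\<Gamma>. \<pi> c) = 1"
begin

definition words :: "(nat \<Rightarrow> 'c) set" where
  "words = PiE {..<N} (\<lambda>_. \<Gamma>)"

definition weight :: "(nat \<Rightarrow> 'c) \<Rightarrow> real" where
  "weight x = (\<Prod>i<N. \<pi> (x i))"

definition mean :: "((nat \<Rightarrow> 'c) \<Rightarrow> 'v::real_vector) \<Rightarrow> 'v" where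
  "mean G = (\<Sum>x\<in>words. weight x *\<^sub>R G x)"

definition avg :: "nat \<Rightarrow> ((nat \<Rightarrow> 'c) \<Rightarrow> 'v::real_vector) \<Rightarrow> (nat \<Rightarrow> 'c) \<Rightarrow> 'v" where
  "avg i G x = (\<Sum>c\<in>\<Gamma>. \<pi> c *\<^sub>R G (x(i := c)))"

text \<open>
  Functions matter on \<open>words\<close> only; their values elsewhere are arbitrary.
\<close>

definition determined :: "nat set \<Rightarrow> ((nat \<Rightarrow> 'c) \<Rightarrow> 'v) \<Rightarrow> bool" where
  "determined A G \<longleftrightarrow> (\<forall>x\<in>words. \<forall>y\<in>words. agree A x y \<longrightarrow> G x = G y)"

lemma finite_words [simp]: "finite words"
  unfolding words_def by (intro finite_PiE finite_alphabet) auto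

lemma weight_nonneg: "x \<in> words \<Longrightarrow> 0 \<le> weight x"
  unfolding weight_def words_def by (intro prod_nonneg) (auto intro!: pi_nonneg)

lemma weight_sum: "(\<Sum>x\<in>words. weight x) = 1"
  unfolding weight_def words_def
  using prod_sum_PiE[of "{..<N}" "\<lambda>_. \<Gamma>" "\<lambda>_. \<pi>"] finite_alphabet pi_sum by simp

lemma upd_words: "x \<in> words \<Longrightarrow> i < N \<Longrightarrow> c \<in> \<Gamma> \<Longrightarrow> x(i := c) \<in> words"
  unfolding words_def by (auto simp: PiE_iff extensional_def)

lemma mean_cong: "(\<And>x. x \<in> words \<Longrightarrow> F x = G x) \<Longrightarrow> mean F = mean G"
  unfolding mean_def by (intro sum.cong) auto

lemma mean_mono: "(\<And>x. x \<in> words \<Longrightarrow> F x \<le> G x) \<Longrightarrow> mean F \<le> (mean G :: real)"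
  unfolding mean_def by (auto intro!: sum_mono mult_left_mono weight_nonneg)

lemma mean_nonneg: "(\<And>x. x \<in> words \<Longrightarrow> 0 \<le> F x) \<Longrightarrow> 0 \<le> (mean F :: real)"
  unfolding mean_def by (auto intro!: sum_nonneg mult_nonneg_nonneg weight_nonneg)

lemma mean_add: "mean (\<lambda>x. F x + G x) = mean F + mean G"
  by (simp add: mean_def scaleR_add_right sum.distrib)

lemma mean_diff: "mean (\<lambda>x. F x - G x) = mean F - mean G"
  by (simp add: mean_def scaleR_diff_right sum_subtractf)

lemma mean_scale: "mean (\<lambda>x. c *\<^sub>R F x) = c *\<^sub>R mean F"
  by (simp add: mean_def scaleR_sum_right mult.commute)

lemma mean_mult: "mean (\<lambda>x. c * F x) = c * (mean F :: real)"
  using mean_scale[of c F] by simp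

lemma mean_sum: "mean (\<lambda>x. \<Sum>k\<in>K. F k x) = (\<Sum>k\<in>K. mean (F k))"
  unfolding mean_def by (simp add: scaleR_sum_right) (rule sum.swap)

lemma mean_const: "mean (\<lambda>x. c) = (c::real)"
  by (simp add: mean_def weight_sum flip: sum_distrib_right)

lemma weight_upd_swap:
  assumes "x \<in> words" "i < N"
  shows "weight (x(i := c)) * \<pi> (x i) = weight x * \<pi> c"
proof -
  have "weight y = \<pi> (y i) * (\<Prod>j\<in>{..<N} - {i}. \<pi> (y j))" for y
    unfolding weight_def using assms by (intro prod.remove) auto
  moreover have "(\<Prod>j\<in>{..<N} - {i}. \<pi> ((x(i := c)) j)) = (\<Prod>j\<in>{..<N} - {i}. \<pi> (x j))"
    by (intro prod.cong) auto
  ultimately show ?thesis by simp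
qed

lemma mean_avg:
  assumes "i < N"
  shows "mean (avg i G) = mean G"
proof -
  have "mean (avg i G) = (\<Sum>(x, c)\<in>words \<times> \<Gamma>. (weight x * \<pi> c) *\<^sub>R G (x(i := c)))"
    by (simp add: mean_def avg_def scaleR_sum_right sum.cartesian_product)
  also have "\<dots> = (\<Sum>(x, c)\<in>words \<times> \<Gamma>. (weight x * \<pi> c) *\<^sub>R G x)"
  proof (rule sum.reindex_bij_witness[where i = "\<lambda>(x, c). (x(i := c), x i)" and j = "\<lambda>(x, c). (x(i := c), x i)"])
    have in_alphabet: "x i \<in> \<Gamma>" if "x \<in> words" for x
      using that assms by (auto simp: words_def)
    show "(case case a of (x, c) \<Rightarrow> (x(i := c), x i) of (x, c) \<Rightarrow> (x(i := c), x i)) = a"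
      if "a \<in> words \<times> \<Gamma>" for a using that by auto
    show "(case case a of (x, c) \<Rightarrow> (x(i := c), x i) of (x, c) \<Rightarrow> (x(i := c), x i)) = a"
      if "a \<in> words \<times> \<Gamma>" for a using that by auto
    show "(case a of (x, c) \<Rightarrow> (x(i := c), x i)) \<in> words \<times> \<Gamma>"
      if "a \<in> words \<times> \<Gamma>" for a using that assms by (auto intro: upd_words in_alphabet)
    show "(case a of (x, c) \<Rightarrow> (x(i := c), x i)) \<in> words \<times> \<Gamma>"
      if "a \<in> words \<times> \<Gamma>" for a using that assms by (auto intro: upd_words in_alphabet)
    show "(case case a of (x, c) \<Rightarrow> (x(i := c), x i) of (x, c) \<Rightarrow> (weight x * \<pi> c) *\<^sub>R G x) =
      (case a of (x, c) \<Rightarrow> (weight x * \<pi> c) *\<^sub>R G (x(i := c)))" if "a \<in> words \<times> \<Gamma>" for a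
      using that assms by (auto simp: weight_upd_swap)
  qed
  also have "\<dots> = mean G"
    by (simp add: mean_def sum.cartesian_product[symmetric] flip: scaleR_sum_left sum_distrib_left)
      (simp add: pi_sum flip: scaleR_sum_left sum_distrib_left)
  finally show ?thesis .
qed

lemma avg_cong:
  assumes "x \<in> words" "i < N" "\<And>y. y \<in> words \<Longrightarrow> F y = G y"
  shows "avg i F x = avg i G x"
  unfolding avg_def using assms by (intro sum.cong) (auto simp: upd_words)

lemma avg_sum: "avg i (\<lambda>x. \<Sum>k\<in>K. F k x) x = (\<Sum>k\<in>K. avg i (F k) x)"
  unfolding avg_def by (simp add: scaleR_sum_right) (rule sum.swap)

lemma avg_add: "avg i (\<lambda>x. F x + G x) x = avg i F x + avg i G x"
  by (simp add: avg_def scaleR_add_right sum.distrib)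

lemma avg_diff: "avg i (\<lambda>x. F x - G x) x = avg i F x - avg i G x"
  by (simp add: avg_def scaleR_diff_right sum_subtractf)

lemma avg_commute: "avg i (avg j G) = avg j (avg i G)"
proof (cases "i = j")
  case False
  show ?thesis
    by (rule ext, simp add: avg_def scaleR_sum_right, subst sum.swap)
      (simp add: fun_upd_twist[OF False] mult.commute)
qed simp

lemma avg_idem: "avg i (avg i G) = avg i G"
  by (rule ext) (simp add: avg_def pi_sum flip: scaleR_sum_left)

lemma avg_const: "avg i (\<lambda>x. c) = (\<lambda>x. c)"
  by (rule ext) (simp add: avg_def pi_sum flip: scaleR_sum_left)

lemma determinedD: "determined A G \<Longrightarrow> x \<in> words \<Longrightarrow> y \<in> words \<Longrightarrow> agree A x y \<Longrightarrow> G x = G y"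
  by (auto simp: determined_def)

lemma determined_mono: "determined A G \<Longrightarrow> A \<subseteq> B \<Longrightarrow> determined B G"
  unfolding determined_def agree_def by blast

lemma determined_upd:
  assumes "determined A G" "x \<in> words" "i < N" "c \<in> \<Gamma>" "i \<notin> A"
  shows "G (x(i := c)) = G x"
  using assms by (intro determinedD[OF assms(1)]) (auto intro: upd_words simp: agree_def)

lemma determined_avg:
  assumes "determined A G" "i < N"
  shows "determined (A - {i}) (avg i G)"
  unfolding determined_def avg_def
proof (intro ballI impI sum.cong refl)
  fix x y c assume "x \<in> words" "y \<in> words" "agree (A - {i}) x y" "c \<in> \<Gamma>"
  then have "G (x(i := c)) = G (y(i := c))"
    using assms by (intro determinedD[OF assms(1)]) (auto intro: upd_words simp: agree_def)
  then show "\<pi> c *\<^sub>R G (x(i := c)) = \<pi> c *\<^sub>R G (y(i := c))" by simp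
qed

lemma avg_scaleR_determined:
  assumes "determined A u" "i \<notin> A" "i < N" "x \<in> words"
  shows "avg i (\<lambda>y. u y *\<^sub>R G y) x = u x *\<^sub>R avg i G x"
  unfolding avg_def using assms
  by (auto simp: scaleR_sum_right determined_upd mult.commute intro!: sum.cong)

lemma avg_inner_determined:
  fixes F G :: "(nat \<Rightarrow> 'c) \<Rightarrow> 'v::real_inner"
  assumes "determined A F" "i \<notin> A" "i < N" "x \<in> words"
  shows "avg i (\<lambda>y. inner (F y) (G y)) x = inner (F x) (avg i G x)"
  unfolding avg_def using assms
  by (auto simp: inner_sum_right determined_upd intro!: sum.cong)

lemma mean_inner_determined:
  fixes F G :: "(nat \<Rightarrow> 'c) \<Rightarrow> 'v::real_inner"
  assumes "determined A F" "i \<notin> A" "i < N"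
  shows "mean (\<lambda>x. inner (F x) (G x)) = mean (\<lambda>x. inner (F x) (avg i G x))"
proof -
  have "mean (\<lambda>x. inner (F x) (G x)) = mean (avg i (\<lambda>x. inner (F x) (G x)))"
    using assms by (simp add: mean_avg)
  also have "\<dots> = mean (\<lambda>x. inner (F x) (avg i G x))"
    by (intro mean_cong avg_inner_determined[OF assms])
  finally show ?thesis .
qed

lemma determined_comp2:
  "determined A F \<Longrightarrow> determined A G \<Longrightarrow> determined A (\<lambda>x. h (F x) (G x))"
  unfolding determined_def by metis

lemma determined_comp: "determined A F \<Longrightarrow> determined A (\<lambda>x. h (F x))"
  unfolding determined_def by metis

lemma determined_const: "determined A (\<lambda>x. c)"
  unfolding determined_def by simp

lemma determined_sum:
  "(\<And>k. k \<in> K \<Longrightarrow> determined A (F k)) \<Longrightarrow> determined A (\<lambda>x. \<Sum>k\<in>K. F k x)"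
  unfolding determined_def by (metis (mono_tags, lifting) sum.cong)

lemma determined_avg_UNIV:
  "i < N \<Longrightarrow> determined (UNIV - {i}) (avg i G)"
  using determined_avg[of UNIV G i] unfolding determined_def[of UNIV]
  by (simp add: agree_def fun_eq_iff[symmetric])

text \<open>
  Averaging over one coordinate is an orthogonal projection.
\<close>

lemma mean_inner_avg_avg:
  fixes F G :: "(nat \<Rightarrow> 'c) \<Rightarrow> 'v::real_inner"
  assumes "i < N"
  shows "mean (\<lambda>x. inner (avg i F x) (G x)) = mean (\<lambda>x. inner (avg i F x) (avg i G x))"
  by (rule mean_inner_determined[OF determined_avg_UNIV]) (use assms in auto)

section \<open>Centring in a set of coordinates\<close>

definition diff :: "nat \<Rightarrow> ((nat \<Rightarrow> 'c) \<Rightarrow> 'v::real_vector) \<Rightarrow> (nat \<Rightarrow> 'c) \<Rightarrow> 'v" where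
  "diff i G = (\<lambda>x. G x - avg i G x)"

definition proj :: "nat set \<Rightarrow> ((nat \<Rightarrow> 'c) \<Rightarrow> 'v::real_vector) \<Rightarrow> (nat \<Rightarrow> 'c) \<Rightarrow> 'v" where
  "proj S G = Finite_Set.fold diff G S"

lemma diff_commute: "comp_fun_commute_on UNIV diff"
proof
  show "diff j \<circ> diff i = diff i \<circ> diff j" for i j
  proof (rule ext, rule ext)
    fix G x
    show "(diff j \<circ> diff i) G x = (diff i \<circ> diff j) G x"
      using avg_commute[of i j G]
      by (simp add: diff_def avg_diff)
  qed
qed

lemma proj_empty [simp]: "proj {} G = G"
  by (simp add: proj_def)

lemma proj_insert: "finite S \<Longrightarrow> i \<notin> S \<Longrightarrow> proj (insert i S) G = diff i (proj S G)"
  unfolding proj_def by (rule comp_fun_commute_on.fold_insert[OF diff_commute]) auto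

lemma proj_Un:
  assumes "finite S" "finite T" "S \<inter> T = {}"
  shows "proj (S \<union> T) G = proj S (proj T G)"
  using assms by (induction S rule: finite_induct) (auto simp: proj_insert)

lemma avg_proj:
  assumes "finite S" "i \<in> S"
  shows "avg i (proj S G) x = 0"
proof -
  have "proj S G = diff i (proj (S - {i}) G)"
    using proj_insert[of "S - {i}" i G] assms by (simp add: insert_absorb)
  then show ?thesis
    using avg_idem[of i "proj (S - {i}) G"] by (simp add: diff_def avg_diff)
qed

lemma proj_sum:
  assumes "finite S"
  shows "proj S (\<lambda>x. \<Sum>k\<in>K. F k x) = (\<lambda>x. \<Sum>k\<in>K. proj S (F k) x)"
  using assms by (induction S rule: finite_induct)
    (auto simp: proj_insert diff_def avg_sum sum_subtractf)

lemma proj_cong: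
  assumes "finite S" "S \<subseteq> {..<N}" "\<And>x. x \<in> words \<Longrightarrow> F x = G x" "x \<in> words"
  shows "proj S F x = proj S G x"
  using assms(1,2,4)
proof (induction S arbitrary: x rule: finite_induct)
  case (insert i S)
  then have "avg i (proj S F) x = avg i (proj S G) x"
    by (intro avg_cong) auto
  with insert show ?case by (simp add: proj_insert diff_def)
qed (use assms in auto)

lemma determined_proj:
  assumes "finite S" "S \<subseteq> {..<N}" "determined A G"
  shows "determined A (proj S G)"
  using assms(1,2)
proof (induction S rule: finite_induct)
  case (insert i S)
  then have "determined A (avg i (proj S G))"
    by (intro determined_mono[OF determined_avg]) auto
  then show ?case
    using insert by (auto simp: proj_insert diff_def intro!: determined_comp2[of A _ _ minus])
qed (use assms in auto)

lemma proj_scaleR_determined: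
  assumes "finite S" "S \<subseteq> {..<N}" "determined b u" "S \<inter> b = {}" "x \<in> words"
  shows "proj S (\<lambda>y. u y *\<^sub>R G y) x = u x *\<^sub>R proj S G x"
  using assms(1,2,4,5)
proof (induction S arbitrary: x rule: finite_induct)
  case (insert i S)
  have "avg i (proj S (\<lambda>y. u y *\<^sub>R G y)) x = avg i (\<lambda>y. u y *\<^sub>R proj S G y) x"
    using insert by (intro avg_cong) auto
  also have "\<dots> = u x *\<^sub>R avg i (proj S G) x"
    using insert by (intro avg_scaleR_determined[OF assms(3)]) auto
  finally show ?case
    using insert by (simp add: proj_insert diff_def scaleR_diff_right)
qed auto

lemma proj_fixed:
  assumes "finite S" "S \<subseteq> {..<N}" "\<And>i x. i \<in> S \<Longrightarrow> x \<in> words \<Longrightarrow> avg i G x = 0" "x \<in> words"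
  shows "proj S G x = G x"
  using assms
proof (induction S arbitrary: x rule: finite_induct)
  case (insert i S)
  have "avg i (proj S G) x = avg i G x"
    using insert by (intro avg_cong) auto
  then show ?case
    using insert by (simp add: proj_insert diff_def)
qed auto

lemma l2_part_avg:
  assumes "i < N" "x \<in> words"
  shows "l2_part I (\<lambda>n. avg i (G n) x) \<le> avg i (\<lambda>y. l2_part I (\<lambda>n. G n y)) x"
proof -
  have "l2_part I (\<lambda>n. avg i (G n) x) \<le> (\<Sum>c\<in>\<Gamma>. l2_part I (\<lambda>n. \<pi> c *\<^sub>R G n (x(i := c))))"
    unfolding avg_def by (rule l2_part_sum)
  also have "\<dots> = avg i (\<lambda>y. l2_part I (\<lambda>n. G n y)) x"
    by (auto simp: avg_def l2_part_scale pi_nonneg intro!: sum.cong)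
  finally show ?thesis .
qed

lemma mean_l2_part_proj:
  assumes "finite S" "S \<subseteq> {..<N}"
  shows "mean (\<lambda>x. l2_part I (\<lambda>n. proj S (G n) x)) \<le> 2 ^ card S * mean (\<lambda>x. l2_part I (\<lambda>n. G n x))"
  using assms
proof (induction S rule: finite_induct)
  case (insert i S)
  let ?H = "\<lambda>n. proj S (G n)"
  have "mean (\<lambda>x. l2_part I (\<lambda>n. proj (insert i S) (G n) x)) \<le>
      mean (\<lambda>x. l2_part I (\<lambda>n. ?H n x) + avg i (\<lambda>y. l2_part I (\<lambda>n. ?H n y)) x)"
    using insert
    by (intro mean_mono) (auto simp: proj_insert diff_def intro!: order_trans[OF l2_part_diff] l2_part_avg)
  also have "\<dots> = 2 * mean (\<lambda>x. l2_part I (\<lambda>n. ?H n x))"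
    using insert by (simp add: mean_add mean_avg)
  also have "\<dots> \<le> 2 ^ card (insert i S) * mean (\<lambda>x. l2_part I (\<lambda>n. G n x))"
    using insert by simp
  finally show ?case .
qed simp

lemma mean_sq_diff:
  fixes G :: "(nat \<Rightarrow> 'c) \<Rightarrow> 'v::real_inner"
  assumes "determined b u" "i \<notin> b" "i < N" "\<And>x. x \<in> words \<Longrightarrow> 0 \<le> u x"
  shows "mean (\<lambda>x. u x * (norm (diff i G x))\<^sup>2) \<le> mean (\<lambda>x. u x * (norm (G x))\<^sup>2)"
proof -
  have 1: "mean (\<lambda>x. u x * inner (avg i G x) (G x)) = mean (\<lambda>x. u x * (norm (avg i G x))\<^sup>2)"
  proof -
    have "determined (UNIV - {i}) (\<lambda>x. u x *\<^sub>R avg i G x)"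
      using assms by (intro determined_comp2[of _ _ _ scaleR] determined_avg_UNIV determined_mono[OF assms(1)]) auto
    from mean_inner_determined[OF this, of i G] assms(3) show ?thesis
      by (simp add: power2_norm_eq_inner)
  qed
  have sq: "(norm (diff i G x))\<^sup>2 = (norm (G x))\<^sup>2 - 2 * inner (avg i G x) (G x) + (norm (avg i G x))\<^sup>2" for x
    by (simp add: diff_def power2_norm_eq_inner algebra_simps inner_commute)
  have "mean (\<lambda>x. u x * (norm (diff i G x))\<^sup>2) =
      mean (\<lambda>x. u x * (norm (G x))\<^sup>2) - 2 * mean (\<lambda>x. u x * inner (avg i G x) (G x))
      + mean (\<lambda>x. u x * (norm (avg i G x))\<^sup>2)"
    unfolding mean_mult[symmetric] mean_add[symmetric] mean_diff[symmetric]
    by (intro mean_cong) (simp only: sq, simp add: algebra_simps)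
  also have "\<dots> = mean (\<lambda>x. u x * (norm (G x))\<^sup>2) - mean (\<lambda>x. u x * (norm (avg i G x))\<^sup>2)"
    by (simp add: 1)
  also have "\<dots> \<le> mean (\<lambda>x. u x * (norm (G x))\<^sup>2)"
    using assms(4) by (auto intro!: mean_nonneg)
  finally show ?thesis .
qed

text \<open>
  Centring is an orthogonal projection, also with respect to a weight \<open>u\<close> that the averaged
  coordinates do not enter.
\<close>

lemma mean_sq_proj:
  fixes G :: "(nat \<Rightarrow> 'c) \<Rightarrow> 'v::real_inner"
  assumes "finite S" "S \<subseteq> {..<N}" "determined b u" "S \<inter> b = {}" "\<And>x. x \<in> words \<Longrightarrow> 0 \<le> u x"
  shows "mean (\<lambda>x. u x * (norm (proj S G x))\<^sup>2) \<le> mean (\<lambda>x. u x * (norm (G x))\<^sup>2)"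
  using assms(1,2,4)
proof (induction S rule: finite_induct)
  case (insert i S)
  then show ?case
    using mean_sq_diff[OF assms(3), of i "proj S G"] assms(5) by (force simp: proj_insert)
qed simp

text \<open>
  Two different sets \<open>A\<close>, \<open>B\<close> that contain \<open>b\<close> differ in a coordinate outside \<open>b\<close>, in which one of the
  two centred functions has mean zero while the other one and \<open>u\<close> are constant. All cross terms vanish.
\<close>

lemma weighted_bessel:
  fixes \<phi> :: "nat set \<Rightarrow> (nat \<Rightarrow> 'c) \<Rightarrow> 'v::real_inner"
  assumes A: "finite \<A>" "\<And>A. A \<in> \<A> \<Longrightarrow> A \<subseteq> {..<N} \<and> b \<subseteq> A \<and> determined A (\<phi> A)"
    and u: "determined b u" "\<And>x. x \<in> words \<Longrightarrow> 0 \<le> u x"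
  shows "mean (\<lambda>x. u x * (norm (\<Sum>A\<in>\<A>. proj (A - b) (\<phi> A) x))\<^sup>2) \<le>
    (\<Sum>A\<in>\<A>. mean (\<lambda>x. u x * (norm (\<phi> A x))\<^sup>2))"
proof -
  define p where "p A = proj (A - b) (\<phi> A)" for A
  have fin: "finite A" if "A \<in> \<A>" for A
    using A(2)[OF that] finite_subset by auto
  have det: "determined A (p A)" if "A \<in> \<A>" for A
    unfolding p_def using A(2)[OF that] fin[OF that] by (intro determined_proj) auto
  have orth: "mean (\<lambda>x. u x * inner (p A x) (p B x)) = 0"
    if "A \<in> \<A>" "B \<in> \<A>" "i \<in> A" "i \<notin> B" for A B i
  proof -
    have "determined B (\<lambda>x. u x *\<^sub>R p B x)"
      using that A(2) by (intro determined_comp2[of _ _ _ scaleR] det determined_mono[OF u(1)]) auto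
    moreover have "i < N" using that A(2) by blast
    ultimately have "mean (\<lambda>x. inner (u x *\<^sub>R p B x) (p A x)) = mean (\<lambda>x. inner (u x *\<^sub>R p B x) (avg i (p A) x))"
      using that by (intro mean_inner_determined) auto
    moreover have "avg i (p A) x = 0" for x
      unfolding p_def using that fin[OF that(1)] A(2)[OF that(2)] by (intro avg_proj) auto
    ultimately show ?thesis by (simp add: inner_commute mean_const)
  qed
  have off: "mean (\<lambda>x. u x * inner (p A x) (p B x)) = 0" if "A \<in> \<A>" "B \<in> \<A>" and ne: "A \<noteq> B" for A B
  proof (cases "A \<subseteq> B")
    case True
    then obtain i where "i \<in> B" "i \<notin> A" using ne by blast
    then show ?thesis using orth[of B A i] that by (simp add: inner_commute)
  next
    case False
    then show ?thesis using orth[of A B] that by blast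
  qed
  have "mean (\<lambda>x. u x * (norm (\<Sum>A\<in>\<A>. p A x))\<^sup>2) =
      (\<Sum>A\<in>\<A>. \<Sum>B\<in>\<A>. mean (\<lambda>x. u x * inner (p A x) (p B x)))"
    by (simp add: power2_norm_eq_inner inner_sum_left inner_sum_right sum_distrib_left mean_sum inner_commute)
  also have "\<dots> = (\<Sum>A\<in>\<A>. \<Sum>B\<in>\<A>. if B = A then mean (\<lambda>x. u x * (norm (p A x))\<^sup>2) else 0)"
    by (intro sum.cong refl) (auto simp: off power2_norm_eq_inner)
  also have "\<dots> = (\<Sum>A\<in>\<A>. mean (\<lambda>x. u x * (norm (p A x))\<^sup>2))"
    using A(1) by simp
  also have "\<dots> \<le> (\<Sum>A\<in>\<A>. mean (\<lambda>x. u x * (norm (\<phi> A x))\<^sup>2))"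
    unfolding p_def using A u fin by (intro sum_mono mean_sq_proj[OF _ _ u(1)]) auto
  finally show ?thesis by (simp add: p_def)
qed

section \<open>Packing weights and their consequences\<close>

text \<open>
  The probability that a random word agrees with \<open>z\<close> on \<open>b\<close>.
\<close>

definition cyl :: "nat set \<Rightarrow> (nat \<Rightarrow> 'c) \<Rightarrow> real" where
  "cyl b z = (\<Sum>x | x \<in> words \<and> agree b z x. weight x)"

lemma cyl_nonneg: "0 \<le> cyl b z"
  unfolding cyl_def by (auto intro!: sum_nonneg weight_nonneg)

lemma cyl_zero:
  assumes "cyl b z = 0" "x \<in> words" "agree b z x"
  shows "weight x = 0"
  using assms sum_nonneg_eq_0_iff[of "{x. x \<in> words \<and> agree b z x}" weight] weight_nonneg
  unfolding cyl_def by auto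

lemma cyl_cong:
  assumes "agree b z x" shows "cyl b z = cyl b x"
proof -
  have "agree b z y \<longleftrightarrow> agree b x y" for y
    using assms by (auto simp: agree_def)
  then show ?thesis by (simp add: cyl_def)
qed

lemma sum_filter_swap:
  fixes h :: "(nat \<Rightarrow> 'c) \<Rightarrow> (nat \<Rightarrow> 'c) \<Rightarrow> real"
  shows "(\<Sum>z\<in>words. \<Sum>x | x \<in> words \<and> agree b z x. h z x) =
    (\<Sum>x\<in>words. \<Sum>z | z \<in> words \<and> agree b x z. h z x)"
proof -
  have "(\<Sum>z\<in>words. \<Sum>x | x \<in> words \<and> agree b z x. h z x) =
      (\<Sum>z\<in>words. \<Sum>x\<in>words. if agree b z x then h z x else 0)"
    by (simp add: sum.inter_filter)
  also have "\<dots> = (\<Sum>x\<in>words. \<Sum>z\<in>words. if agree b x z then h z x else 0)"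
    by (subst sum.swap) (simp add: agree_sym)
  also have "\<dots> = (\<Sum>x\<in>words. \<Sum>z | z \<in> words \<and> agree b x z. h z x)"
    by (simp add: sum.inter_filter)
  finally show ?thesis .
qed

text \<open>
  An inequality between conditional expectations given \<open>x\<^sub>b\<close>, in integrated form: it may be tested with
  every nonnegative function \<open>u\<close> of \<open>x\<^sub>b\<close>.
\<close>

lemma mean_localize:
  assumes u: "determined b u" "\<And>x. x \<in> words \<Longrightarrow> 0 \<le> u x"
    and le: "\<And>z. z \<in> words \<Longrightarrow> (\<Sum>x | x \<in> words \<and> agree b z x. weight x * \<psi> x) \<le> L * cyl b z"
  shows "mean (\<lambda>x. u x * \<psi> x) \<le> L * mean u"
proof -
  \<comment> \<open>Division by zero yields zero here, which is the right value: then \<open>weight z = 0\<close> as well.\<close>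
  define \<rho> where "\<rho> z = weight z * u z / cyl b z" for z
  have \<rho>: "0 \<le> \<rho> z" if "z \<in> words" for z
    unfolding \<rho>_def using that u(2) by (auto intro!: divide_nonneg_nonneg mult_nonneg_nonneg weight_nonneg cyl_nonneg)
  have "(\<Sum>z\<in>words. \<rho> z * (\<Sum>x | x \<in> words \<and> agree b z x. weight x * \<psi> x)) =
      (\<Sum>x\<in>words. \<Sum>z | z \<in> words \<and> agree b x z. \<rho> z * (weight x * \<psi> x))"
    by (simp only: sum_distrib_left) (rule sum_filter_swap)
  also have "\<dots> = (\<Sum>x\<in>words. weight x * (u x * \<psi> x))"
  proof (intro sum.cong refl)
    fix x assume x: "x \<in> words"
    have "\<rho> z * (weight x * \<psi> x) = weight z * (u x * (weight x * \<psi> x) / cyl b x)"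
      if "z \<in> words" "agree b x z" for z
      using determinedD[OF u(1) x that] cyl_cong[OF that(2)] by (simp add: \<rho>_def)
    then have "(\<Sum>z | z \<in> words \<and> agree b x z. \<rho> z * (weight x * \<psi> x)) =
        (\<Sum>z | z \<in> words \<and> agree b x z. weight z * (u x * (weight x * \<psi> x) / cyl b x))"
      by (intro sum.cong) auto
    also have "\<dots> = cyl b x * (u x * (weight x * \<psi> x) / cyl b x)"
      unfolding cyl_def[of b x] by (rule sum_distrib_right[symmetric])
    also have "\<dots> = weight x * (u x * \<psi> x)"
      using cyl_zero[of b x x] x by (cases "cyl b x = 0") (auto simp: agree_def)
    finally show "(\<Sum>z | z \<in> words \<and> agree b x z. \<rho> z * (weight x * \<psi> x)) = weight x * (u x * \<psi> x)" .
  qed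
  also have "\<dots> = mean (\<lambda>x. u x * \<psi> x)" by (simp add: mean_def)
  finally have "mean (\<lambda>x. u x * \<psi> x) = (\<Sum>z\<in>words. \<rho> z * (\<Sum>x | x \<in> words \<and> agree b z x. weight x * \<psi> x))" ..
  also have "\<dots> \<le> (\<Sum>z\<in>words. \<rho> z * (L * cyl b z))"
    by (intro sum_mono mult_left_mono le \<rho>)
  also have "\<dots> = (\<Sum>z\<in>words. L * (weight z * u z))"
  proof (intro sum.cong refl)
    fix z assume z: "z \<in> words"
    show "\<rho> z * (L * cyl b z) = L * (weight z * u z)"
      using cyl_zero[of b z z] z by (cases "cyl b z = 0") (auto simp: agree_def \<rho>_def)
  qed
  also have "\<dots> = L * mean u" by (simp add: mean_def sum_distrib_left)
  finally show ?thesis .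
qed

text \<open>
  The application of \<open>optimal_weights\<close>. The index \<open>k\<close> runs over classes of weights; a weight of class \<open>k\<close>
  serves the components \<open>n \<in> I k\<close> and costs \<open>(\<tau> k)\<^sup>2\<close>. The weights are indexed by a set \<open>b\<close> and a whole word
  \<open>z\<close>, although only the restriction of \<open>z\<close> to \<open>b\<close> matters: the sum of all weights with the same
  restriction is the weight of class \<open>k\<close> at \<open>b\<close>, and it costs what a single one would.
\<close>

lemma packing_weights:
  fixes s :: "nat \<Rightarrow> nat set \<Rightarrow> (nat \<Rightarrow> 'c) \<Rightarrow> real" and I :: "nat \<Rightarrow> nat set"
  assumes fin: "finite \<A>" "finite \<B>" "finite K"
    and I: "\<And>k. k \<in> K \<Longrightarrow> I k \<subseteq> {..<d}"
    and \<tau>: "\<And>k. k \<in> K \<Longrightarrow> 0 < \<tau> k"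
    and s: "\<And>n A x. x \<in> words \<Longrightarrow> 0 \<le> s n A x"
    and "0 < \<eta>"
  obtains w where "\<And>k b x. 0 \<le> w k b x" and "\<And>k b. determined b (w k b)"
    and "\<And>k b u. k \<in> K \<Longrightarrow> b \<in> \<B> \<Longrightarrow> determined b u \<Longrightarrow> (\<And>x. x \<in> words \<Longrightarrow> 0 \<le> u x) \<Longrightarrow>
      mean (\<lambda>x. u x * (\<Sum>n\<in>I k. \<Sum>A | A \<in> \<A> \<and> b \<subseteq> A.
        s n A x / (\<eta> + (\<Sum>k | k \<in> K \<and> n \<in> I k. \<Sum>b | b \<in> \<B> \<and> b \<subseteq> A. w k b x))\<^sup>2))
      \<le> 2 * (\<tau> k)\<^sup>2 * mean u"
    and "(\<Sum>k\<in>K. \<Sum>b\<in>\<B>. (\<tau> k)\<^sup>2 * mean (w k b)) \<le> 2 * (\<Sum>n<d. \<Sum>A\<in>\<A>. mean (\<lambda>x.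
        s n A x / (\<eta> + (\<Sum>k | k \<in> K \<and> n \<in> I k. \<Sum>b | b \<in> \<B> \<and> b \<subseteq> A. w k b x))))"
proof -
  define \<Theta> where "\<Theta> = K \<times> \<B> \<times> words"
  define \<Xi> where "\<Xi> = {..<d} \<times> \<A> \<times> words"
  define R where "R \<theta> \<xi> = (case \<theta> of (k, b, z) \<Rightarrow> case \<xi> of (n, A, x) \<Rightarrow> n \<in> I k \<and> b \<subseteq> A \<and> agree b z x)"
    for \<theta> :: "nat \<times> nat set \<times> (nat \<Rightarrow> 'c)" and \<xi> :: "nat \<times> nat set \<times> (nat \<Rightarrow> 'c)"
  define a where "a \<xi> = (case \<xi> of (n, A, x) \<Rightarrow> weight x * s n A x)" for \<xi>
  define c where "c \<theta> = (case \<theta> of (k, b, z) \<Rightarrow> (\<tau> k)\<^sup>2 * cyl b z)" for \<theta> :: "nat \<times> nat set \<times> (nat \<Rightarrow> 'c)"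
  have finX: "finite \<Xi>" "finite \<Theta>" using fin by (auto simp: \<Xi>_def \<Theta>_def)
  have a0: "0 \<le> a \<xi>" if "\<xi> \<in> \<Xi>" for \<xi>
    using that s by (auto simp: a_def \<Xi>_def intro!: mult_nonneg_nonneg weight_nonneg)
  have c0: "0 \<le> c \<theta>" if "\<theta> \<in> \<Theta>" for \<theta>
    by (auto simp: c_def cyl_nonneg split: prod.split)
  have null: "a \<xi> = 0" if "\<theta> \<in> \<Theta>" "\<xi> \<in> \<Xi>" "c \<theta> = 0" "R \<theta> \<xi>" for \<theta> \<xi>
  proof -
    obtain k b z n A x where eq: "\<theta> = (k, b, z)" "\<xi> = (n, A, x)"
      by (cases \<theta>, cases \<xi>) auto
    have "cyl b z = 0" "x \<in> words" "agree b z x"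
      using that \<tau>[of k] by (auto simp: eq c_def R_def \<Theta>_def \<Xi>_def)
    then show ?thesis
      using cyl_zero[of b z x] by (simp add: eq a_def)
  qed
  obtain w0 where w0: "\<And>\<theta>. 0 \<le> w0 \<theta>"
    and le1: "\<And>\<theta>. \<theta> \<in> \<Theta> \<Longrightarrow>
      (\<Sum>\<xi> | \<xi> \<in> \<Xi> \<and> R \<theta> \<xi>. a \<xi> / (\<eta> + (\<Sum>\<theta> | \<theta> \<in> \<Theta> \<and> R \<theta> \<xi>. w0 \<theta>))\<^sup>2) \<le> 2 * c \<theta>"
    and le2: "(\<Sum>\<theta>\<in>\<Theta>. c \<theta> * w0 \<theta>) \<le> 2 * (\<Sum>\<xi>\<in>\<Xi>. a \<xi> / (\<eta> + (\<Sum>\<theta> | \<theta> \<in> \<Theta> \<and> R \<theta> \<xi>. w0 \<theta>)))"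
    by (rule optimal_weights[OF finX a0 c0 null \<open>0 < \<eta>\<close>]) (assumption | rule that)+
  define w where "w k b x = (\<Sum>z | z \<in> words \<and> agree b x z. w0 (k, b, z))" for k b x
  define V where "V n A x = \<eta> + (\<Sum>k | k \<in> K \<and> n \<in> I k. \<Sum>b | b \<in> \<B> \<and> b \<subseteq> A. w k b x)" for n A x
  have V: "\<eta> + (\<Sum>\<theta> | \<theta> \<in> \<Theta> \<and> R \<theta> (n, A, x). w0 \<theta>) = V n A x" for n A x
  proof -
    have "{\<theta>. \<theta> \<in> \<Theta> \<and> R \<theta> (n, A, x)} =
        (SIGMA k:{k. k \<in> K \<and> n \<in> I k}. SIGMA b:{b. b \<in> \<B> \<and> b \<subseteq> A}. {z. z \<in> words \<and> agree b x z})"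
      by (auto simp: \<Theta>_def R_def agree_sym)
    then show ?thesis
      using fin by (simp add: V_def w_def sum.Sigma)
  qed
  show thesis
  proof (rule that[of w, folded V_def])
    show "0 \<le> w k b x" for k b x
      unfolding w_def by (intro sum_nonneg w0)
    show "determined b (w k b)" for k b
    proof (unfold determined_def, intro ballI impI)
      fix x y :: "nat \<Rightarrow> 'c" assume "agree b x y"
      then have "agree b x z \<longleftrightarrow> agree b y z" for z
        by (auto simp: agree_def)
      then show "w k b x = w k b y" by (simp add: w_def)
    qed
    show "mean (\<lambda>x. u x * (\<Sum>n\<in>I k. \<Sum>A | A \<in> \<A> \<and> b \<subseteq> A. s n A x / (V n A x)\<^sup>2)) \<le> 2 * (\<tau> k)\<^sup>2 * mean u"
      if kb: "k \<in> K" "b \<in> \<B>" and u: "determined b u" "\<And>x. x \<in> words \<Longrightarrow> 0 \<le> u x" for k b u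
    proof (rule mean_localize[OF u])
      fix z assume z: "z \<in> words"
      have "{\<xi>. \<xi> \<in> \<Xi> \<and> R (k, b, z) \<xi>} = I k \<times> {A. A \<in> \<A> \<and> b \<subseteq> A} \<times> {x. x \<in> words \<and> agree b z x}"
        using I[OF kb(1)] by (auto simp: \<Xi>_def R_def)
      then have "(\<Sum>\<xi> | \<xi> \<in> \<Xi> \<and> R (k, b, z) \<xi>. a \<xi> / (\<eta> + (\<Sum>\<theta> | \<theta> \<in> \<Theta> \<and> R \<theta> \<xi>. w0 \<theta>))\<^sup>2) =
        (\<Sum>n\<in>I k. \<Sum>A | A \<in> \<A> \<and> b \<subseteq> A. \<Sum>x | x \<in> words \<and> agree b z x. weight x * s n A x / (V n A x)\<^sup>2)"
        by (simp add: sum.cartesian_product' V a_def)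
      also have "\<dots> = (\<Sum>x | x \<in> words \<and> agree b z x. \<Sum>n\<in>I k. \<Sum>A | A \<in> \<A> \<and> b \<subseteq> A. weight x * s n A x / (V n A x)\<^sup>2)"
      proof -
        have "(\<Sum>A | A \<in> \<A> \<and> b \<subseteq> A. \<Sum>x | x \<in> words \<and> agree b z x. weight x * s n A x / (V n A x)\<^sup>2) =
            (\<Sum>x | x \<in> words \<and> agree b z x. \<Sum>A | A \<in> \<A> \<and> b \<subseteq> A. weight x * s n A x / (V n A x)\<^sup>2)" for n
          by (rule sum.swap)
        then show ?thesis by (simp only:) (rule sum.swap)
      qed
      finally have "(\<Sum>x | x \<in> words \<and> agree b z x. weight x * (\<Sum>n\<in>I k. \<Sum>A | A \<in> \<A> \<and> b \<subseteq> A. s n A x / (V n A x)\<^sup>2))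
          = (\<Sum>\<xi> | \<xi> \<in> \<Xi> \<and> R (k, b, z) \<xi>. a \<xi> / (\<eta> + (\<Sum>\<theta> | \<theta> \<in> \<Theta> \<and> R \<theta> \<xi>. w0 \<theta>))\<^sup>2)"
        by (simp add: sum_distrib_left)
      also have "\<dots> \<le> 2 * c (k, b, z)"
        by (rule le1) (use kb z in \<open>auto simp: \<Theta>_def\<close>)
      finally show "(\<Sum>x | x \<in> words \<and> agree b z x. weight x * (\<Sum>n\<in>I k. \<Sum>A | A \<in> \<A> \<and> b \<subseteq> A. s n A x / (V n A x)\<^sup>2))
          \<le> 2 * (\<tau> k)\<^sup>2 * cyl b z"
        by (simp add: c_def)
    qed
    show "(\<Sum>k\<in>K. \<Sum>b\<in>\<B>. (\<tau> k)\<^sup>2 * mean (w k b)) \<le>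
      2 * (\<Sum>n<d. \<Sum>A\<in>\<A>. mean (\<lambda>x. s n A x / V n A x))"
    proof -
      have "mean (w k b) = (\<Sum>z\<in>words. cyl b z * w0 (k, b, z))" for k b
      proof -
        have "mean (w k b) = (\<Sum>x\<in>words. \<Sum>z | z \<in> words \<and> agree b x z. weight x * w0 (k, b, z))"
          by (simp add: mean_def w_def sum_distrib_left)
        also have "\<dots> = (\<Sum>z\<in>words. \<Sum>x | x \<in> words \<and> agree b z x. weight x * w0 (k, b, z))"
          by (rule sum_filter_swap)
        finally show ?thesis by (simp add: cyl_def sum_distrib_right)
      qed
      then have "(\<Sum>k\<in>K. \<Sum>b\<in>\<B>. (\<tau> k)\<^sup>2 * mean (w k b)) = (\<Sum>\<theta>\<in>\<Theta>. c \<theta> * w0 \<theta>)"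
        by (simp add: \<Theta>_def sum.cartesian_product' c_def sum_distrib_left mult.assoc)
      also note le2
      also have "(\<Sum>\<xi>\<in>\<Xi>. a \<xi> / (\<eta> + (\<Sum>\<theta> | \<theta> \<in> \<Theta> \<and> R \<theta> \<xi>. w0 \<theta>))) =
          (\<Sum>n<d. \<Sum>A\<in>\<A>. mean (\<lambda>x. s n A x / V n A x))"
        by (simp add: \<Xi>_def sum.cartesian_product' V a_def mean_def)
      finally show ?thesis .
    qed
  qed
qed

text \<open>
  The conditional expectation of \<open>u\<close> given the coordinates in \<open>A - S\<close>, characterised by
  integration against functions into which the coordinates in \<open>S\<close> do not enter.
\<close>

lemma average_out:
  fixes u :: "(nat \<Rightarrow> 'c) \<Rightarrow> real"
  assumes "finite S" "S \<subseteq> {..<N}" "determined A u" "\<And>x. x \<in> words \<Longrightarrow> 0 \<le> u x"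
  shows "\<exists>v. determined (A - S) v \<and> (\<forall>x\<in>words. 0 \<le> v x) \<and>
    (\<forall>B F. determined B F \<longrightarrow> B \<inter> S = {} \<longrightarrow> mean (\<lambda>x. v x * F x) = mean (\<lambda>x. u x * F x))"
  using assms(1,2)
proof (induction S rule: finite_induct)
  case empty
  then show ?case using assms(3,4) by auto
next
  case (insert i S)
  then obtain v where v: "determined (A - S) v" "\<forall>x\<in>words. 0 \<le> v x"
    "\<forall>B F. determined B F \<longrightarrow> B \<inter> S = {} \<longrightarrow> mean (\<lambda>x. v x * F x) = mean (\<lambda>x. u x * F x)"
    by auto
  have i: "i < N" using insert by auto
  show ?case
  proof (intro exI[of _ "avg i v"] conjI ballI allI impI)
    have "A - insert i S = (A - S) - {i}" by auto
    then show "determined (A - insert i S) (avg i v)"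
      using determined_avg[OF v(1) i] by simp
    show "0 \<le> avg i v x" if "x \<in> words" for x
      using that v(2) i by (auto simp: avg_def intro!: sum_nonneg mult_nonneg_nonneg pi_nonneg upd_words)
    show "mean (\<lambda>x. avg i v x * F x) = mean (\<lambda>x. u x * F x)"
      if F: "determined B F" "B \<inter> insert i S = {}" for B F
    proof -
      have "mean (\<lambda>x. F x * v x) = mean (\<lambda>x. F x * avg i v x)"
        using mean_inner_determined[OF F(1) _ i, of v] F(2) by auto
      moreover have "mean (\<lambda>x. v x * F x) = mean (\<lambda>x. u x * F x)"
        using v(3) F by auto
      ultimately show ?thesis by (simp add: mult.commute)
    qed
  qed
qed

text \<open>
  Sort the sets \<open>B\<close> by \<open>b = A \<inter> B\<close>. The function \<open>\<psi> B\<close> does not see the coordinates in \<open>A - b\<close>, so these may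
  be averaged out of \<open>u\<close>, and the packing condition at \<open>b\<close> applies to the result. There are
  \<open>2 ^ card A\<close> possibilities for \<open>b\<close>.
\<close>

lemma mean_packed_sum:
  fixes \<psi> :: "nat set \<Rightarrow> (nat \<Rightarrow> 'c) \<Rightarrow> real"
  assumes "finite \<A>" and \<psi>: "\<And>B. B \<in> \<A> \<Longrightarrow> determined B (\<psi> B)"
    "\<And>B x. B \<in> \<A> \<Longrightarrow> x \<in> words \<Longrightarrow> 0 \<le> \<psi> B x"
    and A: "A \<subseteq> {..<N}"
    and u: "determined A u" "\<And>x. x \<in> words \<Longrightarrow> 0 \<le> u x"
    and pack: "\<And>b v. b \<subseteq> A \<Longrightarrow> determined b v \<Longrightarrow> (\<And>x. x \<in> words \<Longrightarrow> 0 \<le> v x) \<Longrightarrow>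
      mean (\<lambda>x. v x * (\<Sum>B | B \<in> \<A> \<and> b \<subseteq> B. \<psi> B x)) \<le> L * mean v"
  shows "mean (\<lambda>x. u x * (\<Sum>B\<in>\<A>. \<psi> B x)) \<le> 2 ^ card A * L * mean u"
proof -
  have "finite A" using A finite_subset by auto
  have part: "(\<Sum>B | B \<in> \<A> \<and> A \<inter> B = b. mean (\<lambda>x. u x * \<psi> B x)) \<le> L * mean u" if "b \<in> Pow A" for b
  proof -
    obtain v where v: "determined (A - (A - b)) v" "\<And>x. x \<in> words \<Longrightarrow> 0 \<le> v x"
      and vF: "\<And>B F. determined B F \<Longrightarrow> B \<inter> (A - b) = {} \<Longrightarrow> mean (\<lambda>x. v x * F x) = mean (\<lambda>x. u x * F x)"
      using average_out[of "A - b" A u] A u \<open>finite A\<close> by blast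
    have "A - (A - b) = b" using that by auto
    have "(\<Sum>B | B \<in> \<A> \<and> A \<inter> B = b. mean (\<lambda>x. u x * \<psi> B x)) = (\<Sum>B | B \<in> \<A> \<and> A \<inter> B = b. mean (\<lambda>x. v x * \<psi> B x))"
      using \<psi>(1) by (intro sum.cong refl vF[symmetric]) auto
    also have "\<dots> \<le> (\<Sum>B | B \<in> \<A> \<and> b \<subseteq> B. mean (\<lambda>x. v x * \<psi> B x))"
      using assms(1) \<psi>(2) v(2) by (intro sum_mono2) (auto intro!: mean_nonneg)
    also have "\<dots> = mean (\<lambda>x. v x * (\<Sum>B | B \<in> \<A> \<and> b \<subseteq> B. \<psi> B x))"
      by (simp add: sum_distrib_left mean_sum)
    also have "\<dots> \<le> L * mean v"
      using that v \<open>A - (A - b) = b\<close> by (intro pack) auto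
    also have "mean v = mean u"
      using vF[OF determined_const[of "{}" 1]] by simp
    finally show ?thesis .
  qed
  have "mean (\<lambda>x. u x * (\<Sum>B\<in>\<A>. \<psi> B x)) = (\<Sum>B\<in>\<A>. mean (\<lambda>x. u x * \<psi> B x))"
    by (simp add: sum_distrib_left mean_sum)
  also have "\<dots> = (\<Sum>b\<in>Pow A. \<Sum>B | B \<in> \<A> \<and> A \<inter> B = b. mean (\<lambda>x. u x * \<psi> B x))"
    using assms(1) \<open>finite A\<close> by (intro sum.group[symmetric]) auto
  also have "\<dots> \<le> (\<Sum>b\<in>Pow A. L * mean u)"
    by (intro sum_mono part)
  also have "\<dots> = 2 ^ card A * L * mean u"
    using \<open>finite A\<close> by (simp add: card_Pow)
  finally show ?thesis .
qed

text \<open>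
  The function \<open>w b\<close> does not depend on coordinates outside \<open>b\<close>, so centring in \<open>A\<close> amounts to centring
  \<open>\<phi> n A\<close> in \<open>A - b\<close>, multiplying by \<open>w b\<close> and centring in \<open>b\<close>. The last step costs a factor
  \<open>2 ^ card b\<close> in \<open>L\<^sup>1\<close>. Before it, the norm over \<open>n \<in> I\<close> of
  \<open>F b n = (\<Sum>A\<supseteq>b. proj (A - b) (\<phi> n A))\<close> is estimated through its square by the inequality
  \<open>2 \<tau> z \<le> \<tau>\<^sup>2 + z\<^sup>2\<close>; the square is controlled by \<open>weighted_bessel\<close> and the packing condition, which
  yield a multiple of \<open>\<tau>\<^sup>2\<close> times the mean of \<open>w b\<close>.
\<close>

lemma class_bound:
  fixes \<phi> :: "nat \<Rightarrow> nat set \<Rightarrow> (nat \<Rightarrow> 'c) \<Rightarrow> 'v::real_inner"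
  assumes fin: "finite \<A>" "finite \<B>"
    and \<A>: "\<And>A. A \<in> \<A> \<Longrightarrow> A \<subseteq> {..<N}" "\<And>n A. A \<in> \<A> \<Longrightarrow> determined A (\<phi> n A)"
    and \<B>: "\<And>b. b \<in> \<B> \<Longrightarrow> b \<subseteq> {..<N} \<and> card b \<le> m"
    and w: "\<And>b. b \<in> \<B> \<Longrightarrow> determined b (w b)" "\<And>b x. b \<in> \<B> \<Longrightarrow> 0 \<le> w b x"
    and pack: "\<And>b u. b \<in> \<B> \<Longrightarrow> determined b u \<Longrightarrow> (\<And>x. x \<in> words \<Longrightarrow> 0 \<le> u x) \<Longrightarrow>
      mean (\<lambda>x. u x * (\<Sum>n\<in>I. \<Sum>A | A \<in> \<A> \<and> b \<subseteq> A. (norm (\<phi> n A x))\<^sup>2)) \<le> 2 * \<tau>\<^sup>2 * mean u"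
  shows "\<tau> * mean (\<lambda>x. l2_part I (\<lambda>n. \<Sum>A\<in>\<A>. \<Sum>b | b \<in> \<B> \<and> b \<subseteq> A. proj A (\<lambda>y. w b y *\<^sub>R \<phi> n A y) x))
    \<le> 2 ^ (m + 1) * (\<Sum>b\<in>\<B>. \<tau>\<^sup>2 * mean (w b))"
proof (cases "0 \<le> \<tau>")
  case False
  then show ?thesis
    using w by (intro order_trans[OF mult_nonpos_nonneg])
      (auto intro!: mean_nonneg sum_nonneg mult_nonneg_nonneg)
next
  case True
  define F where "F b n y = (\<Sum>A | A \<in> \<A> \<and> b \<subseteq> A. proj (A - b) (\<phi> n A) y)" for b n y
  have finb: "finite b" if "b \<subseteq> {..<N}" for b using that finite_subset by auto
  have eq: "(\<Sum>A\<in>\<A>. \<Sum>b | b \<in> \<B> \<and> b \<subseteq> A. proj A (\<lambda>y. w b y *\<^sub>R \<phi> n A y) x) =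
      (\<Sum>b\<in>\<B>. proj b (\<lambda>y. w b y *\<^sub>R F b n y) x)" if x: "x \<in> words" for n x
  proof -
    have "proj A (\<lambda>y. w b y *\<^sub>R \<phi> n A y) x = proj b (\<lambda>y. w b y *\<^sub>R proj (A - b) (\<phi> n A) y) x"
      if "A \<in> \<A>" "b \<in> \<B>" "b \<subseteq> A" for A b
    proof -
      have f: "finite b" "finite (A - b)" "A - b \<subseteq> {..<N}" "b \<subseteq> {..<N}"
        using finb \<A>(1)[OF that(1)] \<B>[OF that(2)] by (auto intro: finite_subset)
      have "b \<union> (A - b) = A" using that by auto
      then have "proj A (\<lambda>y. w b y *\<^sub>R \<phi> n A y) x = proj b (proj (A - b) (\<lambda>y. w b y *\<^sub>R \<phi> n A y)) x"
        using proj_Un[of b "A - b" "\<lambda>y. w b y *\<^sub>R \<phi> n A y"] f by auto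
      also have "\<dots> = proj b (\<lambda>y. w b y *\<^sub>R proj (A - b) (\<phi> n A) y) x"
        using f w(1)[OF that(2)] x by (intro proj_cong proj_scaleR_determined) auto
      finally show ?thesis .
    qed
    then have "(\<Sum>A\<in>\<A>. \<Sum>b | b \<in> \<B> \<and> b \<subseteq> A. proj A (\<lambda>y. w b y *\<^sub>R \<phi> n A y) x) =
        (\<Sum>A\<in>\<A>. \<Sum>b | b \<in> \<B> \<and> b \<subseteq> A. proj b (\<lambda>y. w b y *\<^sub>R proj (A - b) (\<phi> n A) y) x)"
      by (intro sum.cong) auto
    also have "\<dots> = (\<Sum>b\<in>\<B>. \<Sum>A | A \<in> \<A> \<and> b \<subseteq> A. proj b (\<lambda>y. w b y *\<^sub>R proj (A - b) (\<phi> n A) y) x)"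
      using fin by (rule sum.swap_restrict)
    also have "\<dots> = (\<Sum>b\<in>\<B>. proj b (\<lambda>y. w b y *\<^sub>R F b n y) x)"
    proof (intro sum.cong refl)
      fix b assume "b \<in> \<B>"
      then have "finite b" using \<B> finb by blast
      then show "(\<Sum>A | A \<in> \<A> \<and> b \<subseteq> A. proj b (\<lambda>y. w b y *\<^sub>R proj (A - b) (\<phi> n A) y) x) =
          proj b (\<lambda>y. w b y *\<^sub>R F b n y) x"
        by (simp add: F_def scaleR_sum_right proj_sum)
    qed
    finally show ?thesis .
  qed
  have part: "\<tau> * mean (\<lambda>x. l2_part I (\<lambda>n. proj b (\<lambda>y. w b y *\<^sub>R F b n y) x)) \<le> 2 ^ m * (2 * (\<tau>\<^sup>2 * mean (w b)))"
    if b: "b \<in> \<B>" for b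
  proof -
    have fb: "finite b" "b \<subseteq> {..<N}" "card b \<le> m" using \<B>[OF b] finb by auto
    have sq: "mean (\<lambda>x. w b x * (l2_part I (\<lambda>n. F b n x))\<^sup>2) \<le> 2 * \<tau>\<^sup>2 * mean (w b)"
    proof -
      have "mean (\<lambda>x. w b x * (l2_part I (\<lambda>n. F b n x))\<^sup>2) = (\<Sum>n\<in>I. mean (\<lambda>x. w b x * (norm (F b n x))\<^sup>2))"
        by (simp add: l2_part_sq sum_distrib_left mean_sum)
      also have "\<dots> \<le> (\<Sum>n\<in>I. \<Sum>A | A \<in> \<A> \<and> b \<subseteq> A. mean (\<lambda>x. w b x * (norm (\<phi> n A x))\<^sup>2))"
        unfolding F_def using fin \<A> w b by (intro sum_mono weighted_bessel) auto
      also have "\<dots> = mean (\<lambda>x. w b x * (\<Sum>n\<in>I. \<Sum>A | A \<in> \<A> \<and> b \<subseteq> A. (norm (\<phi> n A x))\<^sup>2))"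
        by (simp add: sum_distrib_left mean_sum)
      also have "\<dots> \<le> 2 * \<tau>\<^sup>2 * mean (w b)"
        using w b by (intro pack) auto
      finally show ?thesis .
    qed
    have "\<tau> * mean (\<lambda>x. l2_part I (\<lambda>n. proj b (\<lambda>y. w b y *\<^sub>R F b n y) x)) \<le>
        \<tau> * (2 ^ card b * mean (\<lambda>x. l2_part I (\<lambda>n. w b x *\<^sub>R F b n x)))"
      using fb True by (intro mult_left_mono mean_l2_part_proj) auto
    also have "\<dots> = 2 ^ card b * mean (\<lambda>x. \<tau> * (w b x * l2_part I (\<lambda>n. F b n x)))"
      using w(2)[OF b] by (simp add: l2_part_scale mean_mult)
    also have "\<dots> \<le> 2 ^ m * mean (\<lambda>x. \<tau> * (w b x * l2_part I (\<lambda>n. F b n x)))"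
      using fb w(2)[OF b] True by (intro mult_right_mono power_increasing mean_nonneg) auto
    also have "\<dots> \<le> 2 ^ m * mean (\<lambda>x. (1/2) * (\<tau>\<^sup>2 * w b x) + (1/2) * (w b x * (l2_part I (\<lambda>n. F b n x))\<^sup>2))"
    proof (intro mult_left_mono mean_mono)
      fix x
      have "2 * (\<tau> * l2_part I (\<lambda>n. F b n x)) \<le> \<tau>\<^sup>2 + (l2_part I (\<lambda>n. F b n x))\<^sup>2"
        using sum_squares_bound[of \<tau> "l2_part I (\<lambda>n. F b n x)"] by simp
      from mult_left_mono[OF this w(2)[OF b, of x]]
      show "\<tau> * (w b x * l2_part I (\<lambda>n. F b n x)) \<le> (1/2) * (\<tau>\<^sup>2 * w b x) + (1/2) * (w b x * (l2_part I (\<lambda>n. F b n x))\<^sup>2)"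
        by (simp add: algebra_simps)
    qed simp
    also have "\<dots> = 2 ^ m * ((1/2) * (\<tau>\<^sup>2 * mean (w b)) + (1/2) * mean (\<lambda>x. w b x * (l2_part I (\<lambda>n. F b n x))\<^sup>2))"
      by (simp only: mean_add mean_mult)
    also have "\<dots> \<le> 2 ^ m * (2 * (\<tau>\<^sup>2 * mean (w b)))"
    proof (rule mult_left_mono)
      have "0 \<le> \<tau>\<^sup>2 * mean (w b)"
        using w(2)[OF b] by (intro mult_nonneg_nonneg mean_nonneg) auto
      then show "(1/2) * (\<tau>\<^sup>2 * mean (w b)) + (1/2) * mean (\<lambda>x. w b x * (l2_part I (\<lambda>n. F b n x))\<^sup>2) \<le> 2 * (\<tau>\<^sup>2 * mean (w b))"
        using sq by (simp add: mult.assoc)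
    qed simp
    finally show ?thesis .
  qed
  have "mean (\<lambda>x. l2_part I (\<lambda>n. \<Sum>A\<in>\<A>. \<Sum>b | b \<in> \<B> \<and> b \<subseteq> A. proj A (\<lambda>y. w b y *\<^sub>R \<phi> n A y) x)) \<le>
      mean (\<lambda>x. \<Sum>b\<in>\<B>. l2_part I (\<lambda>n. proj b (\<lambda>y. w b y *\<^sub>R F b n y) x))"
    by (intro mean_mono) (simp add: eq l2_part_sum)
  from mult_left_mono[OF this True]
  have "\<tau> * mean (\<lambda>x. l2_part I (\<lambda>n. \<Sum>A\<in>\<A>. \<Sum>b | b \<in> \<B> \<and> b \<subseteq> A. proj A (\<lambda>y. w b y *\<^sub>R \<phi> n A y) x)) \<le>
      (\<Sum>b\<in>\<B>. \<tau> * mean (\<lambda>x. l2_part I (\<lambda>n. proj b (\<lambda>y. w b y *\<^sub>R F b n y) x)))"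
    by (simp add: mean_sum sum_distrib_left)
  also have "\<dots> \<le> (\<Sum>b\<in>\<B>. 2 ^ m * (2 * (\<tau>\<^sup>2 * mean (w b))))"
    by (intro sum_mono part)
  also have "\<dots> = 2 ^ (m + 1) * (\<Sum>b\<in>\<B>. \<tau>\<^sup>2 * mean (w b))"
    by (simp add: sum_distrib_left mult_ac)
  finally show ?thesis .
qed

end

section \<open>Noise operators and the decomposition on a finite power\<close>

text \<open>
  The factor lost in \<open>dual_lift\<close>: \<open>3 ^ m\<close> from Khinchine's inequality, the rest from extracting the
  product of signs.
\<close>

definition lift_const :: "nat \<Rightarrow> real" where
  "lift_const m = (\<Sum>j\<le>m. \<bar>3 ^ m * 2 ^ m * coeff (extraction_poly m) j / poly (extraction_poly m) (1 / 2 ^ m)\<bar>)"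

definition constituents :: "nat \<Rightarrow> nat \<Rightarrow> nat set set" where
  "constituents N m = {A. A \<subseteq> {..<N} \<and> card A = m}"

lemma finite_constituents [simp]: "finite (constituents N m)"
  unfolding constituents_def by (rule finite_subset[of _ "Pow {..<N}"]) auto

context finite_power
begin

primrec noise :: "(nat \<Rightarrow> real) \<Rightarrow> nat \<Rightarrow> ((nat \<Rightarrow> 'c) \<Rightarrow> 'v::real_vector) \<Rightarrow> (nat \<Rightarrow> 'c) \<Rightarrow> 'v" where
  "noise r 0 G = G"
| "noise r (Suc k) G = noise r k (\<lambda>x. r k *\<^sub>R G x + (1 - r k) *\<^sub>R avg k G x)"

definition centered :: "nat set \<Rightarrow> ((nat \<Rightarrow> 'c) \<Rightarrow> 'v::real_vector) \<Rightarrow> bool" where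
  "centered A G \<longleftrightarrow> determined A G \<and> (\<forall>i\<in>A. \<forall>x\<in>words. avg i G x = 0)"

text \<open>
  On a centred function of the coordinates in \<open>A\<close> the operator acts as multiplication by \<open>\<Prod>i\<in>A. r i\<close>,
  because averaging over a coordinate in \<open>A\<close> annihilates the function and averaging over another one
  leaves it unchanged. By self-adjointness this may be read off with the operator on the other side.
\<close>

lemma noise_adjoint:
  fixes H f :: "(nat \<Rightarrow> 'c) \<Rightarrow> 'v::real_inner"
  assumes "centered A f" "finite A" "k \<le> N"
  shows "mean (\<lambda>x. inner (noise r k H x) (f x)) = (\<Prod>i\<in>A \<inter> {..<k}. r i) * mean (\<lambda>x. inner (H x) (f x))"
  using assms(3)
proof (induction k arbitrary: H)
  case (Suc k)
  then have k: "k < N" by simp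
  have "mean (\<lambda>x. inner (avg k H x) (f x)) = (if k \<in> A then 0 else mean (\<lambda>x. inner (H x) (f x)))"
  proof (cases "k \<in> A")
    case True
    have "mean (\<lambda>x. inner (avg k H x) (f x)) = mean (\<lambda>x. inner (avg k H x) (avg k f x))"
      by (rule mean_inner_avg_avg[OF k])
    also have "\<dots> = mean (\<lambda>x. 0)"
      using assms(1) True by (intro mean_cong) (auto simp: centered_def)
    finally show ?thesis using True by (simp add: mean_const)
  next
    case False
    then show ?thesis
      using mean_inner_determined[of A f k H] assms(1) k by (simp add: centered_def inner_commute)
  qed
  then have "mean (\<lambda>x. inner (r k *\<^sub>R H x + (1 - r k) *\<^sub>R avg k H x) (f x)) =
      (if k \<in> A then r k else 1) * mean (\<lambda>x. inner (H x) (f x))"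
    by (simp only: inner_add_left inner_scaleR_left mean_add mean_mult) (simp add: algebra_simps)
  moreover have "(\<Prod>i\<in>A \<inter> {..<Suc k}. r i) = (\<Prod>i\<in>A \<inter> {..<k}. r i) * (if k \<in> A then r k else 1)"
    using assms(2) by (auto simp: lessThan_Suc)
  ultimately show ?case
    using Suc by simp
qed simp

text \<open>
  Noise averages over points, and balls are convex.
\<close>

lemma l2_part_noise:
  assumes "k \<le> N" "\<And>i. 0 \<le> r i \<and> r i \<le> 1"
    and "\<And>x. x \<in> words \<Longrightarrow> l2_part I (\<lambda>n. H n x) \<le> B" "x \<in> words"
  shows "l2_part I (\<lambda>n. noise r k (H n) x) \<le> B"
  using assms(1,3,4)
proof (induction k arbitrary: H x)
  case (Suc k)
  have "l2_part I (\<lambda>n. r k *\<^sub>R H n y + (1 - r k) *\<^sub>R avg k (H n) y) \<le> B" if y: "y \<in> words" for y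
  proof -
    have "avg k (\<lambda>y. l2_part I (\<lambda>n. H n y)) y \<le> (\<Sum>c\<in>\<Gamma>. \<pi> c *\<^sub>R B)"
      unfolding avg_def using Suc.prems(1) y
      by (intro sum_mono scaleR_left_mono pi_nonneg Suc.prems(2) upd_words) auto
    also have "\<dots> = B" by (simp add: pi_sum flip: sum_distrib_right)
    finally have "l2_part I (\<lambda>n. avg k (H n) y) \<le> B"
      using l2_part_avg[of k y I H] Suc.prems(1) y by simp
    moreover have "l2_part I (\<lambda>n. r k *\<^sub>R H n y + (1 - r k) *\<^sub>R avg k (H n) y) \<le>
        r k * l2_part I (\<lambda>n. H n y) + (1 - r k) * l2_part I (\<lambda>n. avg k (H n) y)"
      using l2_part_add[of I "\<lambda>n. r k *\<^sub>R H n y" "\<lambda>n. (1 - r k) *\<^sub>R avg k (H n) y"] assms(2)[of k]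
      by (simp add: l2_part_scale)
    ultimately show ?thesis
      using assms(2)[of k] Suc.prems(2)[OF y]
        convex_bound_le[of "l2_part I (\<lambda>n. H n y)" B "l2_part I (\<lambda>n. avg k (H n) y)" "r k" "1 - r k"]
      by simp
  qed
  then show ?case
    using Suc by simp
qed auto

text \<open>
  A bounded weight \<open>\<theta>\<close> that is tested against square functions of \<open>f\<close> is replaced by a function \<open>G\<close>, bounded
  in the same norms up to a constant, that is tested against \<open>f\<close> itself. For each pattern \<open>J\<close> of signs
  \<open>H J n\<close> is \<open>\<theta> n\<close> times the direction of the signed sum of the \<open>f n A\<close>; \<open>G\<close> is the average over \<open>J\<close> of
  those combinations of noise operators that turn \<open>f\<close> into its signed sum.
\<close>

lemma dual_lift:
  fixes f :: "nat \<Rightarrow> nat set \<Rightarrow> (nat \<Rightarrow> 'c) \<Rightarrow> 'v::real_inner"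
  assumes f: "\<And>n A. A \<in> constituents N m \<Longrightarrow> centered A (f n A)"
    and \<theta>: "\<And>n x. 0 \<le> \<theta> n x"
  obtains G where
    "\<And>I B x. (\<And>x. x \<in> words \<Longrightarrow> l2_part I (\<lambda>n. \<theta> n x :: real) \<le> B) \<Longrightarrow> x \<in> words \<Longrightarrow>
      l2_part I (\<lambda>n. G n x) \<le> lift_const m * B"
    "\<And>n. mean (\<lambda>x. \<theta> n x * sqrt (\<Sum>A\<in>constituents N m. (norm (f n A x))\<^sup>2)) \<le>
      mean (\<lambda>x. inner (G n x) (\<Sum>A\<in>constituents N m. f n A x))"
proof -
  let ?\<A> = "constituents N m" and ?q = "extraction_poly m"
  define b where "b n x A = (if A \<in> ?\<A> then f n A x else 0)" for n x A
  define H where "H J n x = \<theta> n x *\<^sub>R sgn (chaos {..<N} (b n x) J)" for J n x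
  define r where "r j J i = (1 + (if i \<in> J then -1 else 1) / 2 ^ j) / (2::real)" for j :: nat and J :: "nat set" and i :: nat
  define \<kappa> where "\<kappa> j = 3 ^ m * 2 ^ m * coeff ?q j / poly ?q (1 / 2 ^ m)" for j
  define G where "G n x = (\<Sum>J\<in>Pow {..<N}. \<Sum>j\<le>m. (\<kappa> j / 2 ^ N) *\<^sub>R noise (r j J) N (H J n) x)" for n x
  have r01: "0 \<le> r j J i \<and> r j J i \<le> 1" for j J i
  proof -
    define e where "e = 1 / (2::real) ^ j"
    have "0 \<le> e" "e \<le> 1" by (auto simp: e_def)
    moreover have "r j J i = (1 + (if i \<in> J then - e else e)) / 2" by (simp add: r_def e_def)
    ultimately show ?thesis by (cases "i \<in> J") auto
  qed
  have \<A>: "finite A" "card A = m" "A \<subseteq> {..<N}" if "A \<in> ?\<A>" for A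
    using that finite_subset by (auto simp: constituents_def)
  have chaos_eq: "chaos {..<N} (b n x) J = (\<Sum>A\<in>?\<A>. sign_of J A *\<^sub>R f n A x)" for n x J
    unfolding chaos_def
    by (rule sum.mono_neutral_cong_right) (auto simp: b_def constituents_def)
  have sq_eq: "(\<Sum>A\<in>Pow {..<N}. (norm (b n x A))\<^sup>2) = (\<Sum>A\<in>?\<A>. (norm (f n A x))\<^sup>2)" for n x
    by (rule sum.mono_neutral_cong_right) (auto simp: b_def constituents_def)
  show thesis
  proof (rule that[of G])
    fix I B x
    assume B: "\<And>x. x \<in> words \<Longrightarrow> l2_part I (\<lambda>n. \<theta> n x) \<le> B" and x: "x \<in> words"
    have HB: "l2_part I (\<lambda>n. H J n y) \<le> B" if "y \<in> words" for J y
    proof -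
      have "l2_part I (\<lambda>n. H J n y) \<le> l2_part I (\<lambda>n. \<theta> n y)"
        unfolding l2_part_L2_set H_def using \<theta> by (intro L2_set_mono) (auto simp: norm_sgn)
      with B[OF that] show ?thesis by simp
    qed
    have "l2_part I (\<lambda>n. G n x) \<le> (\<Sum>J\<in>Pow {..<N}. \<Sum>j\<le>m. l2_part I (\<lambda>n. (\<kappa> j / 2 ^ N) *\<^sub>R noise (r j J) N (H J n) x))"
      unfolding G_def by (intro order_trans[OF l2_part_sum] sum_mono l2_part_sum)
    also have "\<dots> \<le> (\<Sum>J\<in>Pow {..<N}. \<Sum>j\<le>m. \<bar>\<kappa> j / 2 ^ N\<bar> * B)"
      unfolding l2_part_scale using r01 HB x
      by (intro sum_mono mult_left_mono l2_part_noise) auto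
    also have "\<dots> = lift_const m * B"
      by (simp add: card_Pow lift_const_def \<kappa>_def sum_distrib_right sum_distrib_left abs_mult abs_divide)
    finally show "l2_part I (\<lambda>n. G n x) \<le> lift_const m * B" .
  next
    fix n
    have adj: "mean (\<lambda>x. inner (noise (r j J) N (H J n) x) (f n A x)) =
        (\<Prod>i\<in>A. r j J i) * mean (\<lambda>x. inner (H J n x) (f n A x))" if "A \<in> ?\<A>" for j J A
    proof -
      have "A \<inter> {..<N} = A" using \<A>[OF that] by auto
      then show ?thesis
        using noise_adjoint[OF f[OF that] \<A>(1)[OF that], of N "r j J" "H J n" n] by simp
    qed
    have coef: "(\<Sum>j\<le>m. \<kappa> j * (\<Prod>i\<in>A. r j J i)) = 3 ^ m * sign_of J A" if "A \<in> ?\<A>" for J A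
    proof -
      have "(\<Prod>i\<in>A. r j J i) = (\<Prod>i\<in>A. 1 + (if i \<in> J then -1 else 1) / 2 ^ j) / 2 ^ m" for j
        unfolding r_def using \<A>[OF that] by (simp add: prod_dividef)
      then have "(\<Sum>j\<le>m. \<kappa> j * (\<Prod>i\<in>A. r j J i)) =
          3 ^ m / poly ?q (1 / 2 ^ m) * (\<Sum>j\<le>m. coeff ?q j * (\<Prod>i\<in>A. 1 + (if i \<in> J then -1 else 1) / 2 ^ j))"
        by (simp add: \<kappa>_def sum_distrib_left mult_ac)
      also have "\<dots> = 3 ^ m / poly ?q (1 / 2 ^ m) * (poly ?q (1 / 2 ^ m) * sign_of J A)"
        unfolding sign_of_def using \<A>[OF that] by (subst extract_product) auto
      also have "\<dots> = 3 ^ m * sign_of J A"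
        using extraction_poly_nonzero[of m] by simp
      finally show ?thesis .
    qed
    have "mean (\<lambda>x. inner (G n x) (\<Sum>A\<in>?\<A>. f n A x)) =
        (\<Sum>J\<in>Pow {..<N}. \<Sum>A\<in>?\<A>. \<Sum>j\<le>m. \<kappa> j / 2 ^ N * mean (\<lambda>x. inner (noise (r j J) N (H J n) x) (f n A x)))"
    proof -
      have "inner (G n x) (\<Sum>A\<in>?\<A>. f n A x) =
          (\<Sum>J\<in>Pow {..<N}. \<Sum>A\<in>?\<A>. \<Sum>j\<le>m. \<kappa> j / 2 ^ N * inner (noise (r j J) N (H J n) x) (f n A x))" for x
      proof -
        have "inner (G n x) (\<Sum>A\<in>?\<A>. f n A x) =
          (\<Sum>A\<in>?\<A>. \<Sum>J\<in>Pow {..<N}. \<Sum>j\<le>m. \<kappa> j / 2 ^ N * inner (noise (r j J) N (H J n) x) (f n A x))"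
          unfolding G_def inner_sum_left inner_scaleR_left inner_sum_right sum_distrib_left ..
        also have "\<dots> = (\<Sum>J\<in>Pow {..<N}. \<Sum>A\<in>?\<A>. \<Sum>j\<le>m. \<kappa> j / 2 ^ N * inner (noise (r j J) N (H J n) x) (f n A x))"
          by (rule sum.swap)
        finally show ?thesis .
      qed
      then show ?thesis by (simp only: mean_sum mean_mult)
    qed
    also have "\<dots> = (\<Sum>J\<in>Pow {..<N}. \<Sum>A\<in>?\<A>. 3 ^ m * sign_of J A / 2 ^ N * mean (\<lambda>x. inner (H J n x) (f n A x)))"
    proof (intro sum.cong refl)
      fix J A assume A: "A \<in> ?\<A>"
      have "(\<Sum>j\<le>m. \<kappa> j / 2 ^ N * mean (\<lambda>x. inner (noise (r j J) N (H J n) x) (f n A x))) =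
          (\<Sum>j\<le>m. \<kappa> j * (\<Prod>i\<in>A. r j J i)) / 2 ^ N * mean (\<lambda>x. inner (H J n x) (f n A x))"
        by (simp add: adj[OF A] sum_distrib_right sum_divide_distrib mult.assoc)
      also have "\<dots> = 3 ^ m * sign_of J A / 2 ^ N * mean (\<lambda>x. inner (H J n x) (f n A x))"
        by (simp only: coef[OF A])
      finally show "(\<Sum>j\<le>m. \<kappa> j / 2 ^ N * mean (\<lambda>x. inner (noise (r j J) N (H J n) x) (f n A x))) =
          3 ^ m * sign_of J A / 2 ^ N * mean (\<lambda>x. inner (H J n x) (f n A x))" .
    qed
    also have "\<dots> = (\<Sum>J\<in>Pow {..<N}. mean (\<lambda>x. 3 ^ m / 2 ^ N * (\<theta> n x * norm (chaos {..<N} (b n x) J))))"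
    proof (intro sum.cong refl)
      fix J
      have "(\<Sum>A\<in>?\<A>. 3 ^ m * sign_of J A / 2 ^ N * mean (\<lambda>x. inner (H J n x) (f n A x))) =
          mean (\<lambda>x. 3 ^ m / 2 ^ N * inner (H J n x) (chaos {..<N} (b n x) J))"
        unfolding chaos_eq inner_sum_right inner_scaleR_right sum_distrib_left mean_sum mean_mult[symmetric]
        by (simp add: mult.assoc)
      moreover have "inner (H J n x) (chaos {..<N} (b n x) J) = \<theta> n x * norm (chaos {..<N} (b n x) J)" for x
        by (cases "chaos {..<N} (b n x) J = 0")
          (simp_all add: H_def sgn_div_norm dot_square_norm power2_eq_square)
      ultimately show "(\<Sum>A\<in>?\<A>. 3 ^ m * sign_of J A / 2 ^ N * mean (\<lambda>x. inner (H J n x) (f n A x))) =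
          mean (\<lambda>x. 3 ^ m / 2 ^ N * (\<theta> n x * norm (chaos {..<N} (b n x) J)))"
        by simp
    qed
    also have "\<dots> = mean (\<lambda>x. \<theta> n x * (3 ^ m / 2 ^ N * (\<Sum>J\<in>Pow {..<N}. norm (chaos {..<N} (b n x) J))))"
      unfolding mean_sum[symmetric] sum_distrib_left by (simp add: mult_ac)
    finally have eq: "mean (\<lambda>x. inner (G n x) (\<Sum>A\<in>?\<A>. f n A x)) =
        mean (\<lambda>x. \<theta> n x * (3 ^ m / 2 ^ N * (\<Sum>J\<in>Pow {..<N}. norm (chaos {..<N} (b n x) J))))" .
    show "mean (\<lambda>x. \<theta> n x * sqrt (\<Sum>A\<in>?\<A>. (norm (f n A x))\<^sup>2)) \<le> mean (\<lambda>x. inner (G n x) (\<Sum>A\<in>?\<A>. f n A x))"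
      unfolding eq
    proof (intro mean_mono mult_left_mono \<theta>)
      fix x
      have "b n x A = 0" if "m < card A" for A
        using that \<A>[of A] by (auto simp: b_def)
      then show "sqrt (\<Sum>A\<in>?\<A>. (norm (f n A x))\<^sup>2) \<le> 3 ^ m / 2 ^ N * (\<Sum>J\<in>Pow {..<N}. norm (chaos {..<N} (b n x) J))"
        using chaos_khinchine[of "{..<N}" m "b n x"] by (simp add: sq_eq)
    qed
  qed
qed

lemma centered_proj:
  assumes "finite A" "A \<subseteq> {..<N}" "determined A G"
  shows "centered A (proj A G)"
  unfolding centered_def using assms by (auto intro: determined_proj avg_proj)

lemma centered_sum:
  "(\<And>k. k \<in> K \<Longrightarrow> centered A (F k)) \<Longrightarrow> centered A (\<lambda>x. \<Sum>k\<in>K. F k x)"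
  unfolding centered_def by (auto simp: avg_sum intro: determined_sum)

text \<open>
  The core of the proof. Class \<open>k < d\<close> consists of the weights of the single component \<open>k\<close>, class \<open>d\<close> of
  the weights shared by all components; they produce \<open>g0\<close> and \<open>g1\<close> respectively.
\<close>

lemma finite_decomposition:
  fixes f :: "nat \<Rightarrow> nat set \<Rightarrow> (nat \<Rightarrow> 'c) \<Rightarrow> 'v::real_inner"
  assumes f: "\<And>n A. A \<in> constituents N m \<Longrightarrow> centered A (f n A)"
    and "0 < t" "0 < \<eta>"
  obtains g0 g1 G where
    "\<And>n A. A \<in> constituents N m \<Longrightarrow> centered A (g0 n A)"
    "\<And>n A. A \<in> constituents N m \<Longrightarrow> centered A (g1 n A)"
    "\<And>n A x. n < d \<Longrightarrow> A \<in> constituents N m \<Longrightarrow> x \<in> words \<Longrightarrow> f n A x = g0 n A x + g1 n A x"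
    "\<And>n x. n < d \<Longrightarrow> x \<in> words \<Longrightarrow> norm (G n x) \<le> lift_const m * sqrt (2 ^ (m + 3))"
    "\<And>x. x \<in> words \<Longrightarrow> l2_part {..<d} (\<lambda>n. G n x) \<le> lift_const m * sqrt (2 ^ (m + 3)) * t"
    "mean (\<lambda>x. \<Sum>n<d. norm (\<Sum>A\<in>constituents N m. g0 n A x)) +
       t * mean (\<lambda>x. l2_part {..<d} (\<lambda>n. \<Sum>A\<in>constituents N m. g1 n A x)) \<le>
     2 ^ (m + 3) * mean (\<lambda>x. \<Sum>n<d. inner (G n x) (\<Sum>A\<in>constituents N m. f n A x)) + \<eta>"
proof -
  let ?\<A> = "constituents N m"
  define \<B> where "\<B> = {b. b \<subseteq> {..<N} \<and> card b \<le> m}"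
  define I where "I k = (if k < d then {k} else {..<d})" for k
  define \<tau> where "\<tau> k = (if k < d then 1 else t)" for k
  define \<epsilon> where "\<epsilon> = \<eta> / (2 ^ (m + 1) * (real d + 1))"
  have "0 < \<epsilon>" using \<open>0 < \<eta>\<close> by (simp add: \<epsilon>_def)
  have finB: "finite \<B>"
    unfolding \<B>_def by (rule finite_subset[of _ "Pow {..<N}"]) auto
  have \<A>: "finite A" "card A = m" "A \<subseteq> {..<N}" if "A \<in> ?\<A>" for A
    using that finite_subset by (auto simp: constituents_def)
  have sub\<B>: "b \<in> \<B>" if "A \<in> ?\<A>" "b \<subseteq> A" for A b
    using that \<A>[OF that(1)] card_mono[of A b] by (auto simp: \<B>_def)
  have I1: "I k \<subseteq> {..<d}" and \<tau>1: "0 < \<tau> k" if "k \<in> {..d}" for k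
    using \<open>0 < t\<close> by (auto simp: I_def \<tau>_def)
  have s1: "0 \<le> (norm (f n A x))\<^sup>2" for n A x by simp
  obtain w where w0: "\<And>k b x. 0 \<le> w k b x" and wdet: "\<And>k b. determined b (w k b)"
    and pack: "\<And>k b u. k \<in> {..d} \<Longrightarrow> b \<in> \<B> \<Longrightarrow> determined b u \<Longrightarrow> (\<And>x. x \<in> words \<Longrightarrow> 0 \<le> u x) \<Longrightarrow>
      mean (\<lambda>x. u x * (\<Sum>n\<in>I k. \<Sum>A | A \<in> ?\<A> \<and> b \<subseteq> A.
        (norm (f n A x))\<^sup>2 / (\<epsilon> + (\<Sum>k | k \<in> {..d} \<and> n \<in> I k. \<Sum>b | b \<in> \<B> \<and> b \<subseteq> A. w k b x))\<^sup>2))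
      \<le> 2 * (\<tau> k)\<^sup>2 * mean u"
    and cost: "(\<Sum>k\<in>{..d}. \<Sum>b\<in>\<B>. (\<tau> k)\<^sup>2 * mean (w k b)) \<le> 2 * (\<Sum>n<d. \<Sum>A\<in>?\<A>. mean (\<lambda>x.
        (norm (f n A x))\<^sup>2 / (\<epsilon> + (\<Sum>k | k \<in> {..d} \<and> n \<in> I k. \<Sum>b | b \<in> \<B> \<and> b \<subseteq> A. w k b x))))"
  proof (rule packing_weights[of ?\<A> \<B> "{..d}" I d \<tau> "\<lambda>n A x. (norm (f n A x))\<^sup>2" \<epsilon>, OF finite_constituents finB finite_atMost I1 \<tau>1 s1 \<open>0 < \<epsilon>\<close>], goal_cases)
    case (3 w)
    show ?case by (rule that) (fact 3)+
  qed simp_all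
  define V where "V n A x = \<epsilon> + (\<Sum>k | k \<in> {..d} \<and> n \<in> I k. \<Sum>b | b \<in> \<B> \<and> b \<subseteq> A. w k b x)" for n A x
  define \<phi> where "\<phi> n A x = (1 / V n A x) *\<^sub>R f n A x" for n A x
  define \<Lambda> where "\<Lambda> = (\<Sum>n<d. \<Sum>A\<in>?\<A>. mean (\<lambda>x. (norm (f n A x))\<^sup>2 / V n A x))"
  have Vpos: "0 < V n A x" for n A x
    unfolding V_def using \<open>0 < \<epsilon>\<close> w0 by (intro add_pos_nonneg sum_nonneg) auto
  have Vdet: "determined A (V n A)" for n A
    unfolding V_def
    by (rule determined_comp[where h = "\<lambda>y. \<epsilon> + y"], intro determined_sum)
      (auto intro: determined_mono[OF wdet])
  have \<phi>det: "determined A (\<phi> n A)" if "A \<in> ?\<A>" for n A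
    unfolding \<phi>_def using f[OF that]
    by (intro determined_comp2[OF Vdet, where h = "\<lambda>a b. (1 / a) *\<^sub>R b"]) (auto simp: centered_def)
  have \<phi>sq: "(norm (\<phi> n A x))\<^sup>2 = (norm (f n A x))\<^sup>2 / (V n A x)\<^sup>2" for n A x
    by (simp add: \<phi>_def power_divide)
  have pack': "mean (\<lambda>x. u x * (\<Sum>n\<in>I k. \<Sum>A | A \<in> ?\<A> \<and> b \<subseteq> A. (norm (\<phi> n A x))\<^sup>2)) \<le> 2 * (\<tau> k)\<^sup>2 * mean u"
    if "k \<le> d" "b \<in> \<B>" "determined b u" "\<And>x. x \<in> words \<Longrightarrow> 0 \<le> u x" for k b u
    using pack[of k b u] that by (simp add: \<phi>sq V_def)
  have cost': "(\<Sum>k\<le>d. \<Sum>b\<in>\<B>. (\<tau> k)\<^sup>2 * mean (w k b)) \<le> 2 * \<Lambda>"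
    using cost by (simp add: \<Lambda>_def V_def)

  \<comment> \<open>The shift \<open>\<epsilon>\<close> in the denominators is booked as a constant weight at \<open>b = {}\<close> in each class \<open>k < d\<close>, so
    that the weights of the subsets of \<open>A\<close> add up to \<open>V n A\<close> exactly.\<close>
  define w' where "w' k b x = w k b x + (if k < d \<and> b = {} then \<epsilon> else 0)" for k b x
  define g where "g k n A x = (\<Sum>b | b \<in> \<B> \<and> b \<subseteq> A. proj A (\<lambda>y. w' k b y *\<^sub>R \<phi> n A y) x)" for k n A x
  have w'det: "determined b (w' k b)" for k b
    unfolding w'_def by (rule determined_comp[OF wdet, where h = "\<lambda>y. y + _"])
  have g_centered: "centered A (g k n A)" if "A \<in> ?\<A>" for k n A
    unfolding g_def using \<A>[OF that] \<phi>det[OF that]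
    by (intro centered_sum centered_proj determined_comp2[where h = scaleR])
      (auto intro: determined_mono[OF w'det])
  have g_bound: "\<tau> k * mean (\<lambda>x. l2_part (I k) (\<lambda>n. \<Sum>A\<in>?\<A>. g k n A x)) \<le>
      2 ^ (m + 1) * (\<Sum>b\<in>\<B>. (\<tau> k)\<^sup>2 * mean (w' k b))" if "k \<le> d" for k
    unfolding g_def
  proof (rule class_bound)
    show "mean (\<lambda>x. u x * (\<Sum>n\<in>I k. \<Sum>A | A \<in> ?\<A> \<and> b \<subseteq> A. (norm (\<phi> n A x))\<^sup>2)) \<le> 2 * (\<tau> k)\<^sup>2 * mean u"
      if "b \<in> \<B>" "determined b u" "\<And>x. x \<in> words \<Longrightarrow> 0 \<le> u x" for b u
      by (rule pack'[OF \<open>k \<le> d\<close> that])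
    show "0 \<le> w' k b x" for b x
      using w0[of k b x] \<open>0 < \<epsilon>\<close> by (simp add: w'_def)
  qed (use finB \<A> \<phi>det w'det in \<open>auto simp: \<B>_def\<close>)
  have split: "f n A x = g n n A x + g d n A x" if "n < d" "A \<in> ?\<A>" "x \<in> words" for n A x
  proof -
    have A: "finite A" "A \<subseteq> {..<N}" using \<A>[OF that(2)] by auto
    have "{k. k \<in> {..d} \<and> n \<in> I k} = {n, d}"
      using that by (auto simp: I_def split: if_splits)
    moreover have "n \<noteq> d" using that by simp
    moreover have "(\<Sum>b | b \<in> \<B> \<and> b \<subseteq> A. w' n b y) = \<epsilon> + (\<Sum>b | b \<in> \<B> \<and> b \<subseteq> A. w n b y)" for y
    proof -
      have "{} \<in> {b. b \<in> \<B> \<and> b \<subseteq> A}" by (simp add: \<B>_def)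
      then show ?thesis
        using that finB unfolding w'_def sum.distrib by simp
    qed
    moreover have "(\<Sum>b | b \<in> \<B> \<and> b \<subseteq> A. w' d b y) = (\<Sum>b | b \<in> \<B> \<and> b \<subseteq> A. w d b y)" for y
      by (simp add: w'_def)
    ultimately have Veq: "V n A y = (\<Sum>b | b \<in> \<B> \<and> b \<subseteq> A. w' n b y) + (\<Sum>b | b \<in> \<B> \<and> b \<subseteq> A. w' d b y)" for y
      by (simp add: V_def)
    have "f n A y = V n A y *\<^sub>R \<phi> n A y" for y
      using Vpos[of n A y] by (simp add: \<phi>_def)
    then have "f n A y = (\<Sum>b | b \<in> \<B> \<and> b \<subseteq> A. w' n b y *\<^sub>R \<phi> n A y + w' d b y *\<^sub>R \<phi> n A y)" for y
      by (simp only: Veq sum.distrib scaleR_sum_left scaleR_add_left)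
    then have fe: "f n A = (\<lambda>y. \<Sum>b | b \<in> \<B> \<and> b \<subseteq> A. \<Sum>k\<in>{n, d}. w' k b y *\<^sub>R \<phi> n A y)"
      using \<open>n \<noteq> d\<close> by (intro ext) simp
    have "proj A (f n A) = (\<lambda>x. \<Sum>b | b \<in> \<B> \<and> b \<subseteq> A. \<Sum>k\<in>{n, d}. proj A (\<lambda>y. w' k b y *\<^sub>R \<phi> n A y) x)"
      by (subst fe) (simp only: proj_sum[OF A(1)])
    also have "\<dots> = (\<lambda>x. g n n A x + g d n A x)"
      using \<open>n \<noteq> d\<close> by (simp add: g_def sum.distrib)
    finally have "proj A (f n A) x = g n n A x + g d n A x" by simp
    moreover have "proj A (f n A) x = f n A x"
      using A f[OF that(2)] that(3) by (intro proj_fixed) (auto simp: centered_def)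
    ultimately show ?thesis by simp
  qed
  have upper: "mean (\<lambda>x. \<Sum>n<d. norm (\<Sum>A\<in>?\<A>. g n n A x)) + t * mean (\<lambda>x. l2_part {..<d} (\<lambda>n. \<Sum>A\<in>?\<A>. g d n A x))
      \<le> 2 ^ (m + 2) * \<Lambda> + \<eta>"
  proof -
    have "mean (\<lambda>x. \<Sum>n<d. norm (\<Sum>A\<in>?\<A>. g n n A x)) + t * mean (\<lambda>x. l2_part {..<d} (\<lambda>n. \<Sum>A\<in>?\<A>. g d n A x)) =
        (\<Sum>k\<le>d. \<tau> k * mean (\<lambda>x. l2_part (I k) (\<lambda>n. \<Sum>A\<in>?\<A>. g k n A x)))"
      by (simp add: mean_sum lessThan_Suc_atMost[symmetric] \<tau>_def I_def)
    also have "\<dots> \<le> (\<Sum>k\<le>d. 2 ^ (m + 1) * (\<Sum>b\<in>\<B>. (\<tau> k)\<^sup>2 * mean (w' k b)))"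
      by (intro sum_mono g_bound) auto
    also have "\<dots> = 2 ^ (m + 1) * (\<Sum>k\<le>d. \<Sum>b\<in>\<B>. (\<tau> k)\<^sup>2 * mean (w' k b))"
      by (simp add: sum_distrib_left)
    also have "(\<Sum>k\<le>d. \<Sum>b\<in>\<B>. (\<tau> k)\<^sup>2 * mean (w' k b)) = (\<Sum>k\<le>d. \<Sum>b\<in>\<B>. (\<tau> k)\<^sup>2 * mean (w k b)) + real d * \<epsilon>"
    proof -
      have "(\<Sum>b\<in>\<B>. (\<tau> k)\<^sup>2 * mean (w' k b)) = (\<Sum>b\<in>\<B>. (\<tau> k)\<^sup>2 * mean (w k b)) + (if k < d then \<epsilon> else 0)" for k
      proof -
        have "{} \<in> \<B>" by (simp add: \<B>_def)
        have "(\<tau> k)\<^sup>2 * mean (w' k b) = (\<tau> k)\<^sup>2 * mean (w k b) + (if b = {} then (if k < d then \<epsilon> else 0) else 0)" for b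
        proof -
          have "w' k b = (\<lambda>x. w k b x + (if k < d \<and> b = {} then \<epsilon> else 0))"
            by (simp add: w'_def fun_eq_iff)
          then have "mean (w' k b) = mean (w k b) + (if k < d \<and> b = {} then \<epsilon> else 0)"
            by (simp only: mean_add mean_const)
          then show ?thesis by (simp add: \<tau>_def)
        qed
        then show ?thesis using finB \<open>{} \<in> \<B>\<close> by (simp add: sum.distrib)
      qed
      moreover have "(\<Sum>k\<le>d. if k < d then \<epsilon> else 0) = real d * \<epsilon>"
        by (simp add: lessThan_Suc_atMost[symmetric])
      ultimately show ?thesis by (simp add: sum.distrib)
    qed
    also have "2 ^ (m + 1) * ((\<Sum>k\<le>d. \<Sum>b\<in>\<B>. (\<tau> k)\<^sup>2 * mean (w k b)) + real d * \<epsilon>) \<le> 2 ^ (m + 1) * (2 * \<Lambda> + real d * \<epsilon>)"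
      using cost' by simp
    also have "\<dots> \<le> 2 ^ (m + 2) * \<Lambda> + \<eta>"
    proof -
      have "2 ^ (m + 1) * (real d * \<epsilon>) = \<eta> * (real d / (real d + 1))"
        by (simp add: \<epsilon>_def)
      also have "\<dots> \<le> \<eta> * 1" using \<open>0 < \<eta>\<close> by (intro mult_left_mono) auto
      finally show ?thesis by (simp add: algebra_simps)
    qed
    finally show ?thesis .
  qed

  define Q where "Q n x = (\<Sum>A\<in>?\<A>. (norm (\<phi> n A x))\<^sup>2)" for n x
  \<comment> \<open>The means of \<open>Q n\<close> and of \<open>\<Sum>n<d. Q n\<close> given \<open>x\<^sub>A\<close> are at most \<open>2\<^sup>m\<^sup>+\<^sup>1\<close> and \<open>2\<^sup>m\<^sup>+\<^sup>1 t\<^sup>2\<close>; at this level each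
    of the two exceptional events has conditional probability at most \<open>1/4\<close>.\<close>
  define C where "C = (2::real) ^ (m + 3)"
  define \<iota> where "\<iota> n x = (if Q n x \<le> C \<and> (\<Sum>n<d. Q n x) \<le> C * t\<^sup>2 then 1 else (0::real))" for n x
  define \<theta> where "\<theta> n x = \<iota> n x * sqrt (Q n x)" for n x
  have "0 < C" by (simp add: C_def)
  have Q0: "0 \<le> Q n x" for n x by (simp add: Q_def sum_nonneg)
  have keep: "mean u \<le> 2 * mean (\<lambda>x. u x * \<iota> n x)"
    if A: "A \<in> ?\<A>" and u: "determined A u" "\<And>x. x \<in> words \<Longrightarrow> 0 \<le> u x" and n: "n < d" for A u n
  proof -
    have 1: "mean (\<lambda>x. u x * Q n x) \<le> 2 ^ m * 2 * mean u"
      unfolding Q_def \<A>(2)[OF A, symmetric]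
    proof (rule mean_packed_sum[OF _ _ _ _ u])
      fix b and v :: "(nat \<Rightarrow> 'c) \<Rightarrow> real"
      assume b: "b \<subseteq> A" and v: "determined b v" "\<And>x. x \<in> words \<Longrightarrow> 0 \<le> v x"
      show "mean (\<lambda>x. v x * (\<Sum>B | B \<in> constituents N (card A) \<and> b \<subseteq> B. (norm (\<phi> n B x))\<^sup>2)) \<le> 2 * mean v"
        using pack'[of n b v, OF _ sub\<B>[OF A b] v] n \<A>(2)[OF A] by (simp add: I_def \<tau>_def)
    qed (use \<A> A \<phi>det in \<open>auto intro!: determined_comp[where h = "\<lambda>y. (norm y)\<^sup>2"]\<close>)
    have Qsum: "(\<Sum>n<d. Q n x) = (\<Sum>A\<in>?\<A>. \<Sum>n<d. (norm (\<phi> n A x))\<^sup>2)" for x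
      unfolding Q_def by (rule sum.swap)
    have 2: "mean (\<lambda>x. u x * (\<Sum>n<d. Q n x)) \<le> 2 ^ m * (2 * t\<^sup>2) * mean u"
      unfolding Qsum \<A>(2)[OF A, symmetric]
    proof (rule mean_packed_sum[OF _ _ _ _ u])
      fix b and v :: "(nat \<Rightarrow> 'c) \<Rightarrow> real"
      assume b: "b \<subseteq> A" and v: "determined b v" "\<And>x. x \<in> words \<Longrightarrow> 0 \<le> v x"
      have "(\<Sum>B | B \<in> ?\<A> \<and> b \<subseteq> B. \<Sum>n<d. (norm (\<phi> n B x))\<^sup>2) =
          (\<Sum>n<d. \<Sum>B | B \<in> ?\<A> \<and> b \<subseteq> B. (norm (\<phi> n B x))\<^sup>2)" for x
        by (rule sum.swap)
      then show "mean (\<lambda>x. v x * (\<Sum>B | B \<in> constituents N (card A) \<and> b \<subseteq> B. \<Sum>n<d. (norm (\<phi> n B x))\<^sup>2)) \<le> 2 * t\<^sup>2 * mean v"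
        using pack'[of d b v, OF _ sub\<B>[OF A b] v] \<A>(2)[OF A] by (simp add: I_def \<tau>_def)
    qed (use \<A> A \<phi>det in \<open>auto intro!: determined_sum sum_nonneg determined_comp[where h = "\<lambda>y. (norm y)\<^sup>2"]\<close>)
    have "mean (\<lambda>x. u x * (1 - \<iota> n x)) \<le> mean (\<lambda>x. (1 / C) * (u x * Q n x) + (1 / (C * t\<^sup>2)) * (u x * (\<Sum>n<d. Q n x)))"
    proof (rule mean_mono)
      fix x assume x: "x \<in> words"
      have "1 - \<iota> n x \<le> Q n x / C + (\<Sum>n<d. Q n x) / (C * t\<^sup>2)"
      proof -
        have "0 \<le> Q n x / C" "0 \<le> (\<Sum>n<d. Q n x) / (C * t\<^sup>2)"
          using Q0 \<open>0 < C\<close> by (auto intro!: divide_nonneg_nonneg sum_nonneg)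
        moreover have "1 \<le> Q n x / C" if "\<not> Q n x \<le> C"
          using that \<open>0 < C\<close> by simp
        moreover have "1 \<le> (\<Sum>n<d. Q n x) / (C * t\<^sup>2)" if "\<not> (\<Sum>n<d. Q n x) \<le> C * t\<^sup>2"
          using that \<open>0 < C\<close> \<open>0 < t\<close> by simp
        ultimately show ?thesis by (auto simp: \<iota>_def)
      qed
      from mult_left_mono[OF this u(2)[OF x]]
      show "u x * (1 - \<iota> n x) \<le> (1 / C) * (u x * Q n x) + (1 / (C * t\<^sup>2)) * (u x * (\<Sum>n<d. Q n x))"
        by (simp add: algebra_simps)
    qed
    also have "\<dots> = (1 / C) * mean (\<lambda>x. u x * Q n x) + (1 / (C * t\<^sup>2)) * mean (\<lambda>x. u x * (\<Sum>n<d. Q n x))"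
      by (simp only: mean_add mean_mult)
    also have "\<dots> \<le> (1 / C) * (2 ^ m * 2 * mean u) + (1 / (C * t\<^sup>2)) * (2 ^ m * (2 * t\<^sup>2) * mean u)"
      using 1 2 \<open>0 < C\<close> by (intro add_mono mult_left_mono) auto
    also have "\<dots> = mean u / 2"
      using \<open>0 < t\<close> by (simp add: C_def power_add field_simps)
    finally have "mean (\<lambda>x. u x * (1 - \<iota> n x)) \<le> mean u / 2" .
    moreover have "mean (\<lambda>x. u x * (1 - \<iota> n x)) = mean u - mean (\<lambda>x. u x * \<iota> n x)"
      by (simp add: right_diff_distrib mean_diff)
    ultimately show ?thesis by simp
  qed
  have "\<Lambda> \<le> 2 * (\<Sum>n<d. mean (\<lambda>x. \<theta> n x * sqrt (\<Sum>A\<in>?\<A>. (norm (f n A x))\<^sup>2)))"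
  proof -
    have "\<Lambda> \<le> (\<Sum>n<d. \<Sum>A\<in>?\<A>. 2 * mean (\<lambda>x. (norm (f n A x))\<^sup>2 / V n A x * \<iota> n x))"
      unfolding \<Lambda>_def
    proof (intro sum_mono keep)
      fix n A assume A: "A \<in> ?\<A>"
      show "determined A (\<lambda>x. (norm (f n A x))\<^sup>2 / V n A x)"
        using f[OF A] by (intro determined_comp2[OF Vdet, where h = "\<lambda>a b. (norm b)\<^sup>2 / a"]) (auto simp: centered_def)
      show "0 \<le> (norm (f n A x))\<^sup>2 / V n A x" for x
        using Vpos[of n A x] by simp
    qed auto
    also have "\<dots> = 2 * (\<Sum>n<d. mean (\<lambda>x. \<iota> n x * (\<Sum>A\<in>?\<A>. norm (\<phi> n A x) * norm (f n A x))))"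
    proof -
      have "(norm (f n A x))\<^sup>2 / V n A x * \<iota> n x = \<iota> n x * (norm (\<phi> n A x) * norm (f n A x))" for n A x
        using Vpos[of n A x] by (simp add: \<phi>_def power2_eq_square)
      then show ?thesis
        by (simp add: sum_distrib_left mean_sum)
    qed
    also have "\<dots> \<le> 2 * (\<Sum>n<d. mean (\<lambda>x. \<theta> n x * sqrt (\<Sum>A\<in>?\<A>. (norm (f n A x))\<^sup>2)))"
    proof (intro mult_left_mono sum_mono mean_mono)
      fix n x
      have "(\<Sum>A\<in>?\<A>. norm (\<phi> n A x) * norm (f n A x)) \<le> sqrt (Q n x) * sqrt (\<Sum>A\<in>?\<A>. (norm (f n A x))\<^sup>2)"
        using L2_set_mult_ineq[of "\<lambda>A. norm (\<phi> n A x)" "\<lambda>A. norm (f n A x)" ?\<A>]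
        by (simp add: L2_set_def Q_def)
      then show "\<iota> n x * (\<Sum>A\<in>?\<A>. norm (\<phi> n A x) * norm (f n A x)) \<le> \<theta> n x * sqrt (\<Sum>A\<in>?\<A>. (norm (f n A x))\<^sup>2)"
        by (simp add: \<theta>_def \<iota>_def)
    qed auto
    finally show ?thesis .
  qed
  moreover obtain G where
    G: "\<And>I B x. (\<And>x. x \<in> words \<Longrightarrow> l2_part I (\<lambda>n. \<theta> n x) \<le> B) \<Longrightarrow> x \<in> words \<Longrightarrow>
      l2_part I (\<lambda>n. G n x) \<le> lift_const m * B"
    and Gf: "\<And>n. mean (\<lambda>x. \<theta> n x * sqrt (\<Sum>A\<in>?\<A>. (norm (f n A x))\<^sup>2)) \<le>
      mean (\<lambda>x. inner (G n x) (\<Sum>A\<in>?\<A>. f n A x))"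
    by (rule dual_lift[of m f \<theta>]) (use f Q0 in \<open>auto simp: \<theta>_def \<iota>_def\<close>)
  ultimately have \<Lambda>G: "\<Lambda> \<le> 2 * mean (\<lambda>x. \<Sum>n<d. inner (G n x) (\<Sum>A\<in>?\<A>. f n A x))"
  proof -
    assume "\<Lambda> \<le> 2 * (\<Sum>n<d. mean (\<lambda>x. \<theta> n x * sqrt (\<Sum>A\<in>?\<A>. (norm (f n A x))\<^sup>2)))"
    also have "\<dots> \<le> 2 * (\<Sum>n<d. mean (\<lambda>x. inner (G n x) (\<Sum>A\<in>?\<A>. f n A x)))"
      by (intro mult_left_mono sum_mono Gf) auto
    finally show ?thesis by (simp only: mean_sum)
  qed
  have \<theta>1: "l2_part {n} (\<lambda>n. \<theta> n x) \<le> sqrt C" for n x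
    using Q0[of n x] \<open>0 < C\<close> by (simp add: \<theta>_def \<iota>_def)
  have \<theta>2: "l2_part {..<d} (\<lambda>n. \<theta> n x) \<le> sqrt C * t" for x
  proof -
    have "(\<Sum>n<d. (norm (\<theta> n x))\<^sup>2) \<le> C * t\<^sup>2"
    proof (cases "(\<Sum>n<d. Q n x) \<le> C * t\<^sup>2")
      case True
      have "(\<Sum>n<d. (norm (\<theta> n x))\<^sup>2) \<le> (\<Sum>n<d. Q n x)"
        using Q0 by (intro sum_mono) (simp add: \<theta>_def \<iota>_def)
      with True show ?thesis by simp
    next
      case False
      then show ?thesis using \<open>0 < C\<close> by (simp add: \<theta>_def \<iota>_def)
    qed
    then have "l2_part {..<d} (\<lambda>n. \<theta> n x) \<le> sqrt (C * t\<^sup>2)" by (simp add: l2_part_def)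
    then show ?thesis using \<open>0 < t\<close> by (simp add: real_sqrt_mult)
  qed
  show thesis
  proof (rule that[of "\<lambda>n. g n n" "g d" G])
    show "mean (\<lambda>x. \<Sum>n<d. norm (\<Sum>A\<in>?\<A>. g n n A x)) + t * mean (\<lambda>x. l2_part {..<d} (\<lambda>n. \<Sum>A\<in>?\<A>. g d n A x))
      \<le> 2 ^ (m + 3) * mean (\<lambda>x. \<Sum>n<d. inner (G n x) (\<Sum>A\<in>?\<A>. f n A x)) + \<eta>"
    proof -
      have "2 ^ (m + 2) * \<Lambda> \<le> 2 ^ (m + 2) * (2 * mean (\<lambda>x. \<Sum>n<d. inner (G n x) (\<Sum>A\<in>?\<A>. f n A x)))"
        by (intro mult_left_mono \<Lambda>G) auto
      also have "\<dots> = 2 ^ (m + 3) * mean (\<lambda>x. \<Sum>n<d. inner (G n x) (\<Sum>A\<in>?\<A>. f n A x))"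
        by (simp add: power_add)
      finally show ?thesis using upper by linarith
    qed
    show "norm (G n x) \<le> lift_const m * sqrt (2 ^ (m + 3))" if "x \<in> words" for n x
      using G[of "{n}" "sqrt C" x] \<theta>1 that by (simp add: C_def)
    show "l2_part {..<d} (\<lambda>n. G n x) \<le> lift_const m * sqrt (2 ^ (m + 3)) * t" if "x \<in> words" for x
      using G[of "{..<d}" "sqrt C * t" x] \<theta>2 that by (simp add: C_def mult.assoc)
  qed (use g_centered split in auto)
qed

end

section \<open>Sequence norms and Bochner spaces\<close>

definition cutoff :: "nat \<Rightarrow> (nat \<Rightarrow> 'k::zero) \<Rightarrow> nat \<Rightarrow> 'k" where
  "cutoff d a = (\<lambda>n. if n < d then a n else 0)"

definition basis_seq :: "nat \<Rightarrow> nat \<Rightarrow> 'k::zero_neq_one" where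
  "basis_seq n = (\<lambda>i. if i = n then 1 else 0)"

lemma cutoff_Suc: "cutoff (Suc d) a = cutoff d a + scale_fun (a d) (basis_seq d)"
  by (auto simp: cutoff_def basis_seq_def scale_fun_def fun_eq_iff less_Suc_eq)

lemma sums_tail:
  fixes g :: "nat \<Rightarrow> real"
  assumes "summable g"
  shows "(\<lambda>n. if n < d then 0 else g n) sums (suminf g - (\<Sum>n<d. g n))"
proof -
  have "(\<lambda>n. if n < d then g n else 0) sums (\<Sum>n<d. g n)"
    using sums_If_finite_set[of "{..<d}" g] by simp
  from sums_diff[OF summable_sums[OF assms] this]
  show ?thesis by (rule sums_cong[THEN iffD1, rotated]) auto
qed

text \<open>
  The properties of \<open>\<ell>\<^sup>1\<close> and \<open>\<ell>\<^sup>2\<close> that the approximation arguments use. Measurability of the norm refers to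
  the product \<open>\<sigma>\<close>-algebra, so that it can be checked by components.
\<close>

locale seq_norm =
  fixes B :: "(nat \<Rightarrow> 'k::{real_normed_field, euclidean_space}) set" and N :: "(nat \<Rightarrow> 'k) \<Rightarrow> real"
  assumes nonneg: "0 \<le> N a"
    and cutoff_mem: "cutoff d a \<in> B"
    and add_mem: "a \<in> B \<Longrightarrow> b \<in> B \<Longrightarrow> a + b \<in> B"
    and triangle: "a \<in> B \<Longrightarrow> b \<in> B \<Longrightarrow> N (a + b) \<le> N a + N b"
    and scale_mem: "a \<in> B \<Longrightarrow> scale_fun c a \<in> B"
    and scale: "a \<in> B \<Longrightarrow> N (scale_fun c a) = norm c * N a"
    and coord: "a \<in> B \<Longrightarrow> norm (a n) \<le> N a"
    and tail: "a \<in> B \<Longrightarrow> (\<lambda>d. N (a - cutoff d a)) \<longlonglongrightarrow> 0"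
    and borel_norm: "N \<in> borel_measurable (\<Pi>\<^sub>M n\<in>UNIV. borel)"
begin

lemma norm_measurable:
  assumes "\<And>n. (\<lambda>x. f x n) \<in> borel_measurable P"
  shows "(\<lambda>x. N (f x)) \<in> borel_measurable P"
  by (rule measurable_compose[OF measurable_PiM_single' borel_norm]) (use assms in auto)

lemma zero_mem: "0 \<in> B"
  using cutoff_mem[of 0 undefined] by (simp add: cutoff_def zero_fun_def)

lemma norm_zero [simp]: "N 0 = 0"
proof -
  have "scale_fun 0 0 = (0 :: nat \<Rightarrow> 'k)" by (simp add: scale_fun_def fun_eq_iff)
  then show ?thesis using scale[OF zero_mem, of 0] by simp
qed

lemma minus_mem: "a \<in> B \<Longrightarrow> - a \<in> B"
  using scale_mem[of a "-1"] by (simp add: scale_fun_def fun_Compl_def)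

lemma norm_minus: "a \<in> B \<Longrightarrow> N (- a) = N a"
  using scale[of a "-1"] by (simp add: scale_fun_def fun_Compl_def)

lemma diff_mem: "a \<in> B \<Longrightarrow> b \<in> B \<Longrightarrow> a - b \<in> B"
  using add_mem[of a "- b"] minus_mem[of b] by simp

lemma basis_mem: "basis_seq n \<in> B"
proof -
  have "basis_seq n = cutoff (Suc n) (basis_seq n)" by (auto simp: basis_seq_def cutoff_def)
  then show ?thesis using cutoff_mem by metis
qed

lemma norm_cutoff_le: "N (cutoff d a) \<le> (\<Sum>n<d. norm (a n) * N (basis_seq n))"
proof (induction d)
  case 0
  have "cutoff 0 a = 0" by (simp add: cutoff_def zero_fun_def)
  then show ?case by (simp only: norm_zero lessThan_0 sum.empty)
next
  case (Suc d)
  have "N (cutoff (Suc d) a) \<le> N (cutoff d a) + norm (a d) * N (basis_seq d)"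
    unfolding cutoff_Suc
    using triangle[OF cutoff_mem scale_mem[OF basis_mem], of d a "a d" d]
    by (simp add: scale[OF basis_mem])
  with Suc show ?case by simp
qed

text \<open>
  Strong measurability is replaced by measurability of the components. This is implied by membership
  in \<open>bochner_L1\<close> (\<open>bochner_tame\<close>), it is easier to verify, and it is all that the triangle inequality
  for the integrated norm requires.
\<close>

definition tame :: "'w measure \<Rightarrow> ('w \<Rightarrow> nat \<Rightarrow> 'k) \<Rightarrow> bool" where
  "tame P f \<longleftrightarrow> (\<forall>x\<in>space P. f x \<in> B) \<and> (\<forall>n. (\<lambda>x. f x n) \<in> borel_measurable P) \<and>
     integrable P (\<lambda>x. N (f x))"

lemma tameI:
  assumes "\<And>x. x \<in> space P \<Longrightarrow> f x \<in> B" "\<And>n. (\<lambda>x. f x n) \<in> borel_measurable P"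
    and "integrable P g" "\<And>x. x \<in> space P \<Longrightarrow> N (f x) \<le> g x"
  shows "tame P f"
  unfolding tame_def
proof (intro conjI ballI allI)
  show "integrable P (\<lambda>x. N (f x))"
    by (rule Bochner_Integration.integrable_bound[OF assms(3) norm_measurable])
      (use assms nonneg in \<open>auto intro!: AE_I2 order_trans[OF _ abs_ge_self]\<close>)
qed (use assms in auto)

lemma tame_add:
  assumes "tame P f" "tame P g"
  shows "tame P (f + g)" "bochner_L1_norm P N (f + g) \<le> bochner_L1_norm P N f + bochner_L1_norm P N g"
proof -
  show t: "tame P (f + g)"
    by (rule tameI[where g = "\<lambda>x. N (f x) + N (g x)"])
      (use assms in \<open>auto simp: tame_def intro: add_mem triangle borel_measurable_add\<close>)
  have "bochner_L1_norm P N (f + g) \<le> (\<integral>x. N (f x) + N (g x) \<partial>P)"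
    unfolding bochner_L1_norm_def using assms t
    by (intro integral_mono) (auto simp: tame_def intro: triangle)
  also have "\<dots> = bochner_L1_norm P N f + bochner_L1_norm P N g"
    unfolding bochner_L1_norm_def using assms by (simp add: tame_def)
  finally show "bochner_L1_norm P N (f + g) \<le> bochner_L1_norm P N f + bochner_L1_norm P N g" .
qed

lemma tame_minus:
  assumes "tame P f"
  shows "tame P (- f)" "bochner_L1_norm P N (- f) = bochner_L1_norm P N f"
proof -
  show "tame P (- f)"
    by (rule tameI[where g = "\<lambda>x. N (f x)"])
      (use assms in \<open>auto simp: tame_def norm_minus intro: minus_mem\<close>)
  show "bochner_L1_norm P N (- f) = bochner_L1_norm P N f"
    unfolding bochner_L1_norm_def
    by (intro Bochner_Integration.integral_cong) (use assms in \<open>auto simp: tame_def norm_minus\<close>)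
qed

lemma tame_diff:
  assumes "tame P f" "tame P g"
  shows "tame P (f - g)" "bochner_L1_norm P N (f - g) \<le> bochner_L1_norm P N f + bochner_L1_norm P N g"
  using tame_add[OF assms(1) tame_minus(1)[OF assms(2)]] tame_minus[OF assms(2)] by auto

lemma tame_scale:
  assumes "tame P f"
  shows "tame P (scale_vfun c f)" "bochner_L1_norm P N (scale_vfun c f) = norm c * bochner_L1_norm P N f"
proof -
  show "tame P (scale_vfun c f)"
    by (rule tameI[where g = "\<lambda>x. norm c * N (f x)"])
      (use assms in \<open>auto simp: tame_def scale_vfun_def scale intro: scale_mem, auto simp: scale_fun_def intro: borel_measurable_times borel_measurable_const\<close>)
  have "bochner_L1_norm P N (scale_vfun c f) = (\<integral>x. norm c * N (f x) \<partial>P)"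
    unfolding bochner_L1_norm_def
    by (intro Bochner_Integration.integral_cong) (use assms in \<open>auto simp: tame_def scale_vfun_def scale\<close>)
  then show "bochner_L1_norm P N (scale_vfun c f) = norm c * bochner_L1_norm P N f"
    by (simp add: bochner_L1_norm_def)
qed

lemma bochner_nonneg: "0 \<le> bochner_L1_norm P N f"
  unfolding bochner_L1_norm_def by (intro integral_nonneg_AE) (simp add: nonneg)

lemma bochner_approx:
  assumes "f \<in> bochner_L1 P B N"
  obtains s where "\<And>x. x \<in> space P \<Longrightarrow> f x \<in> B"
    and "\<And>i. simple_function P (s i)" "\<And>i. s i ` space P \<subseteq> B"
    and "\<And>x. x \<in> space P \<Longrightarrow> (\<lambda>i. N (f x - s i x)) \<longlonglongrightarrow> 0"
    and "integrable P (\<lambda>x. N (f x))"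
proof -
  from assms obtain s where "\<forall>i. simple_function P (s i) \<and> s i ` space P \<subseteq> B"
    "\<forall>x\<in>space P. (\<lambda>i. N (f x - s i x)) \<longlonglongrightarrow> 0"
    by (auto simp: bochner_L1_def strongly_measurable_def)
  with assms show thesis
    by (intro that[of s]) (auto simp: bochner_L1_def strongly_measurable_def)
qed

lemma bochner_tame:
  assumes "f \<in> bochner_L1 P B N"
  shows "tame P f"
proof -
  obtain s where fB: "\<And>x. x \<in> space P \<Longrightarrow> f x \<in> B"
    and s: "\<And>i. simple_function P (s i)" "\<And>i. s i ` space P \<subseteq> B"
    and lim: "\<And>x. x \<in> space P \<Longrightarrow> (\<lambda>i. N (f x - s i x)) \<longlonglongrightarrow> 0"
    and int: "integrable P (\<lambda>x. N (f x))"
  proof (rule bochner_approx[OF assms], goal_cases)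
    case (1 s)
    show ?case by (rule that) (fact 1)+
  qed
  have "(\<lambda>x. f x n) \<in> borel_measurable P" for n
  proof (rule borel_measurable_LIMSEQ_metric)
    show "(\<lambda>x. s i x n) \<in> borel_measurable P" for i
      using simple_function_compose[OF s(1), of "\<lambda>a. a n" i]
      by (intro borel_measurable_simple_function) (simp add: comp_def)
    fix x assume x: "x \<in> space P"
    have "norm (s i x n - f x n) \<le> N (f x - s i x)" for i
      using coord[OF diff_mem[OF fB[OF x]], of "s i x" n] s(2)[of i] x
      by (auto simp: norm_minus_commute)
    then have "(\<lambda>i. s i x n - f x n) \<longlonglongrightarrow> 0"
      by (rule Lim_null_comparison[OF eventuallyI lim[OF x]])
    then show "(\<lambda>i. s i x n) \<longlonglongrightarrow> f x n" by (simp add: LIM_zero_iff)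
  qed
  with fB int show ?thesis by (simp add: tame_def)
qed

lemma bochner_scale:
  assumes "f \<in> bochner_L1 P B N"
  shows "scale_vfun c f \<in> bochner_L1 P B N"
proof -
  obtain s where fB: "\<And>x. x \<in> space P \<Longrightarrow> f x \<in> B"
    and s: "\<And>i. simple_function P (s i)" "\<And>i. s i ` space P \<subseteq> B"
    and lim: "\<And>x. x \<in> space P \<Longrightarrow> (\<lambda>i. N (f x - s i x)) \<longlonglongrightarrow> 0"
  proof (rule bochner_approx[OF assms], goal_cases)
    case (1 s)
    show ?case by (rule that) (fact 1)+
  qed
  have "strongly_measurable P B N (scale_vfun c f)"
    unfolding strongly_measurable_def
  proof (intro conjI ballI exI[of _ "\<lambda>i. scale_vfun c (s i)"] allI)
    show "simple_function P (scale_vfun c (s i))" for i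
      using simple_function_compose[OF s(1), of "scale_fun c" i] by (simp add: scale_vfun_def comp_def)
    show "scale_vfun c (s i) ` space P \<subseteq> B" for i
      using s(2)[of i] by (auto simp: scale_vfun_def intro: scale_mem)
    fix x assume x: "x \<in> space P"
    show "scale_vfun c f x \<in> B" using fB[OF x] by (simp add: scale_vfun_def scale_mem)
    have "N (scale_vfun c f x - scale_vfun c (s i) x) = norm c * N (f x - s i x)" for i
    proof -
      have "scale_vfun c f x - scale_vfun c (s i) x = scale_fun c (f x - s i x)"
        by (simp add: scale_vfun_def scale_fun_def fun_eq_iff right_diff_distrib)
      moreover have "f x - s i x \<in> B" using fB[OF x] s(2)[of i] x by (intro diff_mem) auto
      ultimately show ?thesis by (simp add: scale)
    qed
    then show "(\<lambda>i. N (scale_vfun c f x - scale_vfun c (s i) x)) \<longlonglongrightarrow> 0"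
      using tendsto_mult_right_zero[OF lim[OF x], of "norm c"] by simp
  qed
  then show ?thesis
    using tame_scale(1)[OF bochner_tame[OF assms], of c] by (simp add: bochner_L1_def tame_def)
qed

lemma bochner_add:
  assumes "f \<in> bochner_L1 P B N" "g \<in> bochner_L1 P B N"
  shows "f + g \<in> bochner_L1 P B N"
proof -
  obtain s where fB: "\<And>x. x \<in> space P \<Longrightarrow> f x \<in> B"
    and s: "\<And>i. simple_function P (s i)" "\<And>i. s i ` space P \<subseteq> B"
    and lims: "\<And>x. x \<in> space P \<Longrightarrow> (\<lambda>i. N (f x - s i x)) \<longlonglongrightarrow> 0"
  proof (rule bochner_approx[OF assms(1)], goal_cases)
    case (1 s)
    show ?case by (rule that) (fact 1)+
  qed
  obtain r where gB: "\<And>x. x \<in> space P \<Longrightarrow> g x \<in> B"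
    and r: "\<And>i. simple_function P (r i)" "\<And>i. r i ` space P \<subseteq> B"
    and limr: "\<And>x. x \<in> space P \<Longrightarrow> (\<lambda>i. N (g x - r i x)) \<longlonglongrightarrow> 0"
  proof (rule bochner_approx[OF assms(2)], goal_cases)
    case (1 s)
    show ?case by (rule that) (fact 1)+
  qed
  have "strongly_measurable P B N (f + g)"
    unfolding strongly_measurable_def
  proof (intro conjI ballI exI[of _ "\<lambda>i. s i + r i"] allI)
    show "simple_function P (s i + r i)" for i
      using simple_function_compose2[OF s(1) r(1), of "(+)" i i] by (simp add: plus_fun_def)
    show "(s i + r i) ` space P \<subseteq> B" for i
      using s(2)[of i] r(2)[of i] by (auto intro!: add_mem)
    fix x assume x: "x \<in> space P"
    show "(f + g) x \<in> B" using fB[OF x] gB[OF x] by (simp add: add_mem)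
    have le: "N ((f + g) x - (s i + r i) x) \<le> N (f x - s i x) + N (g x - r i x)" for i
    proof -
      have "(f + g) x - (s i + r i) x = (f x - s i x) + (g x - r i x)" by simp
      moreover have "f x - s i x \<in> B" "g x - r i x \<in> B"
        using fB[OF x] gB[OF x] s(2)[of i] r(2)[of i] x by (auto intro!: diff_mem)
      ultimately show ?thesis using triangle by metis
    qed
    have lim: "(\<lambda>i. N (f x - s i x) + N (g x - r i x)) \<longlonglongrightarrow> 0"
      using tendsto_add[OF lims[OF x] limr[OF x]] by simp
    show "(\<lambda>i. N ((f + g) x - (s i + r i) x)) \<longlonglongrightarrow> 0"
    proof (rule Lim_null_comparison[OF eventuallyI lim])
      show "norm (N ((f + g) x - (s i + r i) x)) \<le> N (f x - s i x) + N (g x - r i x)" for i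
        unfolding real_norm_def abs_of_nonneg[OF nonneg] by (rule le)
    qed
  qed
  then show ?thesis
    using tame_add(1)[OF bochner_tame[OF assms(1)] bochner_tame[OF assms(2)]]
    by (simp add: bochner_L1_def tame_def)
qed

lemma bochner_simple:
  assumes "simple_function P f" "\<And>x. x \<in> space P \<Longrightarrow> f x \<in> B" "finite_measure P"
  shows "f \<in> bochner_L1 P B N"
proof -
  interpret finite_measure P by fact
  have "strongly_measurable P B N f"
    unfolding strongly_measurable_def using assms
    by (intro conjI exI[of _ "\<lambda>_. f"]) auto
  moreover have "simple_function P (\<lambda>x. N (f x))"
    using simple_function_compose[OF assms(1), of N] by (simp add: comp_def)
  then have "integrable P (\<lambda>x. N (f x))"
    by (intro integrable_simple_function) (auto simp: emeasure_eq_measure)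
  ultimately show ?thesis by (simp add: bochner_L1_def)
qed

end

lemma lp_space_1: "lp_space 1 = {b. summable (\<lambda>n. norm (b n))}"
  by (simp add: lp_space_def)

lemma lp_norm_1: "lp_norm 1 b = \<bar>\<Sum>n. norm (b n)\<bar>"
  by (simp add: lp_norm_def)

lemma lp_space_2: "lp_space 2 = {b. summable (\<lambda>n. (norm (b n))\<^sup>2)}"
  by (simp add: lp_space_def)

lemma lp_norm_2: "b \<in> lp_space 2 \<Longrightarrow> lp_norm 2 b = sqrt (\<Sum>n. (norm (b n))\<^sup>2)"
  by (simp add: lp_norm_def lp_space_2 powr_half_sqrt suminf_nonneg)

lemma lp_norm_1_cutoff: "lp_norm 1 (cutoff d a) = (\<Sum>n<d. norm (a n))"
proof -
  have "(\<Sum>n. norm (cutoff d a n)) = (\<Sum>n<d. norm (cutoff d a n))"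
    by (intro suminf_finite) (auto simp: cutoff_def)
  then show ?thesis by (simp add: lp_norm_1 cutoff_def sum_nonneg)
qed

lemma lp_norm_2_cutoff: "lp_norm 2 (cutoff d a) = l2_part {..<d} a"
proof -
  have "(\<Sum>n. (norm (cutoff d a n))\<^sup>2) = (\<Sum>n<d. (norm (cutoff d a n))\<^sup>2)"
    by (intro suminf_finite) (auto simp: cutoff_def)
  moreover have "cutoff d a \<in> lp_space 2"
    unfolding lp_space_2 by (auto intro!: summable_finite[of "{..<d}"] simp: cutoff_def split: if_splits)
  ultimately show ?thesis by (simp add: lp_norm_2 cutoff_def l2_part_def)
qed

lemma l2_part_le_lp_norm_2:
  assumes "a \<in> lp_space 2" shows "l2_part {..<d} a \<le> lp_norm 2 a"
  using assms unfolding lp_norm_2[OF assms] l2_part_def lp_space_2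
  by (auto intro!: sum_le_suminf)

lemma sum_le_lp_norm_1:
  assumes "a \<in> lp_space 1" shows "(\<Sum>n<d. norm (a n)) \<le> lp_norm 1 a"
  using assms unfolding lp_norm_1 lp_space_1
  by (intro order_trans[OF _ abs_ge_self] sum_le_suminf) auto

lemma lp_norm_2_le:
  assumes "a \<in> lp_space 2" "\<And>d. l2_part {..<d} a \<le> C"
  shows "lp_norm 2 a \<le> C"
proof -
  have "(\<lambda>d. l2_part {..<d} a) \<longlonglongrightarrow> lp_norm 2 a"
    using assms(1) unfolding lp_norm_2[OF assms(1)] l2_part_def lp_space_2
    by (intro tendsto_real_sqrt summable_LIMSEQ) auto
  then show ?thesis using assms(2) by (intro LIMSEQ_le_const2) auto
qed

lemma seq_norm_l1: "seq_norm (lp_space 1 :: (nat \<Rightarrow> 'k::{real_normed_field, euclidean_space}) set) (lp_norm 1)"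
proof
  fix a b :: "nat \<Rightarrow> 'k" and c :: 'k and d n :: nat
  show "0 \<le> lp_norm 1 a" by (simp add: lp_norm_1)
  show "cutoff d a \<in> lp_space 1"
    unfolding lp_space_1 by (auto intro!: summable_finite[of "{..<d}"] simp: cutoff_def split: if_splits)
  show "scale_fun c a \<in> lp_space 1" if "a \<in> lp_space 1"
    using that by (auto simp: lp_space_1 scale_fun_def norm_mult intro: summable_mult)
  show "lp_norm 1 (scale_fun c a) = norm c * lp_norm 1 a" if "a \<in> lp_space 1"
    using that by (simp add: lp_space_1 lp_norm_1 scale_fun_def norm_mult suminf_mult abs_mult)
  show "norm (a n) \<le> lp_norm 1 a" if "a \<in> lp_space 1"
    using sum_le_lp_norm_1[OF that, of "Suc n"] sum_nonneg[of "{..<n}" "\<lambda>n. norm (a n)"] by simp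
  show ab: "a + b \<in> lp_space 1" if "a \<in> lp_space 1" "b \<in> lp_space 1"
  proof -
    have S: "summable (\<lambda>n. norm (a n) + norm (b n))"
      using that by (intro summable_add) (auto simp: lp_space_1)
    have "summable (\<lambda>n. norm (a n + b n))"
      by (intro summable_comparison_test'[OF S, where N = 0]) (auto simp: norm_triangle_ineq)
    then show ?thesis by (simp add: lp_space_1)
  qed
  show "lp_norm 1 (a + b) \<le> lp_norm 1 a + lp_norm 1 b" if "a \<in> lp_space 1" "b \<in> lp_space 1"
  proof -
    have "(\<Sum>n. norm ((a + b) n)) \<le> (\<Sum>n. norm (a n) + norm (b n))"
      using that ab[OF that] by (intro suminf_le) (auto simp: lp_space_1 norm_triangle_ineq intro: summable_add)
    also have "\<dots> = (\<Sum>n. norm (a n)) + (\<Sum>n. norm (b n))"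
      using that by (intro suminf_add[symmetric]) (auto simp: lp_space_1)
    finally show ?thesis
      using that ab[OF that] by (simp add: lp_norm_1 lp_space_1 suminf_nonneg)
  qed
  show "(\<lambda>d. lp_norm 1 (a - cutoff d a)) \<longlonglongrightarrow> 0" if "a \<in> lp_space 1"
  proof -
    have s: "summable (\<lambda>n. norm (a n))" using that by (simp add: lp_space_1)
    have "lp_norm 1 (a - cutoff d a) = \<bar>(\<Sum>n. norm (a n)) - (\<Sum>n<d. norm (a n))\<bar>" for d
    proof -
      have "(\<lambda>n. norm ((a - cutoff d a) n)) = (\<lambda>n. if n < d then 0 else norm (a n))"
        by (auto simp: cutoff_def)
      then show ?thesis using sums_unique[OF sums_tail[OF s, of d]] by (simp add: lp_norm_1)
    qed
    moreover have "(\<lambda>d. \<bar>(\<Sum>n. norm (a n)) - (\<Sum>n<d. norm (a n))\<bar>) \<longlonglongrightarrow> \<bar>(\<Sum>n. norm (a n)) - (\<Sum>n. norm (a n))\<bar>"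
      by (intro tendsto_intros summable_LIMSEQ s)
    ultimately show ?thesis by simp
  qed
  show "(lp_norm 1 :: (nat \<Rightarrow> 'k) \<Rightarrow> real) \<in> borel_measurable (\<Pi>\<^sub>M n\<in>UNIV. borel)"
    unfolding lp_norm_1[abs_def] by measurable
qed

lemma seq_norm_l2: "seq_norm (lp_space 2 :: (nat \<Rightarrow> 'k::{real_normed_field, euclidean_space}) set) (lp_norm 2)"
proof
  fix a b :: "nat \<Rightarrow> 'k" and c :: 'k and d n :: nat
  show "0 \<le> lp_norm 2 a" by (simp add: lp_norm_def)
  show "cutoff d a \<in> lp_space 2"
    unfolding lp_space_2 by (auto intro!: summable_finite[of "{..<d}"] simp: cutoff_def split: if_splits)
  show sc: "scale_fun c a \<in> lp_space 2" if "a \<in> lp_space 2"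
    using that by (auto simp: lp_space_2 scale_fun_def norm_mult power_mult_distrib intro: summable_mult)
  show "lp_norm 2 (scale_fun c a) = norm c * lp_norm 2 a" if "a \<in> lp_space 2"
    using that sc[OF that]
    by (simp add: lp_norm_2) (simp add: lp_space_2 scale_fun_def norm_mult power_mult_distrib suminf_mult real_sqrt_mult)
  show "norm (a n) \<le> lp_norm 2 a" if "a \<in> lp_space 2"
  proof -
    have "norm (a n) = sqrt ((norm (a n))\<^sup>2)" by simp
    also have "\<dots> \<le> l2_part {..<Suc n} a"
      unfolding l2_part_def by (intro real_sqrt_le_mono member_le_sum) auto
    also have "\<dots> \<le> lp_norm 2 a" by (rule l2_part_le_lp_norm_2[OF that])
    finally show ?thesis .
  qed
  show ab: "a + b \<in> lp_space 2" if "a \<in> lp_space 2" "b \<in> lp_space 2"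
  proof -
    have le: "(norm (a n + b n))\<^sup>2 \<le> 2 * (norm (a n))\<^sup>2 + 2 * (norm (b n))\<^sup>2" for n
    proof -
      have "(norm (a n + b n))\<^sup>2 \<le> (norm (a n) + norm (b n))\<^sup>2"
        by (intro power_mono norm_triangle_ineq) auto
      also have "\<dots> \<le> 2 * (norm (a n))\<^sup>2 + 2 * (norm (b n))\<^sup>2"
        using sum_squares_bound[of "norm (a n)" "norm (b n)"] by (simp add: power2_sum)
      finally show ?thesis .
    qed
    have S: "summable (\<lambda>n. 2 * (norm (a n))\<^sup>2 + 2 * (norm (b n))\<^sup>2)"
      using that by (intro summable_add summable_mult) (auto simp: lp_space_2)
    have "summable (\<lambda>n. (norm (a n + b n))\<^sup>2)"
      using le by (intro summable_comparison_test'[OF S, where N = 0]) auto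
    then show ?thesis by (simp add: lp_space_2)
  qed
  show "lp_norm 2 (a + b) \<le> lp_norm 2 a + lp_norm 2 b" if "a \<in> lp_space 2" "b \<in> lp_space 2"
  proof (rule lp_norm_2_le[OF ab[OF that]])
    fix d
    have "l2_part {..<d} (a + b) \<le> l2_part {..<d} a + l2_part {..<d} b"
      using l2_part_add[of "{..<d}" a b] by (simp add: plus_fun_def)
    also have "\<dots> \<le> lp_norm 2 a + lp_norm 2 b"
      by (intro add_mono l2_part_le_lp_norm_2 that)
    finally show "l2_part {..<d} (a + b) \<le> lp_norm 2 a + lp_norm 2 b" .
  qed
  show "(\<lambda>d. lp_norm 2 (a - cutoff d a)) \<longlonglongrightarrow> 0" if "a \<in> lp_space 2"
  proof -
    have s: "summable (\<lambda>n. (norm (a n))\<^sup>2)" using that by (simp add: lp_space_2)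
    have "lp_norm 2 (a - cutoff d a) = sqrt ((\<Sum>n. (norm (a n))\<^sup>2) - (\<Sum>n<d. (norm (a n))\<^sup>2))" for d
    proof -
      have eq: "(\<lambda>n. (norm ((a - cutoff d a) n))\<^sup>2) = (\<lambda>n. if n < d then 0 else (norm (a n))\<^sup>2)"
        by (auto simp: cutoff_def)
      then have "a - cutoff d a \<in> lp_space 2"
        using sums_summable[OF sums_tail[OF s, of d]] by (simp add: lp_space_2)
      then show ?thesis using eq sums_unique[OF sums_tail[OF s, of d]] by (simp add: lp_norm_2)
    qed
    moreover have "(\<lambda>d. sqrt ((\<Sum>n. (norm (a n))\<^sup>2) - (\<Sum>n<d. (norm (a n))\<^sup>2))) \<longlonglongrightarrow> sqrt ((\<Sum>n. (norm (a n))\<^sup>2) - (\<Sum>n. (norm (a n))\<^sup>2))"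
      by (intro tendsto_intros summable_LIMSEQ s)
    ultimately show ?thesis by simp
  qed
  show "(lp_norm 2 :: (nat \<Rightarrow> 'k) \<Rightarrow> real) \<in> borel_measurable (\<Pi>\<^sub>M n\<in>UNIV. borel)"
    unfolding lp_norm_def[abs_def] by measurable
qed

section \<open>Square-integrable functions\<close>

definition sq_mean :: "'w measure \<Rightarrow> ('w \<Rightarrow> 'k::real_normed_vector) \<Rightarrow> real" where
  "sq_mean P f = (\<integral>x. (norm (f x))\<^sup>2 \<partial>P)"

lemma sq_mean_nonneg: "0 \<le> sq_mean P f"
  by (simp add: sq_mean_def)

lemma L2_norm_sq_mean: "L2_norm P f = sqrt (sq_mean P f)"
  by (simp add: L2_norm_def sq_mean_def)

lemma L2_norm_less_iff: "0 < e \<Longrightarrow> L2_norm P f < e \<longleftrightarrow> sq_mean P f < e\<^sup>2"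
  unfolding L2_norm_sq_mean using real_sqrt_less_iff[of "sq_mean P f" "e\<^sup>2"] by simp

lemma norm_add_sq_le:
  fixes a b :: "'k::real_normed_vector"
  shows "(norm (a + b))\<^sup>2 \<le> 2 * (norm a)\<^sup>2 + 2 * (norm b)\<^sup>2"
proof -
  have "(norm (a + b))\<^sup>2 \<le> (norm a + norm b)\<^sup>2"
    by (intro power_mono norm_triangle_ineq) auto
  also have "\<dots> \<le> 2 * (norm a)\<^sup>2 + 2 * (norm b)\<^sup>2"
    using sum_squares_bound[of "norm a" "norm b"] by (simp add: power2_sum)
  finally show ?thesis .
qed

lemma L2_add:
  fixes f g :: "'w \<Rightarrow> 'k::{real_normed_field, euclidean_space}"
  assumes "f \<in> L2 P" "g \<in> L2 P"
  shows "(\<lambda>x. f x + g x) \<in> L2 P"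
    and "sq_mean P (\<lambda>x. f x + g x) \<le> 2 * sq_mean P f + 2 * sq_mean P g"
proof -
  have [measurable]: "f \<in> borel_measurable P" "g \<in> borel_measurable P"
    and int: "integrable P (\<lambda>x. (norm (f x))\<^sup>2)" "integrable P (\<lambda>x. (norm (g x))\<^sup>2)"
    using assms by (auto simp: L2_def)
  have i: "integrable P (\<lambda>x. 2 * (norm (f x))\<^sup>2 + 2 * (norm (g x))\<^sup>2)"
    using int by simp
  have j: "integrable P (\<lambda>x. (norm (f x + g x))\<^sup>2)"
    by (rule Bochner_Integration.integrable_bound[OF i]) (auto intro!: AE_I2 norm_add_sq_le order_trans[OF _ abs_ge_self])
  then show "(\<lambda>x. f x + g x) \<in> L2 P" by (simp add: L2_def)
  have "sq_mean P (\<lambda>x. f x + g x) \<le> (\<integral>x. 2 * (norm (f x))\<^sup>2 + 2 * (norm (g x))\<^sup>2 \<partial>P)"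
    unfolding sq_mean_def by (intro integral_mono i j norm_add_sq_le)
  also have "\<dots> = 2 * sq_mean P f + 2 * sq_mean P g"
    using int by (simp add: sq_mean_def)
  finally show "sq_mean P (\<lambda>x. f x + g x) \<le> 2 * sq_mean P f + 2 * sq_mean P g" .
qed

lemma L2_scale:
  fixes f :: "'w \<Rightarrow> 'k::{real_normed_field, euclidean_space}"
  assumes "f \<in> L2 P"
  shows "(\<lambda>x. c * f x) \<in> L2 P" "sq_mean P (\<lambda>x. c * f x) = (norm c)\<^sup>2 * sq_mean P f"
  using assms by (auto simp: L2_def sq_mean_def norm_mult power_mult_distrib intro: borel_measurable_times)

lemma L2_diff:
  fixes f g :: "'w \<Rightarrow> 'k::{real_normed_field, euclidean_space}"
  assumes "f \<in> L2 P" "g \<in> L2 P"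
  shows "(\<lambda>x. f x - g x) \<in> L2 P"
    and "sq_mean P (\<lambda>x. f x - g x) \<le> 2 * sq_mean P f + 2 * sq_mean P g"
  using L2_add[OF assms(1) L2_scale(1)[OF assms(2), of "-1"]] L2_scale(2)[OF assms(2), of "-1"] by auto

lemma L2_zero: "(\<lambda>x. 0) \<in> L2 P"
  by (simp add: L2_def)

lemma L2_sum:
  fixes f :: "'i \<Rightarrow> 'w \<Rightarrow> 'k::{real_normed_field, euclidean_space}"
  shows "(\<And>i. i \<in> I \<Longrightarrow> f i \<in> L2 P) \<Longrightarrow> (\<lambda>x. \<Sum>i\<in>I. f i x) \<in> L2 P"
  by (induction I rule: infinite_finite_induct) (auto intro: L2_zero L2_add)

lemma integrable_inner_L2:
  fixes f g :: "'w \<Rightarrow> 'k::{real_normed_field, euclidean_space}"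
  assumes "f \<in> L2 P" "g \<in> L2 P"
  shows "integrable P (\<lambda>x. inner (f x) (g x))"
proof -
  have [measurable]: "f \<in> borel_measurable P" "g \<in> borel_measurable P"
    and int: "integrable P (\<lambda>x. (norm (f x))\<^sup>2)" "integrable P (\<lambda>x. (norm (g x))\<^sup>2)"
    using assms by (auto simp: L2_def)
  have i: "integrable P (\<lambda>x. (norm (f x))\<^sup>2 + (norm (g x))\<^sup>2)"
    using int by simp
  show ?thesis
  proof (rule Bochner_Integration.integrable_bound[OF i])
    show "AE x in P. norm (inner (f x) (g x)) \<le> norm ((norm (f x))\<^sup>2 + (norm (g x))\<^sup>2)"
    proof (intro AE_I2)
      fix x
      have "\<bar>inner (f x) (g x)\<bar> \<le> norm (f x) * norm (g x)" by (rule Cauchy_Schwarz_ineq2)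
      moreover have "2 * (norm (f x) * norm (g x)) \<le> (norm (f x))\<^sup>2 + (norm (g x))\<^sup>2"
        using sum_squares_bound[of "norm (f x)" "norm (g x)"] by simp
      moreover have "0 \<le> norm (f x) * norm (g x)" by simp
      ultimately show "norm (inner (f x) (g x)) \<le> norm ((norm (f x))\<^sup>2 + (norm (g x))\<^sup>2)"
        by (simp only: real_norm_def)
    qed
  qed simp
qed

lemma (in prob_space) L2_integrable:
  fixes f :: "'a \<Rightarrow> 'k::{real_normed_field, euclidean_space}"
  assumes "f \<in> L2 M"
  shows "integrable M f" "(\<integral>x. norm (f x) \<partial>M) \<le> L2_norm M f"
proof -
  have [measurable]: "f \<in> borel_measurable M"
    and int: "integrable M (\<lambda>x. (norm (f x))\<^sup>2)"
    using assms by (auto simp: L2_def)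
  have "integrable M (\<lambda>x. 1 + (norm (f x))\<^sup>2)" using int by simp
  then show i: "integrable M f"
  proof (rule Bochner_Integration.integrable_bound)
    show "AE x in M. norm (f x) \<le> norm (1 + (norm (f x))\<^sup>2)"
    proof (intro AE_I2)
      fix x
      have "2 * norm (f x) \<le> 1 + (norm (f x))\<^sup>2"
        using sum_squares_bound[of 1 "norm (f x)"] by simp
      then have "norm (f x) \<le> 1 + (norm (f x))\<^sup>2" using norm_ge_zero[of "f x"] by linarith
      then show "norm (f x) \<le> norm (1 + (norm (f x))\<^sup>2)" by simp
    qed
  qed simp
  have "0 \<le> variance (\<lambda>x. norm (f x))" by (rule variance_positive)
  also have "\<dots> = sq_mean M f - (\<integral>x. norm (f x) \<partial>M)\<^sup>2"
    using i int by (subst variance_eq) (auto simp: sq_mean_def)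
  finally have "(\<integral>x. norm (f x) \<partial>M)\<^sup>2 \<le> sq_mean M f" by simp
  then show "(\<integral>x. norm (f x) \<partial>M) \<le> L2_norm M f"
    unfolding L2_norm_sq_mean by (rule real_le_rsqrt)
qed

section \<open>Hoeffding decomposition\<close>

text \<open>
  Expand the identity as \<open>\<Prod>i<N. (diff i + avg i)\<close>: splitting coordinate \<open>k\<close> in every term found so far
  makes it either centred in \<open>k\<close> or independent of \<open>k\<close>.
\<close>

lemma (in finite_power) hoeffding:
  fixes F :: "(nat \<Rightarrow> 'c) \<Rightarrow> 'v::real_vector"
  shows "\<exists>H. (\<forall>A\<subseteq>{..<N}. centered A (H A)) \<and> (\<forall>x\<in>words. F x = (\<Sum>A\<in>Pow {..<N}. H A x))"
proof -
  have "\<exists>H. (\<forall>A\<subseteq>{..<k}. determined (A \<union> {k..<N}) (H A) \<and> (\<forall>i\<in>A. \<forall>x\<in>words. avg i (H A) x = 0)) \<and>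
      (\<forall>x\<in>words. F x = (\<Sum>A\<in>Pow {..<k}. H A x))" if "k \<le> N" for k
    using that
  proof (induction k)
    case 0
    have "determined {0..<N} F"
      unfolding determined_def
    proof (intro ballI impI)
      fix x y assume xy: "x \<in> words" "y \<in> words" "agree {0..<N} x y"
      have "x = y"
        by (rule PiE_ext[OF xy(1,2)[unfolded words_def]]) (use xy(3) in \<open>auto simp: agree_def\<close>)
      then show "F x = F y" by simp
    qed
    then show ?case by (intro exI[of _ "\<lambda>_. F"]) auto
  next
    case (Suc k)
    from Suc obtain H where "(\<forall>A\<subseteq>{..<k}. determined (A \<union> {k..<N}) (H A) \<and> (\<forall>i\<in>A. \<forall>x\<in>words. avg i (H A) x = 0)) \<and>
      (\<forall>x\<in>words. F x = (\<Sum>A\<in>Pow {..<k}. H A x))" by auto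
    then have H: "\<And>A. A \<subseteq> {..<k} \<Longrightarrow> determined (A \<union> {k..<N}) (H A)"
      "\<And>A i x. A \<subseteq> {..<k} \<Longrightarrow> i \<in> A \<Longrightarrow> x \<in> words \<Longrightarrow> avg i (H A) x = 0"
      "\<And>x. x \<in> words \<Longrightarrow> F x = (\<Sum>A\<in>Pow {..<k}. H A x)"
      by blast+
    have k: "k < N" using Suc by simp
    define H' where "H' A = (if k \<in> A then diff k (H (A - {k})) else avg k (H A))" for A
    show ?case
    proof (intro exI[of _ H'] conjI allI impI ballI)
      fix A assume A: "A \<subseteq> {..<Suc k}"
      show "determined (A \<union> {Suc k..<N}) (H' A)"
      proof (cases "k \<in> A")
        case True
        have sub: "A - {k} \<subseteq> {..<k}" using A by (auto simp: less_Suc_eq)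
        have eq: "A - {k} \<union> {k..<N} = A \<union> {Suc k..<N}"
          using True k ivl_disj_un_two(3)[of k "Suc k" N] by auto
        have "determined (A \<union> {Suc k..<N}) (H (A - {k}))" using H(1)[OF sub] eq by simp
        then show ?thesis
          using determined_mono[OF determined_avg[of "A \<union> {Suc k..<N}" "H (A - {k})" k]] k True
          by (auto simp: H'_def diff_def intro!: determined_comp2[where h = minus])
      next
        case False
        then have sub: "A \<subseteq> {..<k}" using A by (auto simp: less_Suc_eq)
        have eq: "(A \<union> {k..<N}) - {k} = A \<union> {Suc k..<N}" using False k by auto
        show ?thesis
          using determined_avg[OF H(1)[OF sub] k] False unfolding eq by (simp add: H'_def)
      qed
      fix i x assume i: "i \<in> A" and x: "x \<in> words"
      have avg0: "avg k (avg i (H B)) x = 0" if "B \<subseteq> {..<k}" "i \<in> B" for B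
      proof -
        have "avg k (avg i (H B)) x = avg k (\<lambda>_. 0) x"
          using H(2)[OF that] x k by (intro avg_cong) auto
        then show ?thesis by (simp add: avg_const)
      qed
      show "avg i (H' A) x = 0"
      proof (cases "k \<in> A")
        case True
        have sub: "A - {k} \<subseteq> {..<k}" using A by (auto simp: less_Suc_eq)
        show ?thesis
        proof (cases "i = k")
          case True
          then show ?thesis using \<open>k \<in> A\<close> by (simp add: H'_def diff_def avg_diff avg_idem)
        next
          case False
          then have "i \<in> A - {k}" using i by simp
          then show ?thesis
            using \<open>k \<in> A\<close> avg0[OF sub] H(2)[OF sub _ x] by (simp add: H'_def diff_def avg_diff avg_commute[of i k])
        qed
      next
        case False
        then have sub: "A \<subseteq> {..<k}" using A by (auto simp: less_Suc_eq)
        show ?thesis using False avg0[OF sub i] by (simp add: H'_def avg_commute[of i k])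
      qed
    next
      fix x assume x: "x \<in> words"
      have "(\<Sum>A\<in>Pow {..<Suc k}. H' A x) = (\<Sum>A\<in>Pow {..<k}. H' A x) + (\<Sum>A\<in>Pow {..<k}. H' (insert k A) x)"
        unfolding lessThan_Suc by (rule sum_Pow_insert) auto
      also have "(\<Sum>A\<in>Pow {..<k}. H' A x) = (\<Sum>A\<in>Pow {..<k}. avg k (H A) x)"
        by (intro sum.cong) (auto simp: H'_def)
      also have "(\<Sum>A\<in>Pow {..<k}. H' (insert k A) x) = (\<Sum>A\<in>Pow {..<k}. H A x - avg k (H A) x)"
      proof (intro sum.cong refl)
        fix A assume "A \<in> Pow {..<k}"
        then have "insert k A - {k} = A" by auto
        then show "H' (insert k A) x = H A x - avg k (H A) x" by (simp add: H'_def diff_def)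
      qed
      finally show "F x = (\<Sum>A\<in>Pow {..<Suc k}. H' A x)"
        using H(3)[OF x] by (simp add: sum_subtractf)
    qed
  qed
  from this[of N] show ?thesis by (simp add: centered_def)
qed

lemma (in finite_power) mean_inner_centered:
  fixes F G :: "(nat \<Rightarrow> 'c) \<Rightarrow> 'v::real_inner"
  assumes "centered A F" "centered B G" "A \<subseteq> {..<N}" "B \<subseteq> {..<N}" "A \<noteq> B"
  shows "mean (\<lambda>x. inner (F x) (G x)) = 0"
proof -
  have *: "mean (\<lambda>x. inner (F x) (G x)) = 0"
    if F: "centered A F" and G: "centered B G" and i: "i \<in> B" "i \<notin> A" "i < N" for A B i and F G :: "(nat \<Rightarrow> 'c) \<Rightarrow> 'v"
  proof -
    have "mean (\<lambda>x. inner (F x) (G x)) = mean (\<lambda>x. inner (F x) (avg i G x))"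
      using F i by (intro mean_inner_determined) (auto simp: centered_def)
    also have "\<dots> = mean (\<lambda>x. 0)"
      using G i by (intro mean_cong) (auto simp: centered_def)
    finally show ?thesis by (simp add: mean_const)
  qed
  show ?thesis
  proof (cases "B \<subseteq> A")
    case False
    then show ?thesis using *[OF assms(1,2)] assms by blast
  next
    case True
    then obtain i where "i \<in> A" "i \<notin> B" using assms(5) by blast
    then show ?thesis using *[OF assms(2,1), of i] assms by (auto simp: inner_commute)
  qed
qed

section \<open>Coding the infinite power by finitely many letters\<close>

locale power_space = prob_space M for M :: "'a measure"
begin

abbreviation \<P> :: "(nat \<Rightarrow> 'a) measure" where "\<P> \<equiv> infinite_power M"

lemma prob_space_power: "prob_space \<P>"
  unfolding infinite_power_def by (intro prob_space_PiM prob_space_axioms)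

sublocale power: prob_space "infinite_power M"
  by (rule prob_space_power)

lemma space_power: "space \<P> = {x. \<forall>i. x i \<in> space M}"
  by (auto simp: infinite_power_def space_PiM PiE_UNIV_domain)

text \<open>
  Replacing one coordinate by an independent copy does not change the distribution.
\<close>

lemma integral_resample:
  fixes F :: "(nat \<Rightarrow> 'a) \<Rightarrow> real"
  assumes "integrable \<P> F"
  shows "(\<integral>x. F x \<partial>\<P>) = (\<integral>x. (\<integral>y. F (x(i := y)) \<partial>M) \<partial>\<P>)"
proof -
  interpret pps: pair_sigma_finite M "infinite_power M" ..
  have D: "distr (M \<Otimes>\<^sub>M \<P>) \<P> (\<lambda>(y, x). x(i := y)) = \<P>"
    using distr_pair_PiM_eq_PiM[of UNIV "\<lambda>_. M" i] prob_space_axioms by (simp add: infinite_power_def)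
  have meas: "(\<lambda>(y, x). x(i := y)) \<in> measurable (M \<Otimes>\<^sub>M \<P>) \<P>"
    unfolding infinite_power_def case_prod_unfold
    by (rule measurable_fun_upd[where J = UNIV]) auto
  have "integrable (distr (M \<Otimes>\<^sub>M \<P>) \<P> (\<lambda>(y, x). x(i := y))) F"
    using assms D by simp
  then have int: "integrable (M \<Otimes>\<^sub>M \<P>) (case_prod (\<lambda>y x. F (x(i := y))))"
    using integrable_distr_eq[OF meas, of F] assms by (simp add: case_prod_unfold)
  have "(\<integral>x. F x \<partial>\<P>) = (\<integral>x. F x \<partial>(distr (M \<Otimes>\<^sub>M \<P>) \<P> (\<lambda>(y, x). x(i := y))))"
    by (simp add: D)
  also have "\<dots> = (\<integral>z. F ((\<lambda>(y, x). x(i := y)) z) \<partial>(M \<Otimes>\<^sub>M \<P>))"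
    using assms by (intro integral_distr meas) auto
  also have "\<dots> = (\<integral>x. (\<integral>y. F (x(i := y)) \<partial>M) \<partial>\<P>)"
    using pps.integral_snd[OF int] by (simp add: case_prod_unfold)
  finally show ?thesis .
qed

definition finite_code :: "('a \<Rightarrow> nat) \<Rightarrow> bool" where
  "finite_code q \<longleftrightarrow> q \<in> measurable M (count_space UNIV) \<and> finite (range q)"

definition letter_prob :: "('a \<Rightarrow> nat) \<Rightarrow> nat \<Rightarrow> real" where
  "letter_prob q c = measure M {a \<in> space M. q a = c}"

end

text \<open>
  The map \<open>q\<close> groups the points of \<open>M\<close> into finitely many letters. Functions of the letters of the first
  \<open>N\<close> coordinates form a copy of the functions on a finite power.
\<close>

locale code_space = power_space M for M :: "'a measure" +
  fixes q :: "'a \<Rightarrow> nat" and N :: nat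
  assumes code: "finite_code q"
begin

lemma q_measurable [measurable]: "q \<in> measurable M (count_space UNIV)"
  using code by (simp add: finite_code_def)

lemma finite_range_q: "finite (range q)"
  using code by (simp add: finite_code_def)

lemma integral_letter:
  fixes h :: "nat \<Rightarrow> real"
  shows "(\<integral>y. h (q y) \<partial>M) = (\<Sum>c\<in>range q. letter_prob q c * h c)"
proof -
  have "(\<integral>y. h (q y) \<partial>M) = (\<integral>y. (\<Sum>c\<in>range q. indicator {a \<in> space M. q a = c} y * h c) \<partial>M)"
    using finite_range_q by (intro Bochner_Integration.integral_cong) (auto simp: indicator_def if_distrib cong: if_cong)
  also have "\<dots> = (\<Sum>c\<in>range q. letter_prob q c * h c)"
    by (subst Bochner_Integration.integral_sum)
      (auto simp: letter_prob_def emeasure_eq_measure intro!: sum.cong)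
  finally show ?thesis .
qed

sublocale finite_power "range q" "letter_prob q" N
proof
  show "(\<Sum>c\<in>range q. letter_prob q c) = 1"
    using integral_letter[of "\<lambda>_. 1"] by (simp add: prob_space)
qed (auto simp: finite_range_q letter_prob_def)

definition encode :: "(nat \<Rightarrow> 'a) \<Rightarrow> nat \<Rightarrow> nat" where
  "encode x = restrict (\<lambda>i. q (x i)) {..<N}"

lemma encode_words: "encode x \<in> words"
  by (auto simp: encode_def words_def)

lemma encode_eq_iff: "c \<in> words \<Longrightarrow> encode x = c \<longleftrightarrow> (\<forall>i\<in>{..<N}. q (x i) = c i)"
  by (auto simp: encode_def words_def fun_eq_iff PiE_iff extensional_def restrict_def)

lemma encode_upd: "i < N \<Longrightarrow> encode (x(i := y)) = (encode x)(i := q y)"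
  by (auto simp: encode_def fun_eq_iff)

lemma q_coord_measurable [measurable]: "(\<lambda>x. q (x i)) \<in> measurable \<P> (count_space UNIV)"
  unfolding infinite_power_def by measurable

lemma encode_set:
  assumes "c \<in> words"
  shows "{x \<in> space \<P>. encode x = c} \<in> sets \<P>"
  unfolding encode_eq_iff[OF assms] by (intro sets.sets_Collect_finite_All) auto

lemma prob_encode:
  assumes "c \<in> words"
  shows "measure \<P> {x \<in> space \<P>. encode x = c} = weight c"
proof -
  interpret pp: product_prob_space "\<lambda>_. M" "UNIV :: nat set" ..
  have "emeasure \<P> {x \<in> space \<P>. encode x = c} =
      emeasure \<P> {x \<in> space \<P>. \<forall>i\<in>{..<N}. x i \<in> {a \<in> space M. q a = c i}}"
    by (intro arg_cong[where f = "emeasure \<P>"]) (auto simp: encode_eq_iff[OF assms] space_power)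
  also have "\<dots> = (\<Prod>i<N. emeasure M {a \<in> space M. q a = c i})"
    unfolding infinite_power_def by (rule pp.emeasure_PiM_Collect) auto
  also have "\<dots> = ennreal (weight c)"
    by (simp add: weight_def letter_prob_def emeasure_eq_measure prod_ennreal)
  finally show ?thesis
    using weight_nonneg[OF assms] by (simp add: measure_def)
qed

lemma encode_simple: "simple_function \<P> (\<lambda>x. F (encode x))"
proof -
  have "simple_function \<P> encode"
    unfolding simple_function_def
  proof (intro conjI ballI)
    show "finite (encode ` space \<P>)"
      by (rule finite_subset[OF _ finite_words]) (auto intro: encode_words)
    fix c assume "c \<in> encode ` space \<P>"
    then have "c \<in> words" using encode_words by auto
    from encode_set[OF this] show "encode -` {c} \<inter> space \<P> \<in> sets \<P>"
      by (simp add: vimage_def Int_def conj_commute)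
  qed
  from simple_function_compose[OF this, of F] show ?thesis by (simp add: comp_def)
qed

lemma integrable_encode: "integrable \<P> (\<lambda>x. F (encode x) :: real)"
  by (intro integrable_simple_function encode_simple) (simp add: power.emeasure_eq_measure)

lemma integral_encode:
  fixes F :: "(nat \<Rightarrow> nat) \<Rightarrow> real"
  shows "(\<integral>x. F (encode x) \<partial>\<P>) = mean F"
proof -
  have "(\<integral>x. F (encode x) \<partial>\<P>) = (\<integral>x. (\<Sum>c\<in>words. indicator {x \<in> space \<P>. encode x = c} x * F c) \<partial>\<P>)"
    by (intro Bochner_Integration.integral_cong)
      (auto simp: indicator_def if_distrib encode_words cong: if_cong)
  also have "\<dots> = (\<Sum>c\<in>words. measure \<P> {x \<in> space \<P>. encode x = c} * F c)"
    using encode_set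
    by (subst Bochner_Integration.integral_sum) (auto simp: power.emeasure_eq_measure intro!: sum.cong)
  also have "\<dots> = mean F"
    unfolding mean_def by (intro sum.cong) (auto simp: prob_encode)
  finally show ?thesis .
qed

lemma encode_L2:
  fixes F :: "(nat \<Rightarrow> nat) \<Rightarrow> 'k::{real_normed_field, euclidean_space}"
  shows "(\<lambda>x. F (encode x)) \<in> L2 \<P>"
  using borel_measurable_simple_function[OF encode_simple[of F]] integrable_encode[of "\<lambda>c. (norm (F c))\<^sup>2"]
  by (simp add: L2_def)

text \<open>
  Resampling a coordinate that \<open>f\<close> does not see averages \<open>S\<close> over this coordinate.
\<close>

lemma orthogonal_free:
  fixes f :: "(nat \<Rightarrow> 'a) \<Rightarrow> 'k::{real_normed_field, euclidean_space}"
  assumes f: "f \<in> L2 \<P>" "depends_on \<P> D f" and i: "i \<notin> D" "i < N"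
    and S: "\<And>c. c \<in> words \<Longrightarrow> avg i S c = 0"
  shows "(\<integral>x. inner (f x) (S (encode x)) \<partial>\<P>) = 0"
proof -
  have "(\<integral>x. inner (f x) (S (encode x)) \<partial>\<P>) =
      (\<integral>x. (\<integral>y. inner (f (x(i := y))) (S (encode (x(i := y)))) \<partial>M) \<partial>\<P>)"
    by (intro integral_resample integrable_inner_L2 f encode_L2)
  also have "\<dots> = (\<integral>x. 0 \<partial>\<P>)"
  proof (intro Bochner_Integration.integral_cong refl)
    fix x assume x: "x \<in> space \<P>"
    have "(\<integral>y. inner (f (x(i := y))) (S (encode (x(i := y)))) \<partial>M) =
        (\<integral>y. inner (f x) (S ((encode x)(i := q y))) \<partial>M)"
    proof (intro Bochner_Integration.integral_cong refl)
      fix y assume "y \<in> space M"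
      then have "x(i := y) \<in> space \<P>" using x by (auto simp: space_power)
      moreover have "\<forall>j\<in>D. (x(i := y)) j = x j" using i by auto
      ultimately have "f (x(i := y)) = f x"
        using f(2) x unfolding depends_on_def by blast
      then show "inner (f (x(i := y))) (S (encode (x(i := y)))) = inner (f x) (S ((encode x)(i := q y)))"
        using i by (simp add: encode_upd)
    qed
    also have "\<dots> = (\<Sum>c\<in>range q. letter_prob q c * inner (f x) (S ((encode x)(i := c))))"
      by (rule integral_letter)
    also have "\<dots> = inner (f x) (avg i S (encode x))"
      by (simp add: avg_def inner_sum_right)
    also have "\<dots> = 0" using S[OF encode_words] by simp
    finally show "(\<integral>y. inner (f (x(i := y))) (S (encode (x(i := y)))) \<partial>M) = 0" .
  qed
  finally show ?thesis by simp
qed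

end

section \<open>The homogeneous subspaces and their finite approximation\<close>

interpretation fun_vs: vector_space "scale_fun :: 'k::field \<Rightarrow> ('w \<Rightarrow> 'k) \<Rightarrow> 'w \<Rightarrow> 'k"
  by (rule vector_space_scale_fun)

context power_space
begin

text \<open>
  The functions whose closed span is \<open>U2_le\<close>.
\<close>

definition few_coords :: "nat \<Rightarrow> ((nat \<Rightarrow> 'a) \<Rightarrow> 'k::{real_normed_field, euclidean_space}) set" where
  "few_coords k = {f \<in> L2 \<P>. \<exists>A. finite A \<and> card A \<le> k \<and> depends_on \<P> A f}"

lemma U2_le_iff:
  "f \<in> U2_le M k \<longleftrightarrow> f \<in> L2 \<P> \<and> (\<forall>e>0. \<exists>g\<in>fun_vs.span (few_coords k). sq_mean \<P> (\<lambda>x. f x - g x) < e\<^sup>2)"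
  by (auto simp: U2_le_def norm_closure_def few_coords_def[symmetric] fun_diff_def L2_norm_less_iff)

lemma U2_le_L2: "f \<in> U2_le M k \<Longrightarrow> f \<in> L2 \<P>"
  by (simp add: U2_le_iff)

lemma U2_le_approx:
  assumes "f \<in> U2_le M k" "0 < e"
  obtains g where "g \<in> fun_vs.span (few_coords k)" "sq_mean \<P> (\<lambda>x. f x - g x) < e\<^sup>2"
proof -
  have "\<exists>g\<in>fun_vs.span (few_coords k). sq_mean \<P> (\<lambda>x. f x - g x) < e\<^sup>2"
    using assms by (simp add: U2_le_iff)
  then show thesis using that by auto
qed

lemma span_few_coords_L2:
  assumes "f \<in> fun_vs.span (few_coords k)" shows "f \<in> L2 \<P>"
  using assms
proof (induction rule: fun_vs.span_induct_alt)
  case base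
  then show ?case using L2_zero by (simp add: zero_fun_def)
next
  case (step c x y)
  then show ?case
    using L2_add(1)[OF L2_scale(1)[of x \<P> c] step(2)] by (simp add: few_coords_def scale_fun_def plus_fun_def)
qed

lemma U2_le_add:
  assumes "f \<in> U2_le M k" "g \<in> U2_le M k"
  shows "(\<lambda>x. f x + g x) \<in> U2_le M k"
  unfolding U2_le_iff
proof (intro conjI allI impI)
  show "(\<lambda>x. f x + g x) \<in> L2 \<P>" using assms by (auto simp: U2_le_iff intro: L2_add)
  fix e :: real assume "0 < e"
  then have "0 < e / 2" by simp
  obtain u where u: "u \<in> fun_vs.span (few_coords k)" "sq_mean \<P> (\<lambda>x. f x - u x) < (e / 2)\<^sup>2"
    by (rule U2_le_approx[OF assms(1) \<open>0 < e / 2\<close>])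
  obtain v where v: "v \<in> fun_vs.span (few_coords k)" "sq_mean \<P> (\<lambda>x. g x - v x) < (e / 2)\<^sup>2"
    by (rule U2_le_approx[OF assms(2) \<open>0 < e / 2\<close>])
  have L: "(\<lambda>x. f x - u x) \<in> L2 \<P>" "(\<lambda>x. g x - v x) \<in> L2 \<P>"
    by (intro L2_diff(1) U2_le_L2[OF assms(1)] U2_le_L2[OF assms(2)] span_few_coords_L2[OF u(1)] span_few_coords_L2[OF v(1)])+
  have "sq_mean \<P> (\<lambda>x. f x + g x - (u + v) x) = sq_mean \<P> (\<lambda>x. (f x - u x) + (g x - v x))"
    by (simp add: algebra_simps)
  also have "\<dots> \<le> 2 * sq_mean \<P> (\<lambda>x. f x - u x) + 2 * sq_mean \<P> (\<lambda>x. g x - v x)"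
    by (rule L2_add(2)[OF L])
  also have "\<dots> < e\<^sup>2" using u v by (simp add: power_divide)
  finally show "\<exists>h\<in>fun_vs.span (few_coords k). sq_mean \<P> (\<lambda>x. f x + g x - h x) < e\<^sup>2"
    using fun_vs.span_add[OF u(1) v(1)] by blast
qed

lemma U2_le_scale:
  assumes "f \<in> U2_le M k"
  shows "(\<lambda>x. c * f x) \<in> U2_le M k"
  unfolding U2_le_iff
proof (intro conjI allI impI)
  show "(\<lambda>x. c * f x) \<in> L2 \<P>" using assms by (auto simp: U2_le_iff intro: L2_scale)
  fix e :: real assume "0 < e"
  then have "0 < e / (norm c + 1)" by (simp add: add_nonneg_pos)
  then obtain u where u: "u \<in> fun_vs.span (few_coords k)" "sq_mean \<P> (\<lambda>x. f x - u x) < (e / (norm c + 1))\<^sup>2"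
    by (rule U2_le_approx[OF assms])
  have L: "(\<lambda>x. f x - u x) \<in> L2 \<P>"
    by (intro L2_diff(1) U2_le_L2[OF assms] span_few_coords_L2[OF u(1)])
  have "sq_mean \<P> (\<lambda>x. c * f x - scale_fun c u x) = (norm c)\<^sup>2 * sq_mean \<P> (\<lambda>x. f x - u x)"
    using L2_scale(2)[OF L, of c] by (simp add: scale_fun_def right_diff_distrib)
  also have "\<dots> \<le> (norm c + 1)\<^sup>2 * sq_mean \<P> (\<lambda>x. f x - u x)"
    by (intro mult_right_mono power_mono sq_mean_nonneg) auto
  also have "\<dots> < (norm c + 1)\<^sup>2 * (e / (norm c + 1))\<^sup>2"
  proof (rule mult_strict_left_mono[OF u(2)])
    show "0 < (norm c + 1)\<^sup>2" using norm_ge_zero[of c] by (intro zero_less_power) linarith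
  qed
  also have "\<dots> = e\<^sup>2"
  proof -
    have "norm c + 1 \<noteq> 0" using norm_ge_zero[of c] by linarith
    then show ?thesis by (simp add: power_divide)
  qed
  finally show "\<exists>h\<in>fun_vs.span (few_coords k). sq_mean \<P> (\<lambda>x. c * f x - h x) < e\<^sup>2"
    using fun_vs.span_scale[OF u(1)] by blast
qed

lemma few_coords_U2_le: "f \<in> few_coords k \<Longrightarrow> f \<in> U2_le M k"
  unfolding U2_le_iff
  by (auto simp: few_coords_def sq_mean_def intro!: bexI[of _ f] fun_vs.span_base)

lemma U2_U2_le: "f \<in> U2 M m \<Longrightarrow> f \<in> U2_le M m"
  by (cases m) auto

lemma U2_L2: "f \<in> U2 M m \<Longrightarrow> f \<in> L2 \<P>"
  using U2_U2_le by (auto simp: U2_le_iff)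

lemma U2_add:
  assumes "f \<in> U2 M m" "g \<in> U2 M m"
  shows "(\<lambda>x. f x + g x) \<in> U2 M m"
proof (cases m)
  case 0
  then show ?thesis using assms U2_le_add by simp
next
  case (Suc k)
  have "L2_orthogonal \<P> (\<lambda>x. f x + g x) h" if h: "h \<in> U2_le M k" for h
    unfolding L2_orthogonal_def
  proof
    fix c
    have "f \<in> L2 \<P>" "g \<in> L2 \<P>" "h \<in> L2 \<P>"
      using assms U2_L2 h by (auto simp: U2_le_iff)
    then have "(\<integral>x. inner (c * (f x + g x)) (h x) \<partial>\<P>) = (\<integral>x. inner (c * f x) (h x) \<partial>\<P>) + (\<integral>x. inner (c * g x) (h x) \<partial>\<P>)"
      by (simp add: distrib_left inner_add_left integrable_inner_L2 L2_scale)
    then show "(\<integral>x. inner (c * (f x + g x)) (h x) \<partial>\<P>) = 0"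
      using assms h Suc by (simp add: L2_orthogonal_def)
  qed
  then show ?thesis using assms Suc U2_le_add[of f "Suc k" g] by simp
qed

lemma U2_scale:
  assumes "f \<in> U2 M m"
  shows "(\<lambda>x. c * f x) \<in> U2 M m"
proof (cases m)
  case 0
  then show ?thesis using assms U2_le_scale by simp
next
  case (Suc k)
  have "L2_orthogonal \<P> (\<lambda>x. c * f x) h" if "h \<in> U2_le M k" for h
    using assms that Suc by (simp add: L2_orthogonal_def mult.assoc[symmetric])
  then show ?thesis using assms Suc U2_le_scale[of f "Suc k" c] by simp
qed

lemma U2_zero: "(\<lambda>x. 0) \<in> U2 M m"
proof -
  have "(\<lambda>x. 0) \<in> few_coords k" for k
    unfolding few_coords_def by (auto simp: L2_zero depends_on_def intro!: exI[of _ "{}"])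
  then have *: "(\<lambda>x. 0) \<in> U2_le M k" for k by (rule few_coords_U2_le)
  show ?thesis by (cases m) (auto simp: * L2_orthogonal_def)
qed

lemma U2_sum: "(\<And>i. i \<in> I \<Longrightarrow> f i \<in> U2 M m) \<Longrightarrow> (\<lambda>x. \<Sum>i\<in>I. f i x) \<in> U2 M m"
  by (induction I rule: infinite_finite_induct) (auto intro: U2_zero U2_add)

end

context code_space
begin

text \<open>
  A function of at most \<open>k\<close> coordinates misses one of the more than \<open>k\<close> coordinates in \<open>A\<close>. The factor
  \<open>c\<close> makes the statement stable under multiplication by scalars.
\<close>

lemma orthogonal_span:
  fixes f :: "(nat \<Rightarrow> 'a) \<Rightarrow> 'k::{real_normed_field, euclidean_space}"
  assumes f: "f \<in> fun_vs.span (few_coords k)" and S: "centered A S" "A \<subseteq> {..<N}" "k < card A"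
  shows "(\<integral>x. inner (c * f x) (S (encode x)) \<partial>\<P>) = 0"
proof -
  have "f \<in> L2 \<P> \<and> (\<forall>c. (\<integral>x. inner (c * f x) (S (encode x)) \<partial>\<P>) = 0)" using f
  proof (induction rule: fun_vs.span_induct_alt)
    case base
    then show ?case using L2_zero by (simp add: zero_fun_def)
  next
    case (step a g h)
    have g: "g \<in> L2 \<P>" using step by (simp add: few_coords_def)
    have h: "h \<in> L2 \<P>" using step by simp
    obtain D where D: "finite D" "card D \<le> k" "depends_on \<P> D g"
      using step by (auto simp: few_coords_def)
    have "\<not> A \<subseteq> D" using D S card_mono[of D A] by auto
    then obtain i where i: "i \<in> A" "i \<notin> D" by auto
    have g0: "(\<integral>x. inner (c * g x) (S (encode x)) \<partial>\<P>) = 0" for c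
    proof (rule orthogonal_free)
      show "(\<lambda>x. c * g x) \<in> L2 \<P>" using g by (rule L2_scale)
      show "depends_on \<P> D (\<lambda>x. c * g x)" using D(3) unfolding depends_on_def by metis
    qed (use i S in \<open>auto simp: centered_def\<close>)
    show ?case
    proof (intro conjI allI)
      show "scale_fun a g + h \<in> L2 \<P>"
        using L2_add(1)[OF L2_scale(1)[OF g, of a] h] by (simp add: scale_fun_def plus_fun_def)
      fix c
      have "(\<integral>x. inner (c * (scale_fun a g + h) x) (S (encode x)) \<partial>\<P>) =
          (\<integral>x. inner (c * a * g x) (S (encode x)) + inner (c * h x) (S (encode x)) \<partial>\<P>)"
        by (simp add: scale_fun_def distrib_left inner_add_left mult.assoc)
      also have "\<dots> = (\<integral>x. inner (c * a * g x) (S (encode x)) \<partial>\<P>) + (\<integral>x. inner (c * h x) (S (encode x)) \<partial>\<P>)"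
        by (intro Bochner_Integration.integral_add integrable_inner_L2 L2_scale g h encode_L2)
      also have "\<dots> = 0" using g0[of "c * a"] step by simp
      finally show "(\<integral>x. inner (c * (scale_fun a g + h) x) (S (encode x)) \<partial>\<P>) = 0" .
    qed
  qed
  then show ?thesis by simp
qed

lemma orthogonal_U2_le:
  fixes f :: "(nat \<Rightarrow> 'a) \<Rightarrow> 'k::{real_normed_field, euclidean_space}"
  assumes f: "f \<in> U2_le M k" and S: "centered A S" "A \<subseteq> {..<N}" "k < card A"
  shows "(\<integral>x. inner (f x) (S (encode x)) \<partial>\<P>) = 0"
proof -
  define B where "B = (\<Sum>c\<in>words. norm (S c)) + 1"
  have B: "norm (S (encode x)) \<le> B" "0 < B" for x
    using member_le_sum[of "encode x" words "\<lambda>c. norm (S c)"] encode_words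
      sum_nonneg[of words "\<lambda>c. norm (S c)"]
    by (auto simp: B_def intro: add_increasing2 add_nonneg_pos)
  have "\<bar>\<integral>x. inner (f x) (S (encode x)) \<partial>\<P>\<bar> \<le> e" if "0 < e" for e
  proof -
    have "0 < e / B" using that B by simp
    then obtain g where g: "g \<in> fun_vs.span (few_coords k)" "sq_mean \<P> (\<lambda>x. f x - g x) < (e / B)\<^sup>2"
      by (rule U2_le_approx[OF f])
    have fL: "f \<in> L2 \<P>" "g \<in> L2 \<P>" using f g span_few_coords_L2 by (auto simp: U2_le_iff)
    then have L: "(\<lambda>x. f x - g x) \<in> L2 \<P>" by (rule L2_diff)
    have "(\<integral>x. inner (f x) (S (encode x)) \<partial>\<P>) =
        (\<integral>x. inner (f x) (S (encode x)) \<partial>\<P>) - (\<integral>x. inner (1 * g x) (S (encode x)) \<partial>\<P>)"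
      using orthogonal_span[OF g(1) S, of 1] by simp
    also have "\<dots> = (\<integral>x. inner (f x - g x) (S (encode x)) \<partial>\<P>)"
      using fL by (simp add: inner_diff_left integrable_inner_L2 encode_L2)
    finally have "\<bar>\<integral>x. inner (f x) (S (encode x)) \<partial>\<P>\<bar> = \<bar>\<integral>x. inner (f x - g x) (S (encode x)) \<partial>\<P>\<bar>"
      by simp
    also have "\<dots> \<le> (\<integral>x. \<bar>inner (f x - g x) (S (encode x))\<bar> \<partial>\<P>)"
      by (rule integral_abs_bound)
    also have "\<dots> \<le> (\<integral>x. B * norm (f x - g x) \<partial>\<P>)"
    proof (intro integral_mono)
      show "integrable \<P> (\<lambda>x. \<bar>inner (f x - g x) (S (encode x))\<bar>)"
        by (intro integrable_abs integrable_inner_L2 L encode_L2)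
      show "integrable \<P> (\<lambda>x. B * norm (f x - g x))"
        using power.L2_integrable(1)[OF L] by simp
      fix x
      have "\<bar>inner (f x - g x) (S (encode x))\<bar> \<le> norm (f x - g x) * norm (S (encode x))"
        by (rule Cauchy_Schwarz_ineq2)
      also have "\<dots> \<le> norm (f x - g x) * B" by (intro mult_left_mono B) auto
      finally show "\<bar>inner (f x - g x) (S (encode x))\<bar> \<le> B * norm (f x - g x)" by (simp add: mult.commute)
    qed
    also have "\<dots> \<le> B * L2_norm \<P> (\<lambda>x. f x - g x)"
      using power.L2_integrable(2)[OF L] B by simp
    also have "\<dots> \<le> B * (e / B)"
      using g(2) B \<open>0 < e / B\<close> L2_norm_less_iff[of "e / B" \<P> "\<lambda>x. f x - g x"]
      by (intro mult_left_mono) auto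
    also have "\<dots> = e" using B by simp
    finally show ?thesis .
  qed
  then have "\<bar>\<integral>x. inner (f x) (S (encode x)) \<partial>\<P>\<bar> \<le> 0"
    by (rule field_le_epsilon) simp
  then show ?thesis by simp
qed

lemma centered_mult:
  fixes S :: "(nat \<Rightarrow> nat) \<Rightarrow> 'k::real_normed_field"
  assumes "centered A S" shows "centered A (\<lambda>w. c * S w)"
proof -
  have "avg i (\<lambda>w. c * S w) x = c * avg i S x" for i x
    by (simp add: avg_def sum_distrib_left)
  then show ?thesis
    using assms by (auto simp: centered_def intro: determined_comp)
qed

lemma centered_few_coords:
  fixes S :: "(nat \<Rightarrow> nat) \<Rightarrow> 'k::{real_normed_field, euclidean_space}"
  assumes "centered A S" "A \<subseteq> {..<N}" "card A \<le> k"
  shows "(\<lambda>x. S (encode x)) \<in> few_coords k"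
proof -
  have "depends_on \<P> A (\<lambda>x. S (encode x))"
    unfolding depends_on_def
  proof (intro ballI impI)
    fix x y :: "nat \<Rightarrow> 'a" assume "\<forall>i\<in>A. x i = y i"
    then have "agree A (encode x) (encode y)"
      using assms(2) by (auto simp: agree_def encode_def)
    then show "S (encode x) = S (encode y)"
      using assms(1) by (intro determinedD[of A S]) (auto simp: centered_def encode_words)
  qed
  then show ?thesis
    using assms finite_subset[OF assms(2)] by (auto simp: few_coords_def encode_L2)
qed

lemma centered_U2:
  fixes S :: "(nat \<Rightarrow> nat) \<Rightarrow> 'k::{real_normed_field, euclidean_space}"
  assumes "centered A S" "A \<subseteq> {..<N}" "card A = m"
  shows "(\<lambda>x. S (encode x)) \<in> U2 M m"
proof -
  have le: "(\<lambda>x. S (encode x)) \<in> U2_le M m"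
    using assms by (intro few_coords_U2_le centered_few_coords) auto
  show ?thesis
  proof (cases m)
    case 0
    then show ?thesis using le by simp
  next
    case (Suc k)
    have "L2_orthogonal \<P> (\<lambda>x. S (encode x)) g" if "g \<in> U2_le M k" for g
      unfolding L2_orthogonal_def
      using orthogonal_U2_le[OF that centered_mult[OF assms(1)] assms(2)] assms(3) Suc
      by (simp add: inner_commute)
    then show ?thesis using le Suc by simp
  qed
qed

lemma homogeneous_U2:
  fixes H :: "nat set \<Rightarrow> (nat \<Rightarrow> nat) \<Rightarrow> 'k::{real_normed_field, euclidean_space}"
  assumes "\<And>A. A \<in> constituents N m \<Longrightarrow> centered A (H A)"
  shows "(\<lambda>x. \<Sum>A\<in>constituents N m. H A (encode x)) \<in> U2 M m"
  using assms by (intro U2_sum centered_U2) (auto simp: constituents_def)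

text \<open>
  The constituents of \<open>F\<close> of a degree other than \<open>m\<close> are orthogonal to \<open>g\<close>: those of higher degree by
  \<open>orthogonal_U2_le\<close>, those of lower degree by the definition of \<open>U2\<close>. Since they are orthogonal to the
  constituents of degree \<open>m\<close> as well, dropping them cannot increase the distance to \<open>g\<close>.
\<close>

lemma homogeneous_part:
  fixes g :: "(nat \<Rightarrow> 'a) \<Rightarrow> 'k::{real_normed_field, euclidean_space}" and F :: "(nat \<Rightarrow> nat) \<Rightarrow> 'k"
  assumes g: "g \<in> U2 M m"
  obtains H where "\<And>A. A \<in> constituents N m \<Longrightarrow> centered A (H A)"
    and "sq_mean \<P> (\<lambda>x. g x - (\<Sum>A\<in>constituents N m. H A (encode x))) \<le> sq_mean \<P> (\<lambda>x. g x - F (encode x))"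
proof -
  obtain H where H: "\<And>A. A \<subseteq> {..<N} \<Longrightarrow> centered A (H A)"
    and F: "\<And>x. x \<in> words \<Longrightarrow> F x = (\<Sum>A\<in>Pow {..<N}. H A x)"
    using hoeffding[of F] by auto
  define s where "s x = (\<Sum>A\<in>constituents N m. H A (encode x))" for x
  define R where "R = Pow {..<N} - constituents N m"
  define r where "r x = (\<Sum>A\<in>R. H A (encode x))" for x
  have finR: "finite R" by (simp add: R_def)
  have sub: "constituents N m \<subseteq> Pow {..<N}" by (auto simp: constituents_def)
  have Fsr: "F (encode x) = s x + r x" for x
    unfolding s_def r_def R_def F[OF encode_words]
    using sub by (simp add: sum.subset_diff[of "constituents N m" "Pow {..<N}"] add.commute)
  have L: "s \<in> L2 \<P>" "r \<in> L2 \<P>" "g \<in> L2 \<P>"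
    unfolding s_def r_def using g U2_L2 by (auto intro!: L2_sum encode_L2)
  have gr: "(\<integral>x. inner (g x) (H A (encode x)) \<partial>\<P>) = 0" if "A \<in> R" for A
  proof -
    have A: "A \<subseteq> {..<N}" "card A \<noteq> m" using that by (auto simp: R_def constituents_def)
    show ?thesis
    proof (cases "m < card A")
      case True
      then show ?thesis using orthogonal_U2_le[OF U2_U2_le[OF g] H[OF A(1)] A(1)] by simp
    next
      case False
      then obtain k where k: "m = Suc k" "card A \<le> k" using A(2) by (cases m) auto
      have "(\<lambda>x. H A (encode x)) \<in> U2_le M k"
        by (intro few_coords_U2_le centered_few_coords[OF H[OF A(1)] A(1) k(2)])
      then have "L2_orthogonal \<P> g (\<lambda>x. H A (encode x))"
        using g k by simp
      then have "(\<integral>x. inner (1 * g x) (H A (encode x)) \<partial>\<P>) = 0"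
        unfolding L2_orthogonal_def by (rule spec)
      then show ?thesis by simp
    qed
  qed
  have sr: "(\<integral>x. inner (H B (encode x)) (H A (encode x)) \<partial>\<P>) = 0" if "A \<in> R" "B \<in> constituents N m" for A B
  proof -
    have "mean (\<lambda>c. inner (H B c) (H A c)) = 0"
      using that by (intro mean_inner_centered[of B _ A] H) (auto simp: R_def constituents_def)
    then show ?thesis using integral_encode[of "\<lambda>c. inner (H B c) (H A c)"] by simp
  qed
  have "(\<integral>x. inner (g x - s x) (r x) \<partial>\<P>) = (\<Sum>A\<in>R. \<integral>x. inner (g x - s x) (H A (encode x)) \<partial>\<P>)"
    unfolding r_def inner_sum_right
    using L by (intro Bochner_Integration.integral_sum integrable_inner_L2 L2_diff encode_L2)
  also have "\<dots> = 0"
  proof (intro sum.neutral ballI)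
    fix A assume A: "A \<in> R"
    have "(\<integral>x. inner (s x) (H A (encode x)) \<partial>\<P>) = (\<Sum>B\<in>constituents N m. \<integral>x. inner (H B (encode x)) (H A (encode x)) \<partial>\<P>)"
      unfolding s_def inner_sum_left
      by (intro Bochner_Integration.integral_sum integrable_inner_L2 encode_L2)
    also have "\<dots> = 0" using sr[OF A] by simp
    finally show "(\<integral>x. inner (g x - s x) (H A (encode x)) \<partial>\<P>) = 0"
      using gr[OF A] L by (simp add: inner_diff_left integrable_inner_L2 encode_L2)
  qed
  finally have orth: "(\<integral>x. inner (g x - s x) (r x) \<partial>\<P>) = 0" .
  have D: "(\<lambda>x. g x - s x) \<in> L2 \<P>" by (rule L2_diff(1)[OF L(3,1)])
  have "(norm (g x - F (encode x)))\<^sup>2 = (norm (g x - s x))\<^sup>2 - 2 * inner (g x - s x) (r x) + (norm (r x))\<^sup>2" for x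
    unfolding Fsr by (simp add: power2_norm_eq_inner algebra_simps inner_commute)
  then have "sq_mean \<P> (\<lambda>x. g x - F (encode x)) =
      (\<integral>x. (norm (g x - s x))\<^sup>2 - 2 * inner (g x - s x) (r x) + (norm (r x))\<^sup>2 \<partial>\<P>)"
    by (simp add: sq_mean_def)
  also have "\<dots> = sq_mean \<P> (\<lambda>x. g x - s x) - 2 * (\<integral>x. inner (g x - s x) (r x) \<partial>\<P>) + sq_mean \<P> r"
    using integrable_inner_L2[OF D L(2)] D L(2) by (simp add: sq_mean_def L2_def)
  finally have "sq_mean \<P> (\<lambda>x. g x - s x) \<le> sq_mean \<P> (\<lambda>x. g x - F (encode x))"
    using orth sq_mean_nonneg[of \<P> r] by simp
  then show thesis
    using that[of H] H by (auto simp: s_def constituents_def)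
qed

end

context power_space
begin

abbreviation enc :: "('a \<Rightarrow> nat) \<Rightarrow> nat \<Rightarrow> (nat \<Rightarrow> 'a) \<Rightarrow> nat \<Rightarrow> nat" where
  "enc q N x \<equiv> code_space.encode q N x"

lemma code_space_axiom: "finite_code q \<Longrightarrow> code_space M q"
  by unfold_locales

text \<open>
  Two codes have a common refinement, by pairing the letters.
\<close>

lemma refine_codes:
  assumes "finite_code q1" "finite_code q2"
  obtains q N where "finite_code q"
    and "\<forall>F :: (nat \<Rightarrow> nat) \<Rightarrow> 'b. \<exists>G. \<forall>x. F (enc q1 N1 x) = G (enc q N x)"
    and "\<forall>F :: (nat \<Rightarrow> nat) \<Rightarrow> 'b. \<exists>G. \<forall>x. F (enc q2 N2 x) = G (enc q N x)"
proof -
  define q where "q a = prod_encode (q1 a, q2 a)" for a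
  define N where "N = max N1 N2"
  interpret c1: code_space M q1 N1 using assms by unfold_locales
  interpret c2: code_space M q2 N2 using assms by unfold_locales
  have "finite_code q"
    unfolding finite_code_def
  proof
    have "q = (\<lambda>a. prod_encode (q1 a, q2 a))" by (simp add: q_def fun_eq_iff)
    moreover have "(\<lambda>a. prod_encode (q1 a, q2 a)) \<in> measurable M (count_space UNIV)"
      by measurable
    ultimately show "q \<in> measurable M (count_space UNIV)" by simp
    have "range q \<subseteq> prod_encode ` (range q1 \<times> range q2)" by (auto simp: q_def)
    then show "finite (range q)"
      by (rule finite_subset) (intro finite_imageI finite_cartesian_product c1.finite_range_q c2.finite_range_q)
  qed
  then interpret c: code_space M q N by unfold_locales
  have 1: "c1.encode x = restrict (\<lambda>i. fst (prod_decode (c.encode x i))) {..<N1}" for x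
    unfolding c1.encode_def c.encode_def by (auto simp: q_def N_def fun_eq_iff)
  have 2: "c2.encode x = restrict (\<lambda>i. snd (prod_decode (c.encode x i))) {..<N2}" for x
    unfolding c2.encode_def c.encode_def by (auto simp: q_def N_def fun_eq_iff)
  show thesis
  proof (rule that[OF \<open>finite_code q\<close>]; intro allI)
    fix F :: "(nat \<Rightarrow> nat) \<Rightarrow> 'b"
    show "\<exists>G. \<forall>x. F (c1.encode x) = G (c.encode x)"
      by (rule exI[of _ "\<lambda>z. F (restrict (\<lambda>i. fst (prod_decode (z i))) {..<N1})"]) (simp add: 1)
    show "\<exists>G. \<forall>x. F (c2.encode x) = G (c.encode x)"
      by (rule exI[of _ "\<lambda>z. F (restrict (\<lambda>i. snd (prod_decode (z i))) {..<N2})"]) (simp add: 2)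
  qed
qed

definition cyl_approx :: "((nat \<Rightarrow> 'a) \<Rightarrow> 'k::{real_normed_field, euclidean_space}) \<Rightarrow> bool" where
  "cyl_approx f \<longleftrightarrow> f \<in> L2 \<P> \<and>
     (\<forall>e>0. \<exists>q N F. finite_code q \<and> sq_mean \<P> (\<lambda>x. f x - F (enc q N x)) < e)"

lemma enc_L2:
  assumes "finite_code q" shows "(\<lambda>x. F (enc q N x)) \<in> L2 \<P>"
proof -
  interpret code_space M q N using assms by unfold_locales
  show ?thesis by (rule encode_L2)
qed

lemma cyl_approxE:
  assumes "cyl_approx f" "0 < e"
  obtains q N F where "finite_code q" "sq_mean \<P> (\<lambda>x. f x - F (enc q N x)) < e"
  using assms unfolding cyl_approx_def by blast

lemma cyl_approx_add:
  fixes f g :: "(nat \<Rightarrow> 'a) \<Rightarrow> 'k::{real_normed_field, euclidean_space}"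
  assumes f: "cyl_approx f" and g: "cyl_approx g"
  shows "cyl_approx (\<lambda>x. f x + g x)"
  unfolding cyl_approx_def
proof (intro conjI allI impI)
  have L: "f \<in> L2 \<P>" "g \<in> L2 \<P>" using assms by (auto simp: cyl_approx_def)
  then show "(\<lambda>x. f x + g x) \<in> L2 \<P>" by (rule L2_add)
  fix e :: real assume "0 < e"
  then have "0 < e / 4" by simp
  obtain q1 N1 F1 where 1: "finite_code q1" "sq_mean \<P> (\<lambda>x. f x - F1 (enc q1 N1 x)) < e / 4"
    by (rule cyl_approxE[OF f \<open>0 < e / 4\<close>])
  obtain q2 N2 F2 where 2: "finite_code q2" "sq_mean \<P> (\<lambda>x. g x - F2 (enc q2 N2 x)) < e / 4"
    by (rule cyl_approxE[OF g \<open>0 < e / 4\<close>])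
  obtain q N where q: "finite_code q"
    and ex1: "\<forall>F :: (nat \<Rightarrow> nat) \<Rightarrow> 'k. \<exists>G. \<forall>x. F (enc q1 N1 x) = G (enc q N x)"
    and ex2: "\<forall>F :: (nat \<Rightarrow> nat) \<Rightarrow> 'k. \<exists>G. \<forall>x. F (enc q2 N2 x) = G (enc q N x)"
    by (rule refine_codes[OF 1(1) 2(1)])
  obtain G1 where G1: "\<And>x. F1 (enc q1 N1 x) = G1 (enc q N x)" using spec[OF ex1, of F1] by auto
  obtain G2 where G2: "\<And>x. F2 (enc q2 N2 x) = G2 (enc q N x)" using spec[OF ex2, of F2] by auto
  have "sq_mean \<P> (\<lambda>x. f x + g x - (G1 (enc q N x) + G2 (enc q N x))) =
      sq_mean \<P> (\<lambda>x. (f x - G1 (enc q N x)) + (g x - G2 (enc q N x)))"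
    by (simp add: algebra_simps)
  also have "\<dots> \<le> 2 * sq_mean \<P> (\<lambda>x. f x - G1 (enc q N x)) + 2 * sq_mean \<P> (\<lambda>x. g x - G2 (enc q N x))"
    by (intro L2_add(2) L2_diff(1) L enc_L2 q)
  also have "\<dots> < e" using 1 2 by (simp add: G1 G2)
  finally show "\<exists>q N F. finite_code q \<and> sq_mean \<P> (\<lambda>x. f x + g x - F (enc q N x)) < e"
    using q by (intro exI[of _ q] exI[of _ N] exI[of _ "\<lambda>z. G1 z + G2 z"]) auto
qed

lemma cyl_approx_minus:
  assumes f: "cyl_approx f"
  shows "cyl_approx (\<lambda>x. - f x)"
  unfolding cyl_approx_def
proof (intro conjI allI impI)
  show "(\<lambda>x. - f x) \<in> L2 \<P>"
    using L2_scale(1)[of f \<P> "-1"] f by (simp add: cyl_approx_def)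
  fix e :: real assume "0 < e"
  obtain q N F where 1: "finite_code q" "sq_mean \<P> (\<lambda>x. f x - F (enc q N x)) < e"
    by (rule cyl_approxE[OF f \<open>0 < e\<close>])
  have "sq_mean \<P> (\<lambda>x. - f x - - F (enc q N x)) = sq_mean \<P> (\<lambda>x. f x - F (enc q N x))"
    unfolding sq_mean_def by (simp add: norm_minus_commute)
  then show "\<exists>q N F. finite_code q \<and> sq_mean \<P> (\<lambda>x. - f x - F (enc q N x)) < e"
    using 1 by (intro exI[of _ q] exI[of _ N] exI[of _ "\<lambda>z. - F z"]) auto
qed

lemma cyl_approx_limit:
  assumes f: "f \<in> L2 \<P>" and g: "\<And>e. 0 < e \<Longrightarrow> \<exists>g. cyl_approx g \<and> sq_mean \<P> (\<lambda>x. f x - g x) < e"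
  shows "cyl_approx f"
  unfolding cyl_approx_def
proof (intro conjI allI impI f)
  fix e :: real assume "0 < e"
  then have "0 < e / 4" by simp
  obtain g where 1: "cyl_approx g" "sq_mean \<P> (\<lambda>x. f x - g x) < e / 4"
    using assms(2)[OF \<open>0 < e / 4\<close>] by blast
  obtain q N F where 2: "finite_code q" "sq_mean \<P> (\<lambda>x. g x - F (enc q N x)) < e / 4"
    by (rule cyl_approxE[OF 1(1) \<open>0 < e / 4\<close>])
  have L: "g \<in> L2 \<P>" using 1 by (simp add: cyl_approx_def)
  have "sq_mean \<P> (\<lambda>x. f x - F (enc q N x)) = sq_mean \<P> (\<lambda>x. (f x - g x) + (g x - F (enc q N x)))"
    by simp
  also have "\<dots> \<le> 2 * sq_mean \<P> (\<lambda>x. f x - g x) + 2 * sq_mean \<P> (\<lambda>x. g x - F (enc q N x))"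
    by (intro L2_add(2) L2_diff(1) f L enc_L2 2)
  also have "\<dots> < e" using 1 2 by simp
  finally show "\<exists>q N F. finite_code q \<and> sq_mean \<P> (\<lambda>x. f x - F (enc q N x)) < e"
    using 2(1) by blast
qed

lemma cyl_approx_exact:
  assumes "finite_code q" "f \<in> L2 \<P>" "\<And>x. x \<in> space \<P> \<Longrightarrow> f x = F (enc q N x)"
  shows "cyl_approx f"
  unfolding cyl_approx_def
proof (intro conjI allI impI assms)
  fix e :: real assume "0 < e"
  have "sq_mean \<P> (\<lambda>x. f x - F (enc q N x)) = (\<integral>x. 0 \<partial>\<P>)"
    unfolding sq_mean_def by (intro Bochner_Integration.integral_cong) (auto simp: assms(3))
  then show "\<exists>q N F. finite_code q \<and> sq_mean \<P> (\<lambda>x. f x - F (enc q N x)) < e"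
    using assms \<open>0 < e\<close> by (intro exI[of _ q] exI[of _ N] exI[of _ F]) auto
qed

lemma cyl_approx_cong:
  assumes "cyl_approx f" "\<And>x. x \<in> space \<P> \<Longrightarrow> f x = g x"
  shows "cyl_approx g"
proof (rule cyl_approx_limit)
  have f: "f \<in> L2 \<P>" using assms by (simp add: cyl_approx_def)
  have "g \<in> borel_measurable \<P> \<longleftrightarrow> f \<in> borel_measurable \<P>"
    using assms(2) by (intro measurable_cong) simp
  moreover have "integrable \<P> (\<lambda>x. (norm (g x))\<^sup>2) \<longleftrightarrow> integrable \<P> (\<lambda>x. (norm (f x))\<^sup>2)"
    using assms(2) by (intro Bochner_Integration.integrable_cong) auto
  ultimately show "g \<in> L2 \<P>" using f by (simp add: L2_def)
  fix e :: real assume "0 < e"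
  have "sq_mean \<P> (\<lambda>x. g x - f x) = (\<integral>x. 0 \<partial>\<P>)"
    unfolding sq_mean_def by (intro Bochner_Integration.integral_cong) (auto simp: assms(2))
  then show "\<exists>h. cyl_approx h \<and> sq_mean \<P> (\<lambda>x. g x - h x) < e"
    using assms(1) \<open>0 < e\<close> by auto
qed

lemma cyl_approx_const: "cyl_approx (\<lambda>x. v)"
proof (rule cyl_approx_exact[where q = "\<lambda>_. 0" and F = "\<lambda>_. v"])
  show "finite_code (\<lambda>_. 0)" by (simp add: finite_code_def)
qed (simp_all add: L2_def)

lemma cyl_approx_sum:
  "(\<And>i. i \<in> I \<Longrightarrow> cyl_approx (f i)) \<Longrightarrow> cyl_approx (\<lambda>x. \<Sum>i\<in>I. f i x)"
  by (induction I rule: infinite_finite_induct) (auto intro: cyl_approx_const cyl_approx_add)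

lemma indicator_L2:
  assumes "E \<in> sets \<P>" shows "(\<lambda>x. indicator E x *\<^sub>R v) \<in> L2 \<P>"
proof -
  have "(norm (indicator E x *\<^sub>R v))\<^sup>2 = indicator E x * (norm v)\<^sup>2" for x
    by (simp add: indicator_def)
  moreover have "integrable \<P> (\<lambda>x. indicator E x * (norm v)\<^sup>2)"
    using assms by (intro integrable_mult_left) (simp add: power.emeasure_eq_measure)
  ultimately show ?thesis using assms by (simp add: L2_def)
qed

lemma pattern_measurable:
  assumes "finite J" "\<And>j. j \<in> J \<Longrightarrow> E j \<in> sets M"
  shows "(\<lambda>a. set_encode {j \<in> J. a \<in> E j}) \<in> measurable M (count_space UNIV)"
  using assms
proof (induction J rule: finite_induct)
  case (insert i J)
  have "(\<lambda>a. set_encode {j \<in> insert i J. a \<in> E j}) =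
      (\<lambda>a. if a \<in> E i then 2 ^ i + set_encode {j \<in> J. a \<in> E j} else set_encode {j \<in> J. a \<in> E j})"
  proof
    fix a
    have "{j \<in> insert i J. a \<in> E j} = (if a \<in> E i then insert i {j \<in> J. a \<in> E j} else {j \<in> J. a \<in> E j})"
      by auto
    then show "set_encode {j \<in> insert i J. a \<in> E j} =
        (if a \<in> E i then 2 ^ i + set_encode {j \<in> J. a \<in> E j} else set_encode {j \<in> J. a \<in> E j})"
      using insert.hyps by simp
  qed
  moreover have "(\<lambda>a. if a \<in> E i then 2 ^ i + set_encode {j \<in> J. a \<in> E j} else set_encode {j \<in> J. a \<in> E j})
      \<in> measurable M (count_space UNIV)"
  proof -
    have IH: "(\<lambda>a. set_encode {j \<in> J. a \<in> E j}) \<in> measurable M (count_space UNIV)"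
      using insert by auto
    have "(\<lambda>a. 2 ^ i + set_encode {j \<in> J. a \<in> E j}) \<in> measurable M (count_space UNIV)"
      by (rule measurable_compose[OF IH]) simp
    moreover have "E i \<in> sets M" using insert by auto
    ultimately show ?thesis using IH by (intro measurable_If) auto
  qed
  ultimately show ?case by simp
qed simp

text \<open>
  The sets whose indicators are limits of cylinder functions form a Dynkin system that contains the
  finite-dimensional rectangles. For a rectangle the letter of a point records which of the finitely
  many sides contain it.
\<close>

lemma cyl_approx_indicator:
  assumes "E \<in> sets \<P>"
  shows "cyl_approx (\<lambda>x. indicator E x *\<^sub>R v)"
proof -
  let ?G = "prod_algebra UNIV (\<lambda>_::nat. M)" and ?\<Omega> = "PiE UNIV (\<lambda>_::nat. space M)"
  have sets: "sets \<P> = sigma_sets ?\<Omega> ?G"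
    by (simp add: infinite_power_def sets_PiM)
  have \<Omega>: "?\<Omega> = space \<P>" by (simp add: infinite_power_def space_PiM)
  have "E \<in> sigma_sets ?\<Omega> ?G" using assms sets by simp
  with Int_stable_prod_algebra prod_algebra_sets_into_space show ?thesis
  proof (induction rule: sigma_sets_induct_disjoint)
    case (basic A)
    obtain J E where A: "A = prod_emb UNIV (\<lambda>_. M) J (PiE J E)" and J: "finite J"
      and E: "\<And>j. j \<in> J \<Longrightarrow> E j \<in> sets M"
    proof (rule prod_algebraE[OF basic], goal_cases)
      case (1 J E)
      show ?case by (rule that) (fact 1)+
    qed
    have "A \<in> sets \<P>" using basic by (simp add: sets)
    define q where "q a = set_encode {j \<in> J. a \<in> E j}" for a
    obtain N where N: "J \<subseteq> {..<N}" using finite_nat_bounded[OF J] by blast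
    have q: "finite_code q"
      unfolding finite_code_def
    proof
      show "q \<in> measurable M (count_space UNIV)"
        using pattern_measurable[OF J E] by (simp add: q_def[abs_def])
      have "range q \<subseteq> set_encode ` Pow J" by (auto simp: q_def)
      then show "finite (range q)" by (rule finite_subset) (use J in simp)
    qed
    then interpret c: code_space M q N by unfold_locales
    show ?case
    proof (rule cyl_approx_exact[OF q, where F = "\<lambda>z. if \<forall>j\<in>J. j \<in> set_decode (z j) then v else 0" and N = N])
      show "(\<lambda>x. indicator A x *\<^sub>R v) \<in> L2 \<P>" by (rule indicator_L2[OF \<open>A \<in> sets \<P>\<close>])
      fix x assume x: "x \<in> space \<P>"
      have "j \<in> set_decode (c.encode x j) \<longleftrightarrow> x j \<in> E j" if "j \<in> J" for j
      proof -
        have "c.encode x j = set_encode {j' \<in> J. x j \<in> E j'}"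
          using that N unfolding c.encode_def by (auto simp: q_def)
        then show ?thesis using that J by simp
      qed
      moreover have "x \<in> A \<longleftrightarrow> (\<forall>j\<in>J. x j \<in> E j)"
        using x unfolding A prod_emb_def by (auto simp: space_power PiE_iff restrict_def extensional_def)
      ultimately show "indicator A x *\<^sub>R v = (if \<forall>j\<in>J. j \<in> set_decode (c.encode x j) then v else 0)"
        by (simp add: indicator_def)
    qed
  next
    case empty
    then show ?case using cyl_approx_const[of 0] by simp
  next
    case (compl A)
    have "cyl_approx (\<lambda>x. v + - (indicator A x *\<^sub>R v))"
      by (intro cyl_approx_add cyl_approx_minus cyl_approx_const compl.IH)
    then show ?case
      by (rule cyl_approx_cong) (auto simp: \<Omega> indicator_def)
  next
    case (union A)
    have meas: "A i \<in> sets \<P>" for i using union.hyps by (auto simp: sets)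
    then have U: "(\<Union>i. A i) \<in> sets \<P>" by auto
    show ?case
    proof (rule cyl_approx_limit[OF indicator_L2[OF U]])
      fix e :: real assume "0 < e"
      define h where "h n x = (\<Sum>i<n. indicator (A i) x *\<^sub>R v)" for n x
      have h: "cyl_approx (h n)" for n
        unfolding h_def by (intro cyl_approx_sum union.IH)
      have sums: "(\<lambda>i. indicator (A i) x :: real) sums indicator (\<Union>i. A i) x" for x
        using union.hyps by (intro indicator_sums) (auto simp: disjoint_family_on_def)
      have eq: "indicator (\<Union>i. A i) x *\<^sub>R v - h n x = (indicator (\<Union>i. A i) x - (\<Sum>i<n. indicator (A i) x)) *\<^sub>R v" for n x
        by (simp add: h_def scaleR_diff_left scaleR_sum_left)
      have "(\<lambda>n. sq_mean \<P> (\<lambda>x. indicator (\<Union>i. A i) x *\<^sub>R v - h n x)) \<longlonglongrightarrow> (\<integral>x. 0 \<partial>\<P>)"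
        unfolding sq_mean_def
      proof (rule integral_dominated_convergence[where w = "\<lambda>_. (norm v)\<^sup>2"])
        show "(\<lambda>x. (norm (indicator (\<Union>i. A i) x *\<^sub>R v - h n x))\<^sup>2) \<in> borel_measurable \<P>" for n
          unfolding h_def using U meas by measurable
        show "AE x in \<P>. (\<lambda>n. (norm (indicator (\<Union>i. A i) x *\<^sub>R v - h n x))\<^sup>2) \<longlonglongrightarrow> 0"
        proof (intro AE_I2)
          fix x
          have "(\<lambda>n. (norm ((indicator (\<Union>i. A i) x - (\<Sum>i<n. indicator (A i) x)) *\<^sub>R v))\<^sup>2) \<longlonglongrightarrow>
              (norm ((indicator (\<Union>i. A i) x - indicator (\<Union>i. A i) x) *\<^sub>R v))\<^sup>2"
            using sums[of x] unfolding sums_def by (intro tendsto_intros)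
          then show "(\<lambda>n. (norm (indicator (\<Union>i. A i) x *\<^sub>R v - h n x))\<^sup>2) \<longlonglongrightarrow> 0"
            by (simp add: eq)
        qed
        show "AE x in \<P>. norm ((norm (indicator (\<Union>i. A i) x *\<^sub>R v - h n x))\<^sup>2) \<le> (norm v)\<^sup>2" for n
        proof (intro AE_I2)
          fix x
          have "(\<Sum>i<n. indicator (A i) x :: real) \<le> indicator (\<Union>i. A i) x"
            using sum_le_suminf[OF sums_summable[OF sums[of x]], of "{..<n}"] sums_unique[OF sums[of x]] by simp
          moreover have "0 \<le> (\<Sum>i<n. indicator (A i) x :: real)" by (intro sum_nonneg) auto
          moreover have "indicator (\<Union>i. A i) x \<le> (1::real)" by (simp add: indicator_def)
          ultimately have "\<bar>indicator (\<Union>i. A i) x - (\<Sum>i<n. indicator (A i) x :: real)\<bar> \<le> 1" by linarith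
          then have "\<bar>indicator (\<Union>i. A i) x - (\<Sum>i<n. indicator (A i) x :: real)\<bar> * norm v \<le> 1 * norm v"
            by (rule mult_right_mono) simp
          then have "(norm (indicator (\<Union>i. A i) x *\<^sub>R v - h n x))\<^sup>2 \<le> (norm v)\<^sup>2"
            unfolding eq by (intro power_mono) auto
          then show "norm ((norm (indicator (\<Union>i. A i) x *\<^sub>R v - h n x))\<^sup>2) \<le> (norm v)\<^sup>2" by simp
        qed
      qed simp_all
      then have "eventually (\<lambda>n. sq_mean \<P> (\<lambda>x. indicator (\<Union>i. A i) x *\<^sub>R v - h n x) < e) sequentially"
        using \<open>0 < e\<close> by (intro order_tendstoD(2)) auto
      then obtain n where "sq_mean \<P> (\<lambda>x. indicator (\<Union>i. A i) x *\<^sub>R v - h n x) < e"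
        by (auto simp: eventually_sequentially)
      then show "\<exists>g. cyl_approx g \<and> sq_mean \<P> (\<lambda>x. indicator (\<Union>i. A i) x *\<^sub>R v - g x) < e"
        using h by blast
    qed
  qed
qed

lemma cyl_approx_simple:
  assumes "simple_function \<P> s"
  shows "cyl_approx s"
proof -
  have fin: "finite (s ` space \<P>)" and meas: "\<And>y. y \<in> s ` space \<P> \<Longrightarrow> s -` {y} \<inter> space \<P> \<in> sets \<P>"
    using assms by (auto simp: simple_function_def)
  have "cyl_approx (\<lambda>x. \<Sum>y\<in>s ` space \<P>. indicator (s -` {y} \<inter> space \<P>) x *\<^sub>R y)"
    by (intro cyl_approx_sum cyl_approx_indicator meas)
  then show ?thesis
  proof (rule cyl_approx_cong)
    fix x assume x: "x \<in> space \<P>"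
    have "(\<Sum>y\<in>s ` space \<P>. indicator (s -` {y} \<inter> space \<P>) x *\<^sub>R y) = (\<Sum>y\<in>s ` space \<P>. if y = s x then y else 0)"
      using x by (intro sum.cong) (auto simp: indicator_def)
    then show "(\<Sum>y\<in>s ` space \<P>. indicator (s -` {y} \<inter> space \<P>) x *\<^sub>R y) = s x"
      using fin x by simp
  qed
qed

text \<open>
  Simple functions are combinations of indicators, and they are dense by dominated convergence.
\<close>

lemma cyl_approx_L2:
  assumes f: "f \<in> L2 \<P>"
  shows "cyl_approx f"
proof (rule cyl_approx_limit[OF f])
  fix e :: real assume "0 < e"
  have [measurable]: "f \<in> borel_measurable \<P>" and int: "integrable \<P> (\<lambda>x. (norm (f x))\<^sup>2)"
    using f by (auto simp: L2_def)
  obtain s where s': "\<forall>i. simple_function \<P> (s i)"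
    "\<forall>x\<in>space \<P>. (\<lambda>i. s i x) \<longlonglongrightarrow> f x"
    "\<forall>i. \<forall>x\<in>space \<P>. norm (s i x) \<le> 2 * norm (f x)"
    using borel_measurable_implies_sequence_metric[of f \<P> 0] by (auto simp: dist_norm)
  then have s: "\<And>i. simple_function \<P> (s i)"
    and lim: "\<And>x. x \<in> space \<P> \<Longrightarrow> (\<lambda>i. s i x) \<longlonglongrightarrow> f x"
    and bound: "\<And>i x. x \<in> space \<P> \<Longrightarrow> norm (s i x) \<le> 2 * norm (f x)"
    by auto
  have [measurable]: "s i \<in> borel_measurable \<P>" for i
    using s by (rule borel_measurable_simple_function)
  have "(\<lambda>i. sq_mean \<P> (\<lambda>x. f x - s i x)) \<longlonglongrightarrow> (\<integral>x. 0 \<partial>\<P>)"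
    unfolding sq_mean_def
  proof (rule integral_dominated_convergence[where w = "\<lambda>x. 9 * (norm (f x))\<^sup>2"])
    show "integrable \<P> (\<lambda>x. 9 * (norm (f x))\<^sup>2)" using int by simp
    show "AE x in \<P>. (\<lambda>i. (norm (f x - s i x))\<^sup>2) \<longlonglongrightarrow> 0"
    proof (intro AE_I2)
      fix x assume "x \<in> space \<P>"
      then have "(\<lambda>i. (norm (f x - s i x))\<^sup>2) \<longlonglongrightarrow> (norm (f x - f x))\<^sup>2"
        by (intro tendsto_intros lim)
      then show "(\<lambda>i. (norm (f x - s i x))\<^sup>2) \<longlonglongrightarrow> 0" by simp
    qed
    show "AE x in \<P>. norm ((norm (f x - s i x))\<^sup>2) \<le> 9 * (norm (f x))\<^sup>2" for i
    proof (intro AE_I2)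
      fix x assume x: "x \<in> space \<P>"
      have "norm (f x - s i x) \<le> 3 * norm (f x)"
        using norm_triangle_ineq4[of "f x" "s i x"] bound[OF x, of i] by simp
      then have "(norm (f x - s i x))\<^sup>2 \<le> (3 * norm (f x))\<^sup>2" by (intro power_mono) auto
      then show "norm ((norm (f x - s i x))\<^sup>2) \<le> 9 * (norm (f x))\<^sup>2"
        by (simp add: power_mult_distrib)
    qed
  qed simp_all
  then have "eventually (\<lambda>i. sq_mean \<P> (\<lambda>x. f x - s i x) < e) sequentially"
    using \<open>0 < e\<close> by (intro order_tendstoD(2)) auto
  then obtain i where "sq_mean \<P> (\<lambda>x. f x - s i x) < e"
    by (auto simp: eventually_sequentially)
  then show "\<exists>g. cyl_approx g \<and> sq_mean \<P> (\<lambda>x. f x - g x) < e"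
    using cyl_approx_simple[OF s] by blast
qed

lemma common_code:
  fixes f :: "'i \<Rightarrow> (nat \<Rightarrow> 'a) \<Rightarrow> 'k::{real_normed_field, euclidean_space}"
  assumes "finite K" "\<And>n. n \<in> K \<Longrightarrow> f n \<in> L2 \<P>" "0 < e"
  shows "\<exists>q N F. finite_code q \<and> (\<forall>n\<in>K. sq_mean \<P> (\<lambda>x. f n x - F n (enc q N x)) < e)"
  using assms(1,2)
proof (induction K rule: finite_induct)
  case empty
  have "finite_code (\<lambda>_. 0)" by (simp add: finite_code_def)
  then show ?case by blast
next
  case (insert k K)
  have "\<exists>q N F. finite_code q \<and> (\<forall>n\<in>K. sq_mean \<P> (\<lambda>x. f n x - F n (enc q N x)) < e)"
    by (rule insert.IH) (use insert.prems in auto)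
  then obtain q1 N1 F1 where 1: "finite_code q1" "\<forall>n\<in>K. sq_mean \<P> (\<lambda>x. f n x - F1 n (enc q1 N1 x)) < e"
    by blast
  obtain q2 N2 F2 where 2: "finite_code q2" "sq_mean \<P> (\<lambda>x. f k x - F2 (enc q2 N2 x)) < e"
    using cyl_approx_L2[of "f k"] insert.prems \<open>0 < e\<close> by (blast elim: cyl_approxE)
  obtain q N where q: "finite_code q"
    and ex1: "\<forall>F :: (nat \<Rightarrow> nat) \<Rightarrow> 'k. \<exists>G. \<forall>x. F (enc q1 N1 x) = G (enc q N x)"
    and ex2: "\<forall>F :: (nat \<Rightarrow> nat) \<Rightarrow> 'k. \<exists>G. \<forall>x. F (enc q2 N2 x) = G (enc q N x)"
    by (rule refine_codes[OF 1(1) 2(1)])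
  obtain G1 where G1: "\<And>n x. F1 n (enc q1 N1 x) = G1 n (enc q N x)"
  proof -
    have "\<forall>n. \<exists>G. \<forall>x. F1 n (enc q1 N1 x) = G (enc q N x)" using ex1 by simp
    from choice[OF this] show thesis using that by auto
  qed
  obtain G2 where G2: "\<And>x. F2 (enc q2 N2 x) = G2 (enc q N x)"
    using spec[OF ex2, of F2] by auto
  show ?case
    using q 1(2) 2(2) insert.hyps
    by (intro exI[of _ q] exI[of _ N] exI[of _ "\<lambda>n. if n = k then G2 else G1 n"]) (auto simp: G1 G2)
qed

end

section \<open>Vector-valued homogeneous functions and K-closedness\<close>

interpretation vfun_vs: vector_space "scale_vfun :: 'k::field \<Rightarrow> ('w \<Rightarrow> nat \<Rightarrow> 'k) \<Rightarrow> 'w \<Rightarrow> nat \<Rightarrow> 'k"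
  by (rule vector_space_scale_vfun)

lemma K_functional_le:
  assumes "f0 \<in> Y0" "f1 \<in> Y1" "f = f0 + f1" "0 \<le> t" "\<And>g. 0 \<le> N0 g" "\<And>g. 0 \<le> N1 g"
  shows "K_functional Y0 N0 Y1 N1 f t \<le> N0 f0 + t * N1 f1"
  unfolding K_functional_def
  by (rule cInf_lower) (use assms in \<open>auto intro!: bdd_belowI[of _ 0] add_nonneg_nonneg\<close>)

lemma le_K_functional:
  assumes "f0 \<in> X0" "f1 \<in> X1" "f = f0 + f1" "0 < C"
    and "\<And>k0 k1. k0 \<in> X0 \<Longrightarrow> k1 \<in> X1 \<Longrightarrow> f = k0 + k1 \<Longrightarrow> c \<le> C * (N0 k0 + t * N1 k1)"
  shows "c \<le> C * K_functional X0 N0 X1 N1 f t"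
proof -
  have "c / C \<le> K_functional X0 N0 X1 N1 f t"
    unfolding K_functional_def
  proof (rule cInf_greatest)
    show "{N0 f0 + t * N1 f1 |f0 f1. f0 \<in> X0 \<and> f1 \<in> X1 \<and> f = f0 + f1} \<noteq> {}"
      using assms(1-3) by blast
    fix y assume "y \<in> {N0 f0 + t * N1 f1 |f0 f1. f0 \<in> X0 \<and> f1 \<in> X1 \<and> f = f0 + f1}"
    then obtain k0 k1 where k: "k0 \<in> X0" "k1 \<in> X1" "f = k0 + k1" "y = N0 k0 + t * N1 k1" by blast
    show "c / C \<le> y"
      using assms(5)[OF k(1-3)] \<open>0 < C\<close> by (simp add: k(4) field_simps)
  qed
  then show ?thesis using \<open>0 < C\<close> by (simp add: field_simps)
qed

locale vector_power = power_space M + seq_norm B N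
  for M :: "'a measure" and B :: "(nat \<Rightarrow> 'k::{real_normed_field, euclidean_space}) set" and N
begin

abbreviation bnorm :: "((nat \<Rightarrow> 'a) \<Rightarrow> nat \<Rightarrow> 'k) \<Rightarrow> real" where
  "bnorm \<equiv> bochner_L1_norm \<P> N"

definition tensors :: "nat \<Rightarrow> ((nat \<Rightarrow> 'a) \<Rightarrow> nat \<Rightarrow> 'k) set" where
  "tensors m = {\<lambda>x. scale_fun (f x) b | f b. f \<in> U1 M m \<and> b \<in> B}"

lemma U1_vec_iff:
  "f \<in> U1_vec M m B N \<longleftrightarrow> f \<in> bochner_L1 \<P> B N \<and> (\<forall>e>0. \<exists>g\<in>vfun_vs.span (tensors m). bnorm (f - g) < e)"
  by (simp add: U1_vec_def norm_closure_def tensors_def)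

lemma tame_tensor:
  fixes u :: "(nat \<Rightarrow> 'a) \<Rightarrow> 'k"
  assumes u: "integrable \<P> u" and b: "b \<in> B"
  shows "tame \<P> (\<lambda>x. scale_fun (u x) b)" "bnorm (\<lambda>x. scale_fun (u x) b) = (\<integral>x. norm (u x) \<partial>\<P>) * N b"
proof -
  have [measurable]: "u \<in> borel_measurable \<P>" using u by auto
  show "tame \<P> (\<lambda>x. scale_fun (u x) b)"
  proof (rule tameI[where g = "\<lambda>x. norm (u x) * N b"])
    show "(\<lambda>x. scale_fun (u x) b n) \<in> borel_measurable \<P>" for n
      unfolding scale_fun_def by measurable
  qed (use u b in \<open>auto simp: scale intro: scale_mem\<close>)
  show "bnorm (\<lambda>x. scale_fun (u x) b) = (\<integral>x. norm (u x) \<partial>\<P>) * N b"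
    using b by (simp add: bochner_L1_norm_def scale)
qed

lemma U1_integrable: "f \<in> U1 M m \<Longrightarrow> integrable \<P> f"
  by (simp add: U1_def norm_closure_def L1_def)

lemma U2_U1:
  assumes "f \<in> U2 M m" shows "f \<in> U1 M m"
proof -
  have "\<exists>g\<in>U2 M m. L1_norm \<P> (f - g) < e" if "0 < e" for e
    by (rule bexI[of _ f]) (use that assms in \<open>simp_all add: L1_norm_def\<close>)
  then show ?thesis
    using power.L2_integrable(1)[OF U2_L2[OF assms]] assms
    by (auto simp: U1_def norm_closure_def L1_def)
qed

lemma tame_zero: "tame \<P> 0"
  by (rule tameI[where g = "\<lambda>_. 0"]) (auto simp: zero_mem)

lemma span_tame:
  assumes "f \<in> vfun_vs.span (tensors m)" shows "tame \<P> f"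
  using assms
proof (induction rule: vfun_vs.span_induct_alt)
  case (step c x y)
  then obtain u b where x: "x = (\<lambda>x. scale_fun (u x) b)" "u \<in> U1 M m" "b \<in> B"
    by (auto simp: tensors_def)
  show ?case
    unfolding x(1) by (intro tame_add(1) tame_scale(1) tame_tensor(1) U1_integrable[OF x(2)] x(3) step)
qed (rule tame_zero)

lemma U1_vec_tame: "f \<in> U1_vec M m B N \<Longrightarrow> tame \<P> f"
  by (simp add: U1_vec_iff bochner_tame)

lemma U1_vec_add:
  assumes "f \<in> U1_vec M m B N" "g \<in> U1_vec M m B N"
  shows "f + g \<in> U1_vec M m B N"
  unfolding U1_vec_iff
proof (intro conjI allI impI)
  show "f + g \<in> bochner_L1 \<P> B N" using assms by (auto simp: U1_vec_iff intro: bochner_add)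
  fix e :: real assume "0 < e"
  then have "0 < e / 2" by simp
  obtain u where u: "u \<in> vfun_vs.span (tensors m)" "bnorm (f - u) < e / 2"
    using assms(1) \<open>0 < e / 2\<close> unfolding U1_vec_iff by blast
  obtain v where v: "v \<in> vfun_vs.span (tensors m)" "bnorm (g - v) < e / 2"
    using assms(2) \<open>0 < e / 2\<close> unfolding U1_vec_iff by blast
  have "f + g - (u + v) = (f - u) + (g - v)" by simp
  then have "bnorm (f + g - (u + v)) \<le> bnorm (f - u) + bnorm (g - v)"
    using tame_add(2)[of \<P> "f - u" "g - v"] u v assms U1_vec_tame span_tame tame_diff(1) by metis
  also have "\<dots> < e" using u v by simp
  finally show "\<exists>h\<in>vfun_vs.span (tensors m). bnorm (f + g - h) < e"
    using vfun_vs.span_add[OF u(1) v(1)] by blast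
qed

lemma U1_vec_minus:
  assumes "f \<in> U1_vec M m B N"
  shows "- f \<in> U1_vec M m B N"
  unfolding U1_vec_iff
proof (intro conjI allI impI)
  have eq: "- f = scale_vfun (- 1) f" by (simp add: scale_vfun_def scale_fun_def fun_eq_iff)
  show "- f \<in> bochner_L1 \<P> B N"
    unfolding eq by (rule bochner_scale) (use assms in \<open>simp add: U1_vec_iff\<close>)
  fix e :: real assume "0 < e"
  obtain u where u: "u \<in> vfun_vs.span (tensors m)" "bnorm (f - u) < e"
    using assms \<open>0 < e\<close> unfolding U1_vec_iff by blast
  have "tame \<P> (f - u)" using u assms by (intro tame_diff U1_vec_tame span_tame)
  from tame_minus(2)[OF this] have "bnorm (- f - (- u)) < e" using u by simp
  then show "\<exists>h\<in>vfun_vs.span (tensors m). bnorm (- f - h) < e"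
    using vfun_vs.span_neg[OF u(1)] by blast
qed

lemma U1_vec_diff:
  "f \<in> U1_vec M m B N \<Longrightarrow> g \<in> U1_vec M m B N \<Longrightarrow> f - g \<in> U1_vec M m B N"
  using U1_vec_add[of f m "- g"] U1_vec_minus[of g m] by simp

lemma tame_finite_seq:
  assumes v: "\<And>n. v n \<in> L2 \<P>" "\<And>n. d \<le> n \<Longrightarrow> v n = (\<lambda>x. 0)"
  shows "tame \<P> (\<lambda>x n. v n x)"
    and "bnorm (\<lambda>x n. v n x) \<le> (\<Sum>n<d. N (basis_seq n) * (\<integral>x. norm (v n x) \<partial>\<P>))"
proof -
  have cut: "(\<lambda>n. v n x) = cutoff d (\<lambda>n. v n x)" for x
    using v(2) by (auto simp: cutoff_def fun_eq_iff not_less)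
  have int: "integrable \<P> (v n)" for n by (rule power.L2_integrable(1)[OF v(1)])
  have le: "N (\<lambda>n. v n x) \<le> (\<Sum>n<d. N (basis_seq n) * norm (v n x))" for x
    using norm_cutoff_le[of d "\<lambda>n. v n x"] cut[of x] by (simp add: mult.commute)
  have i: "integrable \<P> (\<lambda>x. \<Sum>n<d. N (basis_seq n) * norm (v n x))"
    using int by auto
  show t: "tame \<P> (\<lambda>x n. v n x)"
  proof (rule tameI[OF _ _ i le])
    show "(\<lambda>n. v n x) \<in> B" for x
      using cutoff_mem[of d "\<lambda>n. v n x"] cut[of x] by simp
    show "(\<lambda>x. v n x) \<in> borel_measurable \<P>" for n using int[of n] by auto
  qed
  have "bnorm (\<lambda>x n. v n x) \<le> (\<integral>x. (\<Sum>n<d. N (basis_seq n) * norm (v n x)) \<partial>\<P>)"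
    unfolding bochner_L1_norm_def using t i le by (intro integral_mono) (auto simp: tame_def)
  also have "\<dots> = (\<Sum>n<d. N (basis_seq n) * (\<integral>x. norm (v n x) \<partial>\<P>))"
    using int by (subst Bochner_Integration.integral_sum) auto
  finally show "bnorm (\<lambda>x n. v n x) \<le> (\<Sum>n<d. N (basis_seq n) * (\<integral>x. norm (v n x) \<partial>\<P>))" .
qed

text \<open>
  Approximability by sequences with finitely many nonzero components, all of them in \<open>U2\<close>. The span that defines \<open>U1_vec\<close> is reduced
  to such sequences, because \<open>U2\<close> is dense in \<open>U1\<close> and each element of \<open>B\<close> is a limit of its cutoffs.
\<close>

definition U2_approx :: "nat \<Rightarrow> ((nat \<Rightarrow> 'a) \<Rightarrow> nat \<Rightarrow> 'k) \<Rightarrow> bool" where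
  "U2_approx m f \<longleftrightarrow> tame \<P> f \<and> (\<forall>e>0. \<exists>d v. (\<forall>n. v n \<in> U2 M m) \<and> (\<forall>n\<ge>d. v n = (\<lambda>x. 0)) \<and>
     bnorm (f - (\<lambda>x n. v n x)) < e)"

lemma U2_approx_add:
  assumes f: "U2_approx m f" and g: "U2_approx m g"
  shows "U2_approx m (f + g)"
  unfolding U2_approx_def
proof (intro conjI allI impI)
  have t: "tame \<P> f" "tame \<P> g" using assms by (auto simp: U2_approx_def)
  then show "tame \<P> (f + g)" by (rule tame_add)
  fix e :: real assume "0 < e"
  then have "0 < e / 2" by simp
  obtain d u where u: "\<forall>n. u n \<in> U2 M m" "\<forall>n\<ge>d. u n = (\<lambda>x. 0)" "bnorm (f - (\<lambda>x n. u n x)) < e / 2"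
    using f \<open>0 < e / 2\<close> unfolding U2_approx_def by blast
  obtain d' v where v: "\<forall>n. v n \<in> U2 M m" "\<forall>n\<ge>d'. v n = (\<lambda>x. 0)" "bnorm (g - (\<lambda>x n. v n x)) < e / 2"
    using g \<open>0 < e / 2\<close> unfolding U2_approx_def by blast
  have tu: "tame \<P> (\<lambda>x n. u n x)"
    by (rule tame_finite_seq(1)[of u d]) (use u U2_L2 in auto)
  have tv: "tame \<P> (\<lambda>x n. v n x)"
    by (rule tame_finite_seq(1)[of v d']) (use v U2_L2 in auto)
  have eq: "f + g - (\<lambda>x n. u n x + v n x) = (f - (\<lambda>x n. u n x)) + (g - (\<lambda>x n. v n x))"
    by (simp add: fun_eq_iff)
  have "bnorm (f + g - (\<lambda>x n. u n x + v n x)) \<le> bnorm (f - (\<lambda>x n. u n x)) + bnorm (g - (\<lambda>x n. v n x))"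
    unfolding eq by (rule tame_add(2)[OF tame_diff(1)[OF t(1) tu] tame_diff(1)[OF t(2) tv]])
  also have "\<dots> < e" using u v by simp
  finally have "bnorm (f + g - (\<lambda>x n. u n x + v n x)) < e" .
  moreover have "\<forall>n. (\<lambda>x. u n x + v n x) \<in> U2 M m" using u v by (auto intro: U2_add)
  moreover have "\<forall>n\<ge>max d d'. (\<lambda>x. u n x + v n x) = (\<lambda>x. 0)" using u v by simp
  ultimately show "\<exists>d v. (\<forall>n. v n \<in> U2 M m) \<and> (\<forall>n\<ge>d. v n = (\<lambda>x. 0)) \<and> bnorm (f + g - (\<lambda>x n. v n x)) < e"
    by (intro exI[of _ "max d d'"] exI[of _ "\<lambda>n x. u n x + v n x"]) simp
qed

text \<open>
  First \<open>u\<close> is replaced by \<open>g\<close> in \<open>U2\<close>, then \<open>b\<close> by a cutoff; the quality of the second approximation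
  depends on the norm of \<open>g\<close>.
\<close>

lemma U2_approx_tensor:
  fixes u :: "(nat \<Rightarrow> 'a) \<Rightarrow> 'k"
  assumes u: "u \<in> U1 M m" and b: "b \<in> B"
  shows "U2_approx m (\<lambda>x. scale_fun (u x) b)"
  unfolding U2_approx_def
proof (intro conjI allI impI)
  show "tame \<P> (\<lambda>x. scale_fun (u x) b)" by (rule tame_tensor(1)[OF U1_integrable[OF u] b])
  fix e :: real assume "0 < e"
  define e1 where "e1 = e / (2 * (N b + 1))"
  have Nb: "0 < N b + 1" using nonneg[of b] by linarith
  have "0 < e1" using \<open>0 < e\<close> Nb by (simp add: e1_def)
  then obtain g where g: "g \<in> U2 M m" "(\<integral>x. norm (u x - g x) \<partial>\<P>) < e1"
    using u unfolding U1_def norm_closure_def L1_norm_def by auto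
  define G where "G = (\<integral>x. norm (g x) \<partial>\<P>)"
  have G: "0 < G + 1" unfolding G_def by (simp add: add_nonneg_pos)
  have "0 < e / (2 * (G + 1))" using \<open>0 < e\<close> G by simp
  with tail[OF b] have "eventually (\<lambda>d. N (b - cutoff d b) < e / (2 * (G + 1))) sequentially"
    by (intro order_tendstoD(2))
  then obtain d where d: "N (b - cutoff d b) < e / (2 * (G + 1))"
    by (auto simp: eventually_sequentially)
  define v where "v n x = cutoff d b n * g x" for n x
  have int: "integrable \<P> (\<lambda>x. u x - g x)" "integrable \<P> g"
    using U1_integrable[OF u] power.L2_integrable(1)[OF U2_L2[OF g(1)]] by auto
  have bc: "b - cutoff d b \<in> B" by (intro diff_mem b cutoff_mem)
  have eq: "(\<lambda>x. scale_fun (u x) b) - (\<lambda>x n. v n x) = (\<lambda>x. scale_fun (u x - g x) b) + (\<lambda>x. scale_fun (g x) (b - cutoff d b))"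
    by (simp add: fun_eq_iff v_def scale_fun_def algebra_simps)
  have "bnorm ((\<lambda>x. scale_fun (u x) b) - (\<lambda>x n. v n x)) \<le>
      (\<integral>x. norm (u x - g x) \<partial>\<P>) * N b + G * N (b - cutoff d b)"
    unfolding eq G_def tame_tensor(2)[OF int(1) b, symmetric] tame_tensor(2)[OF int(2) bc, symmetric]
    by (rule tame_add(2)[OF tame_tensor(1)[OF int(1) b] tame_tensor(1)[OF int(2) bc]])
  also have "\<dots> \<le> e1 * N b + G * (e / (2 * (G + 1)))"
    using g(2) d nonneg[of b] by (intro add_mono mult_right_mono mult_left_mono) (auto simp: G_def)
  also have "\<dots> < e1 * (N b + 1) + (G + 1) * (e / (2 * (G + 1)))"
    using \<open>0 < e1\<close> \<open>0 < e / (2 * (G + 1))\<close> by (intro add_strict_mono mult_strict_left_mono mult_strict_right_mono) auto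
  also have "\<dots> = e"
  proof -
    have "e1 * (N b + 1) = e / 2" "(G + 1) * (e / (2 * (G + 1))) = e / 2"
      using Nb G by (simp_all add: e1_def field_simps)
    then show ?thesis by linarith
  qed
  finally have "bnorm ((\<lambda>x. scale_fun (u x) b) - (\<lambda>x n. v n x)) < e" .
  moreover have "\<forall>n. v n \<in> U2 M m" unfolding v_def using g(1) by (auto intro: U2_scale)
  moreover have "\<forall>n\<ge>d. v n = (\<lambda>x. 0)" by (auto simp: v_def cutoff_def)
  ultimately show "\<exists>d v. (\<forall>n. v n \<in> U2 M m) \<and> (\<forall>n\<ge>d. v n = (\<lambda>x. 0)) \<and> bnorm ((\<lambda>x. scale_fun (u x) b) - (\<lambda>x n. v n x)) < e"
    by blast
qed

lemma U2_approx_zero: "U2_approx m 0"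
proof -
  have "(0 :: (nat \<Rightarrow> 'a) \<Rightarrow> nat \<Rightarrow> 'k) - (\<lambda>x n. 0) = 0"
    by (simp add: fun_eq_iff)
  moreover have "bnorm 0 = 0"
    by (simp add: bochner_L1_norm_def)
  ultimately have "bnorm (0 - (\<lambda>x n. 0)) = 0" by simp
  then show ?thesis
    unfolding U2_approx_def by (auto simp: tame_zero U2_zero intro!: exI[of _ "\<lambda>n x. 0"])
qed

lemma U1_scale:
  fixes u :: "(nat \<Rightarrow> 'a) \<Rightarrow> 'k"
  assumes "u \<in> U1 M m"
  shows "(\<lambda>x. c * u x) \<in> U1 M m"
proof -
  have int: "integrable \<P> u" by (rule U1_integrable[OF assms])
  have "\<exists>h\<in>U2 M m. L1_norm \<P> ((\<lambda>x. c * u x) - h) < e" if "0 < e" for e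
  proof -
    have c: "0 < norm c + 1" using norm_ge_zero[of c] by linarith
    then have "0 < e / (norm c + 1)" using that by simp
    then obtain g where g: "g \<in> U2 M m" "L1_norm \<P> (u - g) < e / (norm c + 1)"
      using assms unfolding U1_def norm_closure_def by blast
    have "L1_norm \<P> ((\<lambda>x. c * u x) - (\<lambda>x. c * g x)) = norm c * L1_norm \<P> (u - g)"
      by (simp add: L1_norm_def norm_mult flip: right_diff_distrib)
    also have "\<dots> \<le> (norm c + 1) * L1_norm \<P> (u - g)"
      by (intro mult_right_mono) (auto simp: L1_norm_def)
    also have "\<dots> < (norm c + 1) * (e / (norm c + 1))"
      by (rule mult_strict_left_mono[OF g(2) c])
    also have "\<dots> = e" using c by simp
    finally show ?thesis using U2_scale[OF g(1), of c] by blast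
  qed
  then show ?thesis using int by (simp add: U1_def norm_closure_def L1_def)
qed

lemma span_U2_approx:
  assumes "f \<in> vfun_vs.span (tensors m)" shows "U2_approx m f"
  using assms
proof (induction rule: vfun_vs.span_induct_alt)
  case (step c x y)
  then obtain u b where x: "x = (\<lambda>x. scale_fun (u x) b)" "u \<in> U1 M m" "b \<in> B"
    by (auto simp: tensors_def)
  have eq: "scale_vfun c x = (\<lambda>x. scale_fun (c * u x) b)"
    by (simp add: x scale_vfun_def scale_fun_def mult.assoc)
  show ?case
    unfolding eq by (rule U2_approx_add[OF U2_approx_tensor[OF U1_scale[OF x(2), of c] x(3)] step(2)])
qed (rule U2_approx_zero)

lemma U1_vec_approx:
  assumes f: "f \<in> U1_vec M m B N" and "0 < e"
  obtains d v where "\<And>n. v n \<in> U2 M m" "\<And>n. d \<le> n \<Longrightarrow> v n = (\<lambda>x. 0)" "bnorm (f - (\<lambda>x n. v n x)) < e"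
proof -
  have "0 < e / 2" using assms by simp
  obtain g where g: "g \<in> vfun_vs.span (tensors m)" "bnorm (f - g) < e / 2"
    using f \<open>0 < e / 2\<close> unfolding U1_vec_iff by blast
  obtain d v where v: "\<forall>n. v n \<in> U2 M m" "\<forall>n\<ge>d. v n = (\<lambda>x. 0)" "bnorm (g - (\<lambda>x n. v n x)) < e / 2"
    using span_U2_approx[OF g(1)] \<open>0 < e / 2\<close> unfolding U2_approx_def by blast
  have tv: "tame \<P> (\<lambda>x n. v n x)"
    by (rule tame_finite_seq(1)[of v d]) (use v U2_L2 in auto)
  have "f - (\<lambda>x n. v n x) = (f - g) + (g - (\<lambda>x n. v n x))" by simp
  then have "bnorm (f - (\<lambda>x n. v n x)) \<le> bnorm (f - g) + bnorm (g - (\<lambda>x n. v n x))"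
    using tame_add(2)[OF tame_diff(1)[OF U1_vec_tame[OF f] span_tame[OF g(1)]] tame_diff(1)[OF span_tame[OF g(1)] tv]]
    by simp
  also have "\<dots> < e" using g v by simp
  finally show thesis using v that by blast
qed

lemma finite_seq_error:
  assumes v: "\<And>n. v n \<in> L2 \<P>" "\<And>n. d \<le> n \<Longrightarrow> v n = (\<lambda>x. 0)"
    and s: "\<And>n. s n \<in> L2 \<P>" and le: "\<And>n. n < d \<Longrightarrow> sq_mean \<P> (\<lambda>x. v n x - s n x) \<le> \<delta>\<^sup>2" and "0 \<le> \<delta>"
  shows "tame \<P> ((\<lambda>x n. v n x) - (\<lambda>x. cutoff d (\<lambda>n. s n x)))"
    and "bnorm ((\<lambda>x n. v n x) - (\<lambda>x. cutoff d (\<lambda>n. s n x))) \<le> \<delta> * (\<Sum>n<d. N (basis_seq n))"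
proof -
  define w where "w n x = (if n < d then v n x - s n x else 0)" for n x
  have eq: "(\<lambda>x n. v n x) - (\<lambda>x. cutoff d (\<lambda>n. s n x)) = (\<lambda>x n. w n x)"
    using v(2) by (auto simp: fun_eq_iff w_def cutoff_def)
  have w: "w n \<in> L2 \<P>" for n
  proof (cases "n < d")
    case True
    then show ?thesis using L2_diff(1)[OF v(1) s] by (simp add: w_def[abs_def])
  next
    case False
    then show ?thesis using L2_zero by (simp add: w_def[abs_def])
  qed
  have w0: "w n = (\<lambda>x. 0)" if "d \<le> n" for n using that by (simp add: w_def fun_eq_iff)
  show "tame \<P> ((\<lambda>x n. v n x) - (\<lambda>x. cutoff d (\<lambda>n. s n x)))"
    unfolding eq by (rule tame_finite_seq(1)[OF w w0])
  have "bnorm (\<lambda>x n. w n x) \<le> (\<Sum>n<d. N (basis_seq n) * (\<integral>x. norm (w n x) \<partial>\<P>))"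
    by (rule tame_finite_seq(2)[OF w w0])
  also have "\<dots> \<le> (\<Sum>n<d. N (basis_seq n) * \<delta>)"
  proof (intro sum_mono mult_left_mono nonneg)
    fix n assume "n \<in> {..<d}"
    then have "sq_mean \<P> (w n) \<le> \<delta>\<^sup>2" using le[of n] by (simp add: w_def[abs_def])
    then have "L2_norm \<P> (w n) \<le> \<delta>"
      unfolding L2_norm_sq_mean using real_sqrt_le_mono[of "sq_mean \<P> (w n)" "\<delta>\<^sup>2"] \<open>0 \<le> \<delta>\<close> by simp
    then show "(\<integral>x. norm (w n x) \<partial>\<P>) \<le> \<delta>" using power.L2_integrable(2)[OF w[of n]] by simp
  qed
  also have "\<dots> = \<delta> * (\<Sum>n<d. N (basis_seq n))" by (simp add: sum_distrib_left mult.commute)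
  finally show "bnorm ((\<lambda>x n. v n x) - (\<lambda>x. cutoff d (\<lambda>n. s n x))) \<le> \<delta> * (\<Sum>n<d. N (basis_seq n))"
    unfolding eq .
qed

lemma homogeneous_U1_vec:
  fixes H :: "nat \<Rightarrow> nat set \<Rightarrow> (nat \<Rightarrow> nat) \<Rightarrow> 'k"
  assumes q: "code_space M q"
    and H: "\<And>n A. A \<in> constituents k m \<Longrightarrow> finite_power.centered (range q) (letter_prob q) k A (H n A)"
  shows "(\<lambda>x. cutoff d (\<lambda>n. \<Sum>A\<in>constituents k m. H n A (enc q k x))) \<in> U1_vec M m B N"
proof -
  interpret c: code_space M q k by (rule q)
  define u where "u n x = (\<Sum>A\<in>constituents k m. H n A (c.encode x))" for n x
  define h where "h x = cutoff d (\<lambda>n. u n x)" for x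
  have u: "u n \<in> U1 M m" for n
    unfolding u_def by (intro U2_U1 c.homogeneous_U2 H)
  have hsum: "h = (\<Sum>n<d. (\<lambda>x. scale_fun (u n x) (basis_seq n)))"
  proof (rule ext, rule ext)
    fix x i
    have "(\<Sum>n<d. (\<lambda>x. scale_fun (u n x) (basis_seq n))) x i = (\<Sum>n<d. if n = i then u n x else 0)"
      by (induction d) (auto simp: scale_fun_def basis_seq_def)
    then show "h x i = (\<Sum>n<d. (\<lambda>x. scale_fun (u n x) (basis_seq n))) x i"
      by (simp add: h_def cutoff_def)
  qed
  have span: "h \<in> vfun_vs.span (tensors m)"
    unfolding hsum using u basis_mem
    by (intro vfun_vs.span_sum vfun_vs.span_base) (auto simp: tensors_def)
  have X: "h \<in> bochner_L1 \<P> B N"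
  proof (rule bochner_simple)
    show "simple_function \<P> h"
      unfolding h_def u_def by (rule c.encode_simple)
    show "h x \<in> B" for x unfolding h_def by (rule cutoff_mem)
    show "finite_measure \<P>" by (rule power.finite_measure_axioms)
  qed
  have "bnorm (h - h) < e" if "0 < e" for e
    using that by (simp add: bochner_L1_norm_def)
  then have "h \<in> U1_vec M m B N"
    using X span unfolding U1_vec_iff by blast
  moreover have "h = (\<lambda>x. cutoff d (\<lambda>n. \<Sum>A\<in>constituents k m. H n A (c.encode x)))"
    by (simp add: fun_eq_iff h_def u_def)
  ultimately show ?thesis by simp
qed

text \<open>
  A function of the code that is bounded in the dual norm defines a bounded functional on the Bochner
  space.
\<close>

lemma pairing:
  fixes G :: "nat \<Rightarrow> (nat \<Rightarrow> nat) \<Rightarrow> 'k"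
  assumes q: "code_space M q" and f: "tame \<P> f"
    and le: "\<And>x a. a \<in> B \<Longrightarrow> \<bar>\<Sum>n<d. inner (G n (enc q k x)) (a n)\<bar> \<le> L * N a"
  shows "integrable \<P> (\<lambda>x. \<Sum>n<d. inner (G n (enc q k x)) (f x n))"
    and "\<bar>\<integral>x. (\<Sum>n<d. inner (G n (enc q k x)) (f x n)) \<partial>\<P>\<bar> \<le> L * bnorm f"
proof -
  interpret c: code_space M q k by (rule q)
  have [measurable]: "(\<lambda>x. f x n) \<in> borel_measurable \<P>" "(\<lambda>x. G n (c.encode x)) \<in> borel_measurable \<P>" for n
    using f c.encode_simple[of "G n"] by (auto simp: tame_def intro: borel_measurable_simple_function)
  have int: "integrable \<P> (\<lambda>x. L * N (f x))" using f by (simp add: tame_def)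
  have bound: "\<bar>\<Sum>n<d. inner (G n (c.encode x)) (f x n)\<bar> \<le> L * N (f x)" if "x \<in> space \<P>" for x
    using le[of "f x" x] f that by (simp add: tame_def)
  show i: "integrable \<P> (\<lambda>x. \<Sum>n<d. inner (G n (c.encode x)) (f x n))"
  proof (rule Bochner_Integration.integrable_bound[OF int])
    show "AE x in \<P>. norm (\<Sum>n<d. inner (G n (c.encode x)) (f x n)) \<le> norm (L * N (f x))"
      using bound by (intro AE_I2) fastforce
  qed measurable
  have "\<bar>\<integral>x. (\<Sum>n<d. inner (G n (c.encode x)) (f x n)) \<partial>\<P>\<bar> \<le> (\<integral>x. \<bar>\<Sum>n<d. inner (G n (c.encode x)) (f x n)\<bar> \<partial>\<P>)"
    by (rule integral_abs_bound)
  also have "\<dots> \<le> (\<integral>x. L * N (f x) \<partial>\<P>)"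
    using i int bound by (intro integral_mono) auto
  also have "\<dots> = L * bnorm f" by (simp add: bochner_L1_norm_def)
  finally show "\<bar>\<integral>x. (\<Sum>n<d. inner (G n (c.encode x)) (f x n)) \<partial>\<P>\<bar> \<le> L * bnorm f" .
qed

end

lemma le_add_epsilon:
  fixes a b c :: real
  assumes "\<And>e. 0 < e \<Longrightarrow> a \<le> b + c * e" "0 \<le> c"
  shows "a \<le> b"
proof (rule field_le_epsilon)
  fix e :: real assume "0 < e"
  have "a \<le> b + c * (e / (c + 1))"
    using assms(2) \<open>0 < e\<close> by (intro assms(1)) simp
  also have "c * (e / (c + 1)) \<le> e"
    using assms(2) \<open>0 < e\<close> by (simp add: field_simps)
  finally show "a \<le> b + e" by simp
qed

context power_space
begin

text \<open>
  Both parts of a decomposition are approximated with the same code, so that their sum is again a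
  function on one finite power.
\<close>

lemma common_homogeneous_approx:
  fixes v w :: "nat \<Rightarrow> (nat \<Rightarrow> 'a) \<Rightarrow> 'k::{real_normed_field, euclidean_space}"
  assumes v: "\<And>n. v n \<in> U2 M m" and w: "\<And>n. w n \<in> U2 M m" and "0 < \<delta>"
  obtains q k a b where "code_space M q"
    and "\<And>n A. A \<in> constituents k m \<Longrightarrow> finite_power.centered (range q) (letter_prob q) k A (a n A)"
    and "\<And>n A. A \<in> constituents k m \<Longrightarrow> finite_power.centered (range q) (letter_prob q) k A (b n A)"
    and "\<And>n. n < d \<Longrightarrow> sq_mean \<P> (\<lambda>x. v n x - (\<Sum>A\<in>constituents k m. a n A (enc q k x))) \<le> \<delta>\<^sup>2"
    and "\<And>n. n < d \<Longrightarrow> sq_mean \<P> (\<lambda>x. w n x - (\<Sum>A\<in>constituents k m. b n A (enc q k x))) \<le> \<delta>\<^sup>2"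
proof -
  define f where "f i = (case i of Inl n \<Rightarrow> v n | Inr n \<Rightarrow> w n)" for i :: "nat + nat"
  have fU: "f i \<in> U2 M m" for i using v w by (auto simp: f_def split: sum.split)
  obtain q k F where q: "finite_code q"
    and F: "\<forall>i\<in>{..<d} <+> {..<d}. sq_mean \<P> (\<lambda>x. f i x - F i (enc q k x)) < \<delta>\<^sup>2"
    using common_code[of "{..<d} <+> {..<d}" f "\<delta>\<^sup>2"] U2_L2[OF fU] \<open>0 < \<delta>\<close> by auto
  interpret c: code_space M q k using q by unfold_locales
  have "\<forall>i. \<exists>H. (\<forall>A\<in>constituents k m. c.centered A (H A)) \<and>
      sq_mean \<P> (\<lambda>x. f i x - (\<Sum>A\<in>constituents k m. H A (c.encode x))) \<le> sq_mean \<P> (\<lambda>x. f i x - F i (c.encode x))"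
  proof
    fix i
    show "\<exists>H. (\<forall>A\<in>constituents k m. c.centered A (H A)) \<and>
      sq_mean \<P> (\<lambda>x. f i x - (\<Sum>A\<in>constituents k m. H A (c.encode x))) \<le> sq_mean \<P> (\<lambda>x. f i x - F i (c.encode x))"
      by (rule c.homogeneous_part[OF fU[of i], of "F i"]) blast
  qed
  from choice[OF this] obtain H where H: "\<And>i A. A \<in> constituents k m \<Longrightarrow> c.centered A (H i A)"
    and Hle: "\<And>i. sq_mean \<P> (\<lambda>x. f i x - (\<Sum>A\<in>constituents k m. H i A (c.encode x))) \<le> sq_mean \<P> (\<lambda>x. f i x - F i (c.encode x))"
    by blast
  have lt: "sq_mean \<P> (\<lambda>x. f i x - (\<Sum>A\<in>constituents k m. H i A (c.encode x))) \<le> \<delta>\<^sup>2"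
    if "i \<in> {..<d} <+> {..<d}" for i
    using F that by (intro order_trans[OF Hle]) force
  show thesis
  proof (rule that[of q k "\<lambda>n. H (Inl n)" "\<lambda>n. H (Inr n)"])
    show "code_space M q" by (rule code_space_axiom[OF q])
    show "sq_mean \<P> (\<lambda>x. v n x - (\<Sum>A\<in>constituents k m. H (Inl n) A (c.encode x))) \<le> \<delta>\<^sup>2" if "n < d" for n
      using lt[OF InlI[of n "{..<d}"]] that by (simp add: f_def)
    show "sq_mean \<P> (\<lambda>x. w n x - (\<Sum>A\<in>constituents k m. H (Inr n) A (c.encode x))) \<le> \<delta>\<^sup>2" if "n < d" for n
      using lt[OF InrI[of n "{..<d}"]] that by (simp add: f_def)
  qed (use H in auto)
qed

text \<open>
  Let \<open>s0\<close>, \<open>s1\<close> be finite homogeneous approximations of \<open>f0\<close>, \<open>f1\<close>, and let \<open>h0\<close>, \<open>h1\<close>, \<open>G\<close> be obtained by applying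
  \<open>finite_decomposition\<close> to \<open>s0 + s1\<close>. Then \<open>(f0 - s0) + h0\<close> and \<open>(f1 - s1) + h1\<close> decompose \<open>f0 + f1\<close>
  inside the homogeneous spaces. The errors \<open>f0 - s0\<close>, \<open>f1 - s1\<close> are small, and the norms of \<open>h0\<close>, \<open>h1\<close> are
  bounded by pairing \<open>G\<close> with \<open>s0 + s1 = k0 + k1 - (f0 - s0) - (f1 - s1)\<close>.
\<close>

lemma K_estimate:
  fixes f0 f1 k0 k1 :: "(nat \<Rightarrow> 'a) \<Rightarrow> nat \<Rightarrow> 'k::{real_normed_field, euclidean_space}"
  assumes f0: "f0 \<in> U1_vec M m (lp_space 1) (lp_norm 1)" and f1: "f1 \<in> U1_vec M m (lp_space 2) (lp_norm 2)"
    and k0: "k0 \<in> bochner_L1 \<P> (lp_space 1) (lp_norm 1)" and k1: "k1 \<in> bochner_L1 \<P> (lp_space 2) (lp_norm 2)"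
    and eq: "f0 + f1 = k0 + k1" and "0 < t" and "0 < e"
  defines "C \<equiv> 2 ^ (m + 3) * (lift_const m * sqrt (2 ^ (m + 3)))"
  shows "K_functional (U1_vec M m (lp_space 1) (lp_norm 1)) (bochner_L1_norm \<P> (lp_norm 1))
      (U1_vec M m (lp_space 2) (lp_norm 2)) (bochner_L1_norm \<P> (lp_norm 2)) (f0 + f1) t
    \<le> C * (bochner_L1_norm \<P> (lp_norm 1) k0 + t * bochner_L1_norm \<P> (lp_norm 2) k1)
      + (2 * C * (1 + t) + 2 * (1 + t) + 1) * e"
proof -
  interpret l1: vector_power M "lp_space 1 :: (nat \<Rightarrow> 'k) set" "lp_norm 1"
    by (rule vector_power.intro[OF power_space_axioms seq_norm_l1])
  interpret l2: vector_power M "lp_space 2 :: (nat \<Rightarrow> 'k) set" "lp_norm 2"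
    by (rule vector_power.intro[OF power_space_axioms seq_norm_l2])
  define L where "L = lift_const m * sqrt (2 ^ (m + 3))"
  have "0 \<le> L" by (simp add: L_def lift_const_def sum_nonneg)
  obtain d0 v where v: "\<And>n. v n \<in> U2 M m" and v0: "\<And>n. d0 \<le> n \<Longrightarrow> v n = (\<lambda>x. 0)"
    and fv: "l1.bnorm (f0 - (\<lambda>x n. v n x)) < e"
    by (rule l1.U1_vec_approx[OF f0 \<open>0 < e\<close>]) blast
  obtain d1 w where w: "\<And>n. w n \<in> U2 M m" and w0: "\<And>n. d1 \<le> n \<Longrightarrow> w n = (\<lambda>x. 0)"
    and fw: "l2.bnorm (f1 - (\<lambda>x n. w n x)) < e"
    by (rule l2.U1_vec_approx[OF f1 \<open>0 < e\<close>]) blast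
  define d where "d = max d0 d1"
  define S1 where "S1 = (\<Sum>n<d. lp_norm 1 (basis_seq n :: nat \<Rightarrow> 'k))"
  define S2 where "S2 = (\<Sum>n<d. lp_norm 2 (basis_seq n :: nat \<Rightarrow> 'k))"
  have S: "0 \<le> S1" "0 \<le> S2" by (auto simp: S1_def S2_def intro!: sum_nonneg l1.nonneg l2.nonneg)
  define \<delta> where "\<delta> = e / (S1 + S2 + 1)"
  have "0 < \<delta>" using S \<open>0 < e\<close> by (simp add: \<delta>_def)
  have \<delta>S: "\<delta> * S1 \<le> e" "\<delta> * S2 \<le> e" using S \<open>0 < e\<close> by (simp_all add: \<delta>_def field_simps)
  obtain q k a b where q: "code_space M q"
    and a: "\<And>n A. A \<in> constituents k m \<Longrightarrow> finite_power.centered (range q) (letter_prob q) k A (a n A)"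
    and b: "\<And>n A. A \<in> constituents k m \<Longrightarrow> finite_power.centered (range q) (letter_prob q) k A (b n A)"
    and va: "\<And>n. n < d \<Longrightarrow> sq_mean \<P> (\<lambda>x. v n x - (\<Sum>A\<in>constituents k m. a n A (enc q k x))) \<le> \<delta>\<^sup>2"
    and wb: "\<And>n. n < d \<Longrightarrow> sq_mean \<P> (\<lambda>x. w n x - (\<Sum>A\<in>constituents k m. b n A (enc q k x))) \<le> \<delta>\<^sup>2"
  proof (rule common_homogeneous_approx[where v = v and w = w and m = m and d = d, OF v w \<open>0 < \<delta>\<close>], goal_cases)
    case (1 q k a b)
    show ?case by (rule that) (fact 1)+
  qed
  interpret c: code_space M q k by (rule q)
  let ?\<A> = "constituents k m"
  define s0 where "s0 x = cutoff d (\<lambda>n. \<Sum>A\<in>?\<A>. a n A (c.encode x))" for x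
  define s1 where "s1 x = cutoff d (\<lambda>n. \<Sum>A\<in>?\<A>. b n A (c.encode x))" for x
  have s0U: "s0 \<in> U1_vec M m (lp_space 1) (lp_norm 1)"
    unfolding s0_def[abs_def] by (rule l1.homogeneous_U1_vec[OF q a])
  have s1U: "s1 \<in> U1_vec M m (lp_space 2) (lp_norm 2)"
    unfolding s1_def[abs_def] by (rule l2.homogeneous_U1_vec[OF q b])
  have r0: "l1.bnorm (f0 - s0) \<le> 2 * e"
  proof -
    have L2s: "(\<lambda>x. \<Sum>A\<in>?\<A>. a n A (c.encode x)) \<in> L2 \<P>" for n by (rule c.encode_L2)
    have vd: "v n = (\<lambda>x. 0)" if "d \<le> n" for n using v0 that by (simp add: d_def)
    note err = l1.finite_seq_error[of v d "\<lambda>n x. \<Sum>A\<in>?\<A>. a n A (c.encode x)" \<delta>, OF U2_L2[OF v] vd L2s va less_imp_le[OF \<open>0 < \<delta>\<close>], folded s0_def S1_def]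
    have "l1.bnorm (f0 - s0) = l1.bnorm ((f0 - (\<lambda>x n. v n x)) + ((\<lambda>x n. v n x) - s0))" by simp
    also have "\<dots> \<le> l1.bnorm (f0 - (\<lambda>x n. v n x)) + l1.bnorm ((\<lambda>x n. v n x) - s0)"
      by (rule l1.tame_add(2)[OF l1.tame_diff(1)[OF l1.U1_vec_tame[OF f0] l1.tame_finite_seq(1)[OF U2_L2[OF v] vd]] err(1)])
    also have "\<dots> \<le> 2 * e" using fv err(2) \<delta>S by simp
    finally show ?thesis .
  qed
  have r1: "l2.bnorm (f1 - s1) \<le> 2 * e"
  proof -
    have L2s: "(\<lambda>x. \<Sum>A\<in>?\<A>. b n A (c.encode x)) \<in> L2 \<P>" for n by (rule c.encode_L2)
    have wd: "w n = (\<lambda>x. 0)" if "d \<le> n" for n using w0 that by (simp add: d_def)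
    note err = l2.finite_seq_error[of w d "\<lambda>n x. \<Sum>A\<in>?\<A>. b n A (c.encode x)" \<delta>, OF U2_L2[OF w] wd L2s wb less_imp_le[OF \<open>0 < \<delta>\<close>], folded s1_def S2_def]
    have "l2.bnorm (f1 - s1) = l2.bnorm ((f1 - (\<lambda>x n. w n x)) + ((\<lambda>x n. w n x) - s1))" by simp
    also have "\<dots> \<le> l2.bnorm (f1 - (\<lambda>x n. w n x)) + l2.bnorm ((\<lambda>x n. w n x) - s1)"
      by (rule l2.tame_add(2)[OF l2.tame_diff(1)[OF l2.U1_vec_tame[OF f1] l2.tame_finite_seq(1)[OF U2_L2[OF w] wd]] err(1)])
    also have "\<dots> \<le> 2 * e" using fw err(2) \<delta>S by simp
    finally show ?thesis .
  qed

  define f where "f n A x = a n A x + b n A x" for n A x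
  have fc: "c.centered A (f n A)" if "A \<in> ?\<A>" for n A
    using a[OF that, of n] b[OF that, of n]
    unfolding f_def c.centered_def by (auto simp: c.avg_add intro: c.determined_comp2)
  obtain g0 g1 G where g0: "\<And>n A. A \<in> ?\<A> \<Longrightarrow> c.centered A (g0 n A)"
    and g1: "\<And>n A. A \<in> ?\<A> \<Longrightarrow> c.centered A (g1 n A)"
    and fg: "\<And>n A x. n < d \<Longrightarrow> A \<in> ?\<A> \<Longrightarrow> x \<in> c.words \<Longrightarrow> f n A x = g0 n A x + g1 n A x"
    and G1: "\<And>n x. n < d \<Longrightarrow> x \<in> c.words \<Longrightarrow> norm (G n x) \<le> L"
    and G2: "\<And>x. x \<in> c.words \<Longrightarrow> l2_part {..<d} (\<lambda>n. G n x) \<le> L * t"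
    and gG: "c.mean (\<lambda>x. \<Sum>n<d. norm (\<Sum>A\<in>?\<A>. g0 n A x)) + t * c.mean (\<lambda>x. l2_part {..<d} (\<lambda>n. \<Sum>A\<in>?\<A>. g1 n A x)) \<le>
      2 ^ (m + 3) * c.mean (\<lambda>x. \<Sum>n<d. inner (G n x) (\<Sum>A\<in>?\<A>. f n A x)) + e"
  proof (rule c.finite_decomposition[where f = f and m = m and t = t and \<eta> = e and d = d, OF fc \<open>0 < t\<close> \<open>0 < e\<close>], goal_cases)
    case (2 g0 g1 G)
    show ?case by (rule that) (fact 2[folded L_def])+
  qed
  define h0 where "h0 x = cutoff d (\<lambda>n. \<Sum>A\<in>?\<A>. g0 n A (c.encode x))" for x
  define h1 where "h1 x = cutoff d (\<lambda>n. \<Sum>A\<in>?\<A>. g1 n A (c.encode x))" for x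
  have h0U: "h0 \<in> U1_vec M m (lp_space 1) (lp_norm 1)"
    unfolding h0_def[abs_def] by (rule l1.homogeneous_U1_vec[OF q g0])
  have h1U: "h1 \<in> U1_vec M m (lp_space 2) (lp_norm 2)"
    unfolding h1_def[abs_def] by (rule l2.homogeneous_U1_vec[OF q g1])
  have n0: "l1.bnorm h0 = c.mean (\<lambda>x. \<Sum>n<d. norm (\<Sum>A\<in>?\<A>. g0 n A x))"
    unfolding bochner_L1_norm_def h0_def lp_norm_1_cutoff by (rule c.integral_encode)
  have n1: "l2.bnorm h1 = c.mean (\<lambda>x. l2_part {..<d} (\<lambda>n. \<Sum>A\<in>?\<A>. g1 n A x))"
    unfolding bochner_L1_norm_def h1_def lp_norm_2_cutoff by (rule c.integral_encode)
  have ssum: "s0 x n + s1 x n = h0 x n + h1 x n" for x n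
    using fg[of n _ "c.encode x"] c.encode_words
    by (auto simp: s0_def s1_def h0_def h1_def cutoff_def f_def sum.distrib[symmetric] intro!: sum.cong)

  have y: "f0 + f1 = ((f0 - s0) + h0) + ((f1 - s1) + h1)"
  proof (rule ext, rule ext)
    fix x n
    show "(f0 + f1) x n = (((f0 - s0) + h0) + ((f1 - s1) + h1)) x n"
      using ssum[of x n] by (simp add: algebra_simps)
  qed
  have y0U: "(f0 - s0) + h0 \<in> U1_vec M m (lp_space 1) (lp_norm 1)"
    by (intro l1.U1_vec_add l1.U1_vec_diff f0 s0U h0U)
  have y1U: "(f1 - s1) + h1 \<in> U1_vec M m (lp_space 2) (lp_norm 2)"
    by (intro l2.U1_vec_add l2.U1_vec_diff f1 s1U h1U)
  have t0: "l1.tame \<P> (f0 - s0)"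
    by (rule l1.U1_vec_tame[OF l1.U1_vec_diff[OF f0 s0U]])
  have t1: "l2.tame \<P> (f1 - s1)"
    by (rule l2.U1_vec_tame[OF l2.U1_vec_diff[OF f1 s1U]])
  have "K_functional (U1_vec M m (lp_space 1) (lp_norm 1)) (bochner_L1_norm \<P> (lp_norm 1))
      (U1_vec M m (lp_space 2) (lp_norm 2)) (bochner_L1_norm \<P> (lp_norm 2)) (f0 + f1) t
    \<le> l1.bnorm ((f0 - s0) + h0) + t * l2.bnorm ((f1 - s1) + h1)"
    by (rule K_functional_le[OF y0U y1U y]) (use \<open>0 < t\<close> l1.bochner_nonneg l2.bochner_nonneg in auto)
  also have "\<dots> \<le> (l1.bnorm (f0 - s0) + l1.bnorm h0) + t * (l2.bnorm (f1 - s1) + l2.bnorm h1)"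
    using \<open>0 < t\<close>
    by (intro add_mono mult_left_mono l1.tame_add(2) l2.tame_add(2) t0 t1 l1.U1_vec_tame[OF h0U] l2.U1_vec_tame[OF h1U]) auto
  also have "\<dots> \<le> (2 * e + l1.bnorm h0) + t * (2 * e + l2.bnorm h1)"
    using \<open>0 < t\<close> r0 r1 by (intro add_mono mult_left_mono) auto
  also have "\<dots> = 2 * (1 + t) * e + (l1.bnorm h0 + t * l2.bnorm h1)"
    by (simp add: algebra_simps)
  also have "l1.bnorm h0 + t * l2.bnorm h1 \<le> 2 ^ (m + 3) * c.mean (\<lambda>x. \<Sum>n<d. inner (G n x) (\<Sum>A\<in>?\<A>. f n A x)) + e"
    unfolding n0 n1 by (rule gG)
  also have "c.mean (\<lambda>x. \<Sum>n<d. inner (G n x) (\<Sum>A\<in>?\<A>. f n A x)) \<le>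
      L * (l1.bnorm k0 + t * l2.bnorm k1) + L * (2 * e + t * (2 * e))"
  proof -
    have p1: "\<bar>\<Sum>n<d. inner (G n (c.encode x)) (z n)\<bar> \<le> L * lp_norm 1 z" if "z \<in> lp_space 1" for x z
    proof -
      have "\<bar>\<Sum>n<d. inner (G n (c.encode x)) (z n)\<bar> \<le> (\<Sum>n<d. L * norm (z n))"
      proof (rule order_trans[OF sum_abs], intro sum_mono)
        fix n assume "n \<in> {..<d}"
        have "\<bar>inner (G n (c.encode x)) (z n)\<bar> \<le> norm (G n (c.encode x)) * norm (z n)"
          by (rule Cauchy_Schwarz_ineq2)
        also have "\<dots> \<le> L * norm (z n)"
          using G1[OF _ c.encode_words] \<open>n \<in> {..<d}\<close> by (intro mult_right_mono) auto
        finally show "\<bar>inner (G n (c.encode x)) (z n)\<bar> \<le> L * norm (z n)" .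
      qed
      also have "\<dots> \<le> L * lp_norm 1 z"
        using sum_le_lp_norm_1[OF that, of d] \<open>0 \<le> L\<close> by (simp add: sum_distrib_left[symmetric] mult_left_mono)
      finally show ?thesis .
    qed
    have p2: "\<bar>\<Sum>n<d. inner (G n (c.encode x)) (z n)\<bar> \<le> L * t * lp_norm 2 z" if "z \<in> lp_space 2" for x z
    proof -
      have "\<bar>\<Sum>n<d. inner (G n (c.encode x)) (z n)\<bar> \<le> (\<Sum>n<d. norm (G n (c.encode x)) * norm (z n))"
        by (rule order_trans[OF sum_abs], intro sum_mono Cauchy_Schwarz_ineq2)
      also have "\<dots> \<le> l2_part {..<d} (\<lambda>n. G n (c.encode x)) * l2_part {..<d} z"
        by (rule sum_inner_le_l2_part)
      also have "\<dots> \<le> (L * t) * lp_norm 2 z"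
        using \<open>0 \<le> L\<close> \<open>0 < t\<close> by (intro mult_mono G2 c.encode_words l2_part_le_lp_norm_2 that) auto
      finally show ?thesis .
    qed
    let ?I = "\<lambda>u. \<integral>x. (\<Sum>n<d. inner (G n (c.encode x)) (u x n)) \<partial>\<P>"
    note P1 = l1.pairing[where G = G and k = k and d = d and L = L, OF q _ p1]
    note P2 = l2.pairing[where G = G and k = k and d = d and L = "L * t", OF q _ p2]
    note tk0 = l1.bochner_tame[OF k0] and tk1 = l2.bochner_tame[OF k1]
    have "c.mean (\<lambda>x. \<Sum>n<d. inner (G n x) (\<Sum>A\<in>?\<A>. f n A x)) =
        (\<integral>x. (\<Sum>n<d. inner (G n (c.encode x)) (\<Sum>A\<in>?\<A>. f n A (c.encode x))) \<partial>\<P>)"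
      by (rule c.integral_encode[symmetric])
    also have "\<dots> = (\<integral>x. ((\<Sum>n<d. inner (G n (c.encode x)) (k0 x n)) + (\<Sum>n<d. inner (G n (c.encode x)) (k1 x n)))
        - ((\<Sum>n<d. inner (G n (c.encode x)) ((f0 - s0) x n)) + (\<Sum>n<d. inner (G n (c.encode x)) ((f1 - s1) x n))) \<partial>\<P>)"
    proof (intro Bochner_Integration.integral_cong refl)
      fix x
      have "(\<Sum>A\<in>?\<A>. f n A (c.encode x)) = k0 x n + k1 x n - ((f0 - s0) x n + (f1 - s1) x n)" if "n < d" for n
      proof -
        have "f0 x n + f1 x n = k0 x n + k1 x n" using eq by (simp add: fun_eq_iff)
        moreover have "(\<Sum>A\<in>?\<A>. f n A (c.encode x)) = s0 x n + s1 x n"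
          using that by (simp add: s0_def s1_def cutoff_def f_def sum.distrib)
        ultimately show ?thesis by (simp add: algebra_simps)
      qed
      then have "(\<Sum>n<d. inner (G n (c.encode x)) (\<Sum>A\<in>?\<A>. f n A (c.encode x))) =
          (\<Sum>n<d. inner (G n (c.encode x)) (k0 x n + k1 x n - ((f0 - s0) x n + (f1 - s1) x n)))"
        by (intro sum.cong) auto
      also have "\<dots> = ((\<Sum>n<d. inner (G n (c.encode x)) (k0 x n)) + (\<Sum>n<d. inner (G n (c.encode x)) (k1 x n)))
        - ((\<Sum>n<d. inner (G n (c.encode x)) ((f0 - s0) x n)) + (\<Sum>n<d. inner (G n (c.encode x)) ((f1 - s1) x n)))"
        by (simp only: inner_add_right inner_diff_right sum.distrib sum_subtractf)
      finally show "(\<Sum>n<d. inner (G n (c.encode x)) (\<Sum>A\<in>?\<A>. f n A (c.encode x))) = \<dots>" .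
    qed
    also have "\<dots> = (?I k0 + ?I k1) - (?I (f0 - s0) + ?I (f1 - s1))"
      using P1(1)[OF tk0] P2(1)[OF tk1] P1(1)[OF t0] P2(1)[OF t1] by simp
    also have "\<dots> \<le> (L * l1.bnorm k0 + L * t * l2.bnorm k1) + (L * l1.bnorm (f0 - s0) + L * t * l2.bnorm (f1 - s1))"
      using P1(2)[OF tk0] P2(2)[OF tk1] P1(2)[OF t0] P2(2)[OF t1] by linarith
    also have "\<dots> \<le> (L * l1.bnorm k0 + L * t * l2.bnorm k1) + (L * (2 * e) + L * t * (2 * e))"
      using r0 r1 \<open>0 \<le> L\<close> \<open>0 < t\<close> by (intro add_mono mult_left_mono order_refl) auto
    also have "\<dots> = L * (l1.bnorm k0 + t * l2.bnorm k1) + L * (2 * e + t * (2 * e))"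
      by (simp add: algebra_simps)
    finally show ?thesis .
  qed
  finally show ?thesis
    by (simp add: C_def L_def[symmetric] algebra_simps)
qed

end

theorem theorem4:
  fixes M :: "'a measure" and m :: nat
  assumes "prob_space M"
  shows "K_closed
    (U1_vec M m (lp_space 1 :: (nat \<Rightarrow> 'k::{real_normed_field, euclidean_space}) set) (lp_norm 1))
    (U1_vec M m (lp_space 2 :: (nat \<Rightarrow> 'k) set) (lp_norm 2))
    (bochner_L1 (infinite_power M) (lp_space 1) (lp_norm 1))
    (bochner_L1_norm (infinite_power M) (lp_norm 1))
    (bochner_L1 (infinite_power M) (lp_space 2) (lp_norm 2))
    (bochner_L1_norm (infinite_power M) (lp_norm 2))"
proof -
  interpret power_space M by (rule power_space.intro[OF assms])
  interpret l1: vector_power M "lp_space 1 :: (nat \<Rightarrow> 'k) set" "lp_norm 1"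
    by (rule vector_power.intro[OF power_space_axioms seq_norm_l1])
  interpret l2: vector_power M "lp_space 2 :: (nat \<Rightarrow> 'k) set" "lp_norm 2"
    by (rule vector_power.intro[OF power_space_axioms seq_norm_l2])
  define C where "C = 2 ^ (m + 3) * (lift_const m * sqrt (2 ^ (m + 3)))"
  have "0 \<le> C" by (simp add: C_def lift_const_def sum_nonneg)
  let ?Y0 = "U1_vec M m (lp_space 1 :: (nat \<Rightarrow> 'k) set) (lp_norm 1)"
  let ?Y1 = "U1_vec M m (lp_space 2 :: (nat \<Rightarrow> 'k) set) (lp_norm 2)"
  show ?thesis
    unfolding K_closed_def
  proof (intro exI[of _ "C + 1"] ballI allI impI)
    fix f and t :: real
    assume "f \<in> {f0 + f1 |f0 f1. f0 \<in> ?Y0 \<and> f1 \<in> ?Y1}" and "0 < t"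
    then obtain f0 f1 where f: "f = f0 + f1" "f0 \<in> ?Y0" "f1 \<in> ?Y1" by blast
    show "K_functional ?Y0 l1.bnorm ?Y1 l2.bnorm f t \<le>
      (C + 1) * K_functional (bochner_L1 \<P> (lp_space 1) (lp_norm 1)) l1.bnorm (bochner_L1 \<P> (lp_space 2) (lp_norm 2)) l2.bnorm f t"
    proof (rule le_K_functional[OF _ _ f(1)])
      show "f0 \<in> bochner_L1 \<P> (lp_space 1) (lp_norm 1)" using f by (simp add: l1.U1_vec_iff)
      show "f1 \<in> bochner_L1 \<P> (lp_space 2) (lp_norm 2)" using f by (simp add: l2.U1_vec_iff)
      show "0 < C + 1" using \<open>0 \<le> C\<close> by simp
      fix k0 k1 :: "(nat \<Rightarrow> 'a) \<Rightarrow> nat \<Rightarrow> 'k"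
      assume k: "k0 \<in> bochner_L1 \<P> (lp_space 1) (lp_norm 1)" "k1 \<in> bochner_L1 \<P> (lp_space 2) (lp_norm 2)" "f = k0 + k1"
      have "K_functional ?Y0 l1.bnorm ?Y1 l2.bnorm f t \<le> C * (l1.bnorm k0 + t * l2.bnorm k1)"
      proof (rule le_add_epsilon)
        show "K_functional ?Y0 l1.bnorm ?Y1 l2.bnorm f t \<le>
            C * (l1.bnorm k0 + t * l2.bnorm k1) + (2 * C * (1 + t) + 2 * (1 + t) + 1) * e" if "0 < e" for e
          using K_estimate[OF f(2,3) k(1,2) _ \<open>0 < t\<close> that] f(1) k(3) by (simp add: C_def)
        show "0 \<le> 2 * C * (1 + t) + 2 * (1 + t) + 1" using \<open>0 \<le> C\<close> \<open>0 < t\<close> by simp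
      qed
      also have "\<dots> \<le> (C + 1) * (l1.bnorm k0 + t * l2.bnorm k1)"
        using \<open>0 < t\<close> l1.bochner_nonneg[of \<P> k0] l2.bochner_nonneg[of \<P> k1]
        by (intro mult_right_mono add_nonneg_nonneg mult_nonneg_nonneg) auto
      finally show "K_functional ?Y0 l1.bnorm ?Y1 l2.bnorm f t \<le> (C + 1) * (l1.bnorm k0 + t * l2.bnorm k1)" .
    qed
  qed
qed

end
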